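(* For every $i\in\omega$, the $i$-th iterated ITRM-jump $0^{(i)}_{\mathrm{ITRM}}$ is Turing-computable from $0^{r}_{\mathrm{ITRM}}$.
   Context: ITRMs are Infinite Time Register Machines (finitely many natural-number registers, transfinite running time, liminf rule at limits with reset to $0$ on infinite liminf). Fix an enumeration $(P_i)$ of ITRM-programs. The ITRM-jump of $x$ is $x'=\{i: P_i^{x}(0)\text{ halts}\}$; $0^{(0)}=\emptyset$, $0^{(i+1)}=(0^{(i)})'$. $\delta(z,y)=1$ if $z=y$, else $0$. The recognizable jump is $0^{r}_{\mathrm{ITRM}}=\{i\in\omega:\exists y\subseteq\omega\,\forall z\subseteq\omega\; P_i^{z}\text{ halts with output }\delta(z,y)\}$. *)

theory Defs
  imports Main "HOL-Library.Nat_Bijection"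
begin

datatype instr =
    Zero nat
  | Inc nat
  | Copy nat nat
  | Jeq nat nat nat
  | Orc nat

type_synonym program = "instr list"

(* configuration: program counter (0-based) and register contents;
   registers not mentioned by the program stay 0 *)
type_synonym config = "nat \<times> (nat \<Rightarrow> nat)"

definition halted :: "program \<Rightarrow> config \<Rightarrow> bool" where
  "halted p c \<longleftrightarrow> length p \<le> fst c"

fun exec :: "nat set \<Rightarrow> instr \<Rightarrow> config \<Rightarrow> config" where
  "exec z (Zero n) (pc, R) = (Suc pc, R(n := 0))"
| "exec z (Inc n) (pc, R) = (Suc pc, R(n := Suc (R n)))"
| "exec z (Copy i j) (pc, R) = (Suc pc, R(j := R i))"
| "exec z (Jeq i j q) (pc, R) = (if R i = R j then q else Suc pc, R)"
| "exec z (Orc n) (pc, R) = (Suc pc, R(n := (if R n \<in> z then 1 else 0)))"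

definition step :: "program \<Rightarrow> nat set \<Rightarrow> config \<Rightarrow> config" where
  "step p z c = (if halted p c then c else exec z (p ! fst c) c)"

definition init_config :: config where
  "init_config = (0, \<lambda>_. 0)"

definition sless :: "'a rel \<Rightarrow> 'a \<Rightarrow> 'a \<Rightarrow> bool" where
  "sless W a b \<longleftrightarrow> (a, b) \<in> W \<and> a \<noteq> b"

definition cofinal_val :: "'a rel \<Rightarrow> 'a \<Rightarrow> ('a \<Rightarrow> nat) \<Rightarrow> nat \<Rightarrow> bool" where
  "cofinal_val W l f v \<longleftrightarrow>
     (\<forall>b. sless W b l \<longrightarrow> (\<exists>g. (b, g) \<in> W \<and> sless W g l \<and> f g = v))"

text \<open>liminf of f below l if finite (= least cofinally occurring value), 0 otherwise.\<close>
definition lim_val :: "'a rel \<Rightarrow> 'a \<Rightarrow> ('a \<Rightarrow> nat) \<Rightarrow> nat" where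
  "lim_val W l f = (if \<exists>v. cofinal_val W l f v then (LEAST v. cofinal_val W l f v) else 0)"

definition is_minimal :: "'a rel \<Rightarrow> 'a \<Rightarrow> bool" where
  "is_minimal W g \<longleftrightarrow> (\<forall>b. (b, g) \<in> W \<longrightarrow> b = g)"

definition imm_pred :: "'a rel \<Rightarrow> 'a \<Rightarrow> 'a \<Rightarrow> bool" where
  "imm_pred W b g \<longleftrightarrow> sless W b g \<and> (\<forall>d. (b, d) \<in> W \<and> (d, g) \<in> W \<longrightarrow> d = b \<or> d = g)"

text \<open>A halting ITRM computation of p with oracle z (all registers initially 0),
  indexed by the well-ordered set Field W, whose greatest element t is the
  (first) halting stage.  Time points are represented by elements of type
  nat set, a carrier of size continuum, which accommodates every countable
  ordinal (and halting times of ITRMs are countable).\<close>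
definition halts_with :: "program \<Rightarrow> nat set \<Rightarrow> nat \<Rightarrow> bool" where
  "halts_with p z out \<longleftrightarrow>
    (\<exists>(W :: nat set rel) (c :: nat set \<Rightarrow> config) t.
       Well_order W \<and> t \<in> Field W \<and> (\<forall>a\<in>Field W. (a, t) \<in> W) \<and>
       (\<forall>g\<in>Field W.
          (is_minimal W g \<longrightarrow> c g = init_config) \<and>
          (\<forall>b. imm_pred W b g \<longrightarrow> c g = step p z (c b)) \<and>
          ((\<not> is_minimal W g \<and> \<not> (\<exists>b. imm_pred W b g)) \<longrightarrow>
              c g = (lim_val W g (\<lambda>b. fst (c b)), \<lambda>j. lim_val W g (\<lambda>b. snd (c b) j))) \<and>
          (g \<noteq> t \<longrightarrow> \<not> halted p (c g))) \<and>
       halted p (c t) \<and> snd (c t) 0 = out)"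

definition halts :: "program \<Rightarrow> nat set \<Rightarrow> bool" where
  "halts p z \<longleftrightarrow> (\<exists>out. halts_with p z out)"

definition instr_of :: "nat \<Rightarrow> instr" where
  "instr_of m = (let k = m mod 5; r = m div 5 in
     if k = 0 then Zero r
     else if k = 1 then Inc r
     else if k = 2 then Copy (fst (prod_decode r)) (snd (prod_decode r))
     else if k = 3 then Jeq (fst (prod_decode r)) (fst (prod_decode (snd (prod_decode r))))
                            (snd (prod_decode (snd (prod_decode r))))
     else Orc r)"

definition P :: "nat \<Rightarrow> program" where
  "P i = map instr_of (list_decode i)"

definition itrm_jump :: "nat set \<Rightarrow> nat set" where
  "itrm_jump x = {i. halts (P i) x}"

fun itrm_jump_iter :: "nat \<Rightarrow> nat set" where
  "itrm_jump_iter 0 = {}"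
| "itrm_jump_iter (Suc n) = itrm_jump (itrm_jump_iter n)"

definition delta :: "nat set \<Rightarrow> nat set \<Rightarrow> nat" where
  "delta z y = (if z = y then 1 else 0)"

definition itrm_rec_jump :: "nat set" where
  "itrm_rec_jump = {i. \<exists>y :: nat set. \<forall>z :: nat set. halts_with (P i) z (delta z y)}"

datatype recf =
    RZ | RS | RProj nat | RComp recf "recf list" | RPrec recf recf | RMn recf | ROrc

inductive reval :: "nat set \<Rightarrow> recf \<Rightarrow> nat list \<Rightarrow> nat \<Rightarrow> bool" for A where
  zero: "reval A RZ xs 0"
| suc: "reval A RS (x # xs) (Suc x)"
| proj: "i < length xs \<Longrightarrow> reval A (RProj i) xs (xs ! i)"
| orc: "reval A ROrc (x # xs) (if x \<in> A then 1 else 0)"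
| comp: "list_all2 (\<lambda>g y. reval A g xs y) gs ys \<Longrightarrow> reval A f ys z \<Longrightarrow> reval A (RComp f gs) xs z"
| prec0: "reval A f xs y \<Longrightarrow> reval A (RPrec f g) (0 # xs) y"
| precS: "reval A (RPrec f g) (n # xs) y \<Longrightarrow> reval A g (y # n # xs) z \<Longrightarrow>
          reval A (RPrec f g) (Suc n # xs) z"
| mn: "reval A f (n # xs) 0 \<Longrightarrow> (\<forall>m<n. \<exists>y. reval A f (m # xs) y \<and> y \<noteq> 0) \<Longrightarrow>
       reval A (RMn f) xs n"

definition turing_reducible :: "nat set \<Rightarrow> nat set \<Rightarrow> bool" where
  "turing_reducible B A \<longleftrightarrow>
     (\<exists>f. \<forall>n. reval A f [n] (if n \<in> B then 1 else 0))"

end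

theory Submission
  imports Defs "HOL-Library.Countable_Set_Type"
begin

text \<open>
  The recognizable jump decides, uniformly in a program, whether it halts on all oracles: let the
  program afterwards output whether its oracle is empty. Hence it suffices to find an ITRM-decidable
  nonempty set of certificates, each of which computes all \<open>itrm_jump_iter i\<close>: the program that checks
  whether its oracle is a certificate and, if so, runs \<open>P n\<close> with the \<open>i\<close>-th jump read off from it,
  halts on all oracles iff \<open>n\<close> lies in the next jump. No uniqueness of the certificate is needed.

  A certificate is a well-order of the natural numbers together with the runs of all \<open>P k\<close> with all
  iterated jumps as oracles along it, long enough that all these runs loop simultaneously
  between two fixed stages. A run that returns to a configuration
  without any entry dropping below it in between repeats forever, so halting can be read off at the
  loop. Such stages exist below \<open>\<omega>\<^sub>1\<close> by a closure argument. Being a certificate amounts to a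
  universal arithmetical condition and well-foundedness, which an ITRM decides by depth-first search.
\<close>

section \<open>Well-orders\<close>

text \<open>An index must be correct on every oracle, so a check that diverges on bad candidates is
  useless: rejection has to halt as well. Ill-founded orders can be rejected because a register that
  grows without bound is reset to 0 at the limit, which makes infinite descent visible. The levels
  are not verified one after another: a single certificate holds the runs of all levels, level j+1
  takes its oracle bits from level j of the same certificate, and induction on the level shows these
  bits to be right. Existence of a certificate serves the case that \<open>P n\<close> diverges: the
  constructed program then diverges on that certificate, so it recognizes nothing. Each successor
  jump thereby becomes many-one reducible to the recognizable jump. A recurring difficulty is that
  the limit rule sees intermediate values. Specifications of code therefore speak about the whole
  set of configurations passed, and a simulation has to preserve which values recur cofinally, not
  only the end configurations.\<close>

locale wellord =
  fixes W :: "'a rel"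
  assumes wo: "Well_order W"
begin

abbreviation le where "le a b \<equiv> (a, b) \<in> W"
abbreviation lt where "lt a b \<equiv> sless W a b"

lemma le_Field: "le a b \<Longrightarrow> a \<in> Field W \<and> b \<in> Field W"
  by (auto simp: Field_def)

lemma lt_Field: "lt a b \<Longrightarrow> a \<in> Field W \<and> b \<in> Field W"
  by (auto simp: sless_def le_Field)

lemma le_refl: "a \<in> Field W \<Longrightarrow> le a a"
  using wo by (auto simp: order_on_defs refl_on_def)

lemma le_trans: "le a b \<Longrightarrow> le b c \<Longrightarrow> le a c"
  using wo by (auto simp: order_on_defs trans_def)

lemma le_antisym: "le a b \<Longrightarrow> le b a \<Longrightarrow> a = b"
  using wo by (auto simp: order_on_defs antisym_def)

lemma lt_le: "lt a b \<Longrightarrow> le a b"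
  by (simp add: sless_def)

lemma lt_irrefl: "\<not> lt a a"
  by (simp add: sless_def)

lemma le_lt_trans: "le a b \<Longrightarrow> lt b c \<Longrightarrow> lt a c"
  by (metis le_trans le_antisym sless_def)

lemma lt_le_trans: "lt a b \<Longrightarrow> le b c \<Longrightarrow> lt a c"
  by (metis le_trans le_antisym sless_def)

lemma lt_trans: "lt a b \<Longrightarrow> lt b c \<Longrightarrow> lt a c"
  by (metis lt_le le_lt_trans)

lemma le_or_lt: "a \<in> Field W \<Longrightarrow> b \<in> Field W \<Longrightarrow> le a b \<or> lt b a"
  using wo unfolding order_on_defs total_on_def sless_def refl_on_def by metis

lemma not_lt: "le a b \<Longrightarrow> \<not> lt b a"
  by (metis le_lt_trans lt_irrefl)

lemma le_iff: "le a b \<longleftrightarrow> lt a b \<or> (a = b \<and> a \<in> Field W)"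
  by (metis le_Field le_refl sless_def)

lemma wf_lt: "wf {(a, b). lt a b}"
proof -
  have "{(a, b). lt a b} = W - Id" by (auto simp: sless_def)
  then show ?thesis using wo by (simp add: well_order_on_def)
qed

lemma ex_least:
  assumes "x \<in> X" "X \<subseteq> Field W"
  obtains m where "m \<in> X" "\<And>y. y \<in> X \<Longrightarrow> le m y"
proof -
  obtain m where "m \<in> X" "\<And>y. lt y m \<Longrightarrow> y \<notin> X"
    using wfE_min[OF wf_lt assms(1)] by auto
  with assms(2) show ?thesis by (metis that le_or_lt subsetD)
qed

lemma lt_induct:
  assumes "\<And>a. (\<And>b. lt b a \<Longrightarrow> Q b) \<Longrightarrow> Q a"
  shows "Q a"
  using wf_induct[OF wf_lt, of Q a] assms by auto

definition is_limit :: "'a \<Rightarrow> bool" where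
  "is_limit g \<longleftrightarrow> g \<in> Field W \<and> \<not> is_minimal W g \<and> \<not> (\<exists>b. imm_pred W b g)"

lemma limit_between: "is_limit g \<Longrightarrow> lt b g \<Longrightarrow> \<exists>d. lt b d \<and> lt d g"
  unfolding is_limit_def imm_pred_def by (metis sless_def)

lemma limit_below: "is_limit g \<Longrightarrow> \<exists>b. lt b g"
  unfolding is_limit_def is_minimal_def by (metis sless_def)

lemma not_minimal: "lt a g \<Longrightarrow> \<not> is_minimal W g"
  unfolding is_minimal_def by (metis sless_def)

lemma imm_pred_lt: "imm_pred W q b \<Longrightarrow> lt q b"
  by (simp add: imm_pred_def)

lemma imm_pred_le: "imm_pred W q b \<Longrightarrow> lt a b \<Longrightarrow> le a q"
  unfolding imm_pred_def by (metis le_or_lt lt_Field lt_le lt_irrefl)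

lemma imm_pred_unique: "imm_pred W q b \<Longrightarrow> imm_pred W q' b \<Longrightarrow> q = q'"
  by (meson imm_pred_lt imm_pred_le le_antisym)

text \<open>\<open>L\<close> is the least strict upper bound of \<open>X\<close>. An immediate
  predecessor of \<open>L\<close> would lie below some element of \<open>X\<close>, which in turn
  lies below \<open>L\<close>; this is impossible.\<close>

lemma strict_sup:
  assumes "x \<in> X" "X \<subseteq> Field W" "\<And>x. x \<in> X \<Longrightarrow> \<exists>y\<in>X. lt x y"
    and "\<And>x. x \<in> X \<Longrightarrow> le x u"
  obtains L where "is_limit L" "le L u" "\<And>x. x \<in> X \<Longrightarrow> lt x L"
    "\<And>g. lt g L \<Longrightarrow> \<exists>x\<in>X. lt g x"
proof -
  let ?U = "{u \<in> Field W. \<forall>x\<in>X. lt x u}"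
  have u: "u \<in> ?U" using assms by (smt (verit) le_Field lt_le_trans mem_Collect_eq)
  then obtain L where L: "L \<in> ?U" and least: "\<And>y. y \<in> ?U \<Longrightarrow> le L y"
    using ex_least[of u ?U] by blast
  have cof: "\<exists>x\<in>X. lt g x" if g: "lt g L" for g
  proof -
    have "g \<notin> ?U" using least g not_lt by blast
    then obtain y where "y \<in> X" "\<not> lt y g" using g lt_Field by blast
    then show ?thesis using assms(2,3) g
      by (metis le_lt_trans le_or_lt lt_Field subsetD)
  qed
  have "\<not> imm_pred W b L" for b
  proof
    assume b: "imm_pred W b L"
    then obtain x where "x \<in> X" "lt b x" using cof[OF imm_pred_lt] by blast
    moreover have "lt x L" using L \<open>x \<in> X\<close> by blast
    ultimately show False using imm_pred_le[OF b] not_lt by blast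
  qed
  then have "is_limit L"
    using L assms(1) not_minimal unfolding is_limit_def by blast
  then show ?thesis using that L least[OF u] cof by blast
qed

lemma lim_val_eqI:
  assumes "\<And>b. lt b L \<Longrightarrow> \<exists>g. le b g \<and> lt g L \<and> f g = v"
    and "lt a L" "\<And>g. le a g \<Longrightarrow> lt g L \<Longrightarrow> v \<le> f g"
  shows "lim_val W L f = v"
proof -
  have v: "cofinal_val W L f v" using assms(1) by (simp add: cofinal_val_def)
  have "v \<le> w" if "cofinal_val W L f w" for w
    using that assms(2,3) unfolding cofinal_val_def by blast
  then have "(LEAST v. cofinal_val W L f v) = v" using v by (intro Least_equality)
  then show ?thesis using v by (auto simp: lim_val_def)
qed

end

section \<open>Transfinite runs of countable length\<close>

text \<open>Program counter and registers share one index, since both obey the same liminf rule.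
  Limit conditions and pointwise comparisons of configurations then become single quantified
  statements.\<close>

fun entry :: "config \<Rightarrow> nat \<Rightarrow> nat" where
  "entry c 0 = fst c"
| "entry c (Suc r) = snd c r"

lemma config_eqI: "(\<And>e. entry c e = entry d e) \<Longrightarrow> c = d"
  by (metis entry.simps prod_eqI ext)

text \<open>The omega-indexed form of \<open>cofinal_val\<close>: \<open>A n\<close> is meant to
  collect the values taken in the n-th segment of a computation.\<close>

definition often :: "(nat \<Rightarrow> nat set) \<Rightarrow> nat \<Rightarrow> bool" where
  "often A v \<longleftrightarrow> (\<forall>n. \<exists>m\<ge>n. v \<in> A m)"

definition liminf :: "(nat \<Rightarrow> nat set) \<Rightarrow> nat" where
  "liminf A = (if \<exists>v. often A v then LEAST v. often A v else 0)"

definition limc :: "(nat \<Rightarrow> config set) \<Rightarrow> config" where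
  "limc A = (liminf (\<lambda>n. fst ` A n), \<lambda>j. liminf (\<lambda>n. (\<lambda>d. snd d j) ` A n))"

lemma entry_limc: "entry (limc A) e = liminf (\<lambda>n. (\<lambda>d. entry d e) ` A n)"
  by (cases e) (auto simp: limc_def)

lemma liminf_eqI:
  assumes "often A v" "\<And>n w. w \<in> A n \<Longrightarrow> v \<le> w"
  shows "liminf A = v"
  using assms unfolding liminf_def by (metis (mono_tags, lifting) Least_equality often_def)

lemma often_tail:
  assumes "\<And>n. n \<ge> k \<Longrightarrow> A n = B n"
  shows "often A = often B"
proof (rule ext)
  have "often A v \<longleftrightarrow> (\<forall>n\<ge>k. \<exists>m\<ge>n. v \<in> A m)" for A v
    unfolding often_def by (meson le_trans nat_le_linear)
  then show "often A v = often B v" for v using assms by (metis le_trans)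
qed

text \<open>\<open>run p z c S d\<close>: started in \<open>c\<close>, the machine reaches \<open>d\<close> after countably many stages, and
  \<open>S\<close> is the set of configurations passed strictly before \<open>d\<close>. A countable limit stage is the
  supremum of an \<open>\<omega>\<close>-sequence of stages, so \<open>\<omega>\<close>-limits of runs suffice.\<close>

inductive run :: "program \<Rightarrow> nat set \<Rightarrow> config \<Rightarrow> config set \<Rightarrow> config \<Rightarrow> bool" for p z where
  refl: "run p z c {} c"
| step: "run p z c S d \<Longrightarrow> \<not> halted p d \<Longrightarrow> run p z c (insert d S) (step p z d)"
| lim: "(\<And>n. run p z (f n) (A n) (f (Suc n))) \<Longrightarrow> (\<And>n. A n \<noteq> {}) \<Longrightarrow>
    run p z (f 0) (\<Union>n. A n) (limc A)"

lemma run_trans: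
  assumes "run p z d T e" "run p z c S d"
  shows "run p z c (S \<union> T) e"
  using assms
proof (induction arbitrary: S c rule: run.induct)
  case (refl d)
  then show ?case by simp
next
  case (step d T e)
  then show ?case using run.step by fastforce
next
  case (lim f A)
  \<comment> \<open>The earlier run is absorbed into segment 0; a single segment does not influence
    which values occur often.\<close>
  let ?A = "A(0 := S \<union> A 0)" and ?f = "f(0 := c)"
  have "run p z (?f 0) (\<Union>n. ?A n) (limc ?A)"
  proof (rule run.lim[of p z ?f ?A])
    show "run p z (?f n) (?A n) (?f (Suc n))" for n
      using lim by (cases n) auto
    show "?A n \<noteq> {}" for n using lim by auto
  qed
  moreover have "(\<Union>n. ?A n) = S \<union> (\<Union>n. A n)"
    using UN_absorb[of 0 UNIV A] by (auto split: if_splits) (metis neq0_conv)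
  moreover have "limc ?A = limc A"
  proof (rule config_eqI)
    fix e
    have "often (\<lambda>n. (\<lambda>d. entry d e) ` ?A n) = often (\<lambda>n. (\<lambda>d. entry d e) ` A n)"
      by (rule often_tail[of 1]) auto
    then show "entry (limc ?A) e = entry (limc A) e"
      by (simp only: entry_limc liminf_def)
  qed
  ultimately show ?case by simp
qed

lemma run_start: "run p z c S d \<Longrightarrow> S = {} \<and> d = c \<or> c \<in> S"
  by (induction rule: run.induct) auto

lemma run_not_halted: "run p z c S d \<Longrightarrow> e \<in> S \<Longrightarrow> \<not> halted p e"
  by (induction rule: run.induct) auto

lemma run_step1: "\<not> halted p c \<Longrightarrow> run p z c {c} (Defs.step p z c)"
  using run.step[OF run.refl] by fastforce

lemma halted_step: "halted p c \<Longrightarrow> Defs.step p z c = c"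
  by (simp add: step_def)

section \<open>Runs along a well-order\<close>

text \<open>The local clauses of \<open>halts_with\<close> without a final stage. Because
  \<open>step\<close> fixes halted configurations, such a run continues along the entire well-order
  even after halting.\<close>

definition run_on :: "program \<Rightarrow> nat set \<Rightarrow> 'a rel \<Rightarrow> ('a \<Rightarrow> config) \<Rightarrow> bool" where
  "run_on p z W c \<longleftrightarrow> (\<forall>g\<in>Field W.
     (is_minimal W g \<longrightarrow> c g = init_config) \<and>
     (\<forall>b. imm_pred W b g \<longrightarrow> c g = Defs.step p z (c b)) \<and>
     (\<not> is_minimal W g \<and> \<not> (\<exists>b. imm_pred W b g) \<longrightarrow>
       (\<forall>e. entry (c g) e = lim_val W g (\<lambda>b. entry (c b) e))))"

lemma limit_config_iff:
  "c = (lim_val W g (\<lambda>b. fst (C b)), \<lambda>j. lim_val W g (\<lambda>b. snd (C b) j)) \<longleftrightarrow>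
    (\<forall>e. entry c e = lim_val W g (\<lambda>b. entry (C b) e))" (is "?l \<longleftrightarrow> ?r")
proof
  assume ?l
  then have "entry c e = lim_val W g (\<lambda>b. entry (C b) e)" for e by (cases e) simp_all
  then show ?r by blast
next
  assume r: ?r
  show ?l
    using spec[OF r, of 0] spec[OF r, of "Suc _"] by (auto simp: prod_eq_iff)
qed

context wellord
begin

abbreviation seg where "seg a b \<equiv> {g. le a g \<and> lt g b}"

text \<open>Every stage from \<open>b 0\<close> on and below \<open>L\<close> lies in a segment
  between consecutive \<open>b n\<close>, so a value is taken cofinally below \<open>L\<close> iff
  it is taken in infinitely many segments.\<close>

lemma lim_val_cofinal_seq:
  fixes b :: "nat \<Rightarrow> 'a"
  assumes inc: "\<And>n. lt (b n) (b (Suc n))" and below: "\<And>n. lt (b n) L"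
    and cof: "\<And>g. lt g L \<Longrightarrow> \<exists>n. lt g (b n)"
  shows "lim_val W L f = liminf (\<lambda>n. f ` seg (b n) (b (Suc n)))"
    and "(\<Union>n. seg (b n) (b (Suc n))) = seg (b 0) L"
proof -
  have mono: "le (b m) (b n)" if "m \<le> n" for m n
    using that by (induction n rule: dec_induct) (meson inc le_refl le_trans lt_Field lt_le)+
  have loc: "\<exists>m\<ge>n. g \<in> seg (b m) (b (Suc m))" if g: "lt g L" "le (b n) g" for g n
  proof -
    \<comment> \<open>The segment containing \<open>g\<close> ends at the first \<open>b k\<close>
      above \<open>g\<close>. This \<open>k\<close> exceeds \<open>n\<close>, so it has a
      predecessor.\<close>
    define k where "k = (LEAST k. lt g (b k))"
    have k: "lt g (b k)" unfolding k_def using cof[OF g(1)] by (rule LeastI_ex)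
    then have "n < k" using g(2) mono[of k n] by (meson not_lt le_trans linorder_not_less)
    then obtain m where m: "k = Suc m" by (cases k) auto
    then have "\<not> lt g (b m)" unfolding k_def by (metis lessI not_less_Least)
    then have "le (b m) g" using le_or_lt g(1) inc lt_Field by meson
    then show ?thesis using m k \<open>n < k\<close> by (intro exI[of _ m]) auto
  qed
  have "cofinal_val W L f v \<longleftrightarrow> often (\<lambda>n. f ` seg (b n) (b (Suc n))) v" for v
  proof
    assume c: "cofinal_val W L f v"
    show "often (\<lambda>n. f ` seg (b n) (b (Suc n))) v"
      unfolding often_def
    proof
      fix n
      obtain g where "le (b n) g" "lt g L" "f g = v"
        using c below unfolding cofinal_val_def by blast
      then show "\<exists>m\<ge>n. v \<in> f ` seg (b m) (b (Suc m))" using loc by blast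
    qed
  next
    assume o: "often (\<lambda>n. f ` seg (b n) (b (Suc n))) v"
    show "cofinal_val W L f v"
      unfolding cofinal_val_def
    proof (intro allI impI)
      fix x assume "lt x L"
      then obtain n where n: "lt x (b n)" using cof by blast
      obtain m g where m: "m \<ge> n" "le (b m) g" "lt g (b (Suc m))" "f g = v"
        using o unfolding often_def by blast
      then have "le x g" using n mono by (meson le_trans lt_le)
      moreover have "lt g L" using m below lt_trans by blast
      ultimately show "\<exists>g. le x g \<and> lt g L \<and> f g = v" using m by blast
    qed
  qed
  then have "cofinal_val W L f = often (\<lambda>n. f ` seg (b n) (b (Suc n)))" by blast
  then show "lim_val W L f = liminf (\<lambda>n. f ` seg (b n) (b (Suc n)))"
    by (simp add: lim_val_def liminf_def)
  show "(\<Union>n. seg (b n) (b (Suc n))) = seg (b 0) L"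
  proof (rule set_eqI)
    fix g
    have "g \<in> seg (b 0) L" if "g \<in> seg (b n) (b (Suc n))" for n
      using that mono[of 0 n] below lt_trans le_trans by blast
    then show "g \<in> (\<Union>n. seg (b n) (b (Suc n))) \<longleftrightarrow> g \<in> seg (b 0) L"
      using loc[of g 0] by auto
  qed
qed

lemma seg_empty: "le a b \<Longrightarrow> seg a b = {} \<longleftrightarrow> a = b"
  using le_Field le_refl not_lt by (force simp: sless_def)

lemma seg_Un: "le a b \<Longrightarrow> le b c \<Longrightarrow> seg a b \<union> seg b c = seg a c"
  using le_or_lt le_Field by (blast intro: le_trans lt_le_trans)

lemma seg_imm_pred: "imm_pred W q b \<Longrightarrow> le a q \<Longrightarrow> seg a b = insert q (seg a q)"
  using imm_pred_le[of q b] unfolding imm_pred_def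
  by (auto simp: le_iff intro: lt_trans)

lemma run_on_limit:
  "run_on p z W c \<Longrightarrow> is_limit g \<Longrightarrow> entry (c g) e = lim_val W g (\<lambda>b. entry (c b) e)"
  unfolding run_on_def is_limit_def by blast

lemma run_on_succ: "run_on p z W c \<Longrightarrow> imm_pred W q b \<Longrightarrow> c b = Defs.step p z (c q)"
  unfolding run_on_def using lt_Field imm_pred_lt by blast

lemma run_on_limit_seq:
  assumes "run_on p z W c" "is_limit L"
    and "\<And>n. lt (b n) (b (Suc n))" "\<And>n. lt (b n) L" "\<And>g. lt g L \<Longrightarrow> \<exists>n. lt g (b n)"
  shows "c L = limc (\<lambda>n. c ` seg (b n) (b (Suc n)))"
  using lim_val_cofinal_seq(1)[OF assms(3-5)] run_on_limit[OF assms(1,2)]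
  by (intro config_eqI) (simp add: entry_limc image_image)

lemma ex_succ:
  assumes "lt b u"
  obtains b' where "imm_pred W b b'"
proof -
  have "u \<in> {y. lt b y}" "{y. lt b y} \<subseteq> Field W" using assms lt_Field by auto
  then obtain b' where b': "lt b b'" "\<And>y. lt b y \<Longrightarrow> le b' y"
    by (rule ex_least) simp
  then have "imm_pred W b b'"
    unfolding imm_pred_def by (metis le_antisym sless_def)
  then show ?thesis by (rule that)
qed

text \<open>Uncountable cofinality in the form used below: stages chosen for countably many
  requirements can always be passed. Applied to a singleton, it also excludes a last stage.\<close>

definition omega_bounded :: bool where
  "omega_bounded \<longleftrightarrow> (\<forall>X. X \<subseteq> Field W \<longrightarrow> countable X \<longrightarrow> (\<exists>u\<in>Field W. \<forall>x\<in>X. lt x u))"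

lemma omega_bounded_no_top:
  assumes omega_bounded "b \<in> Field W"
  shows "\<exists>u. lt b u"
proof -
  have "{b} \<subseteq> Field W" "countable {b}" using assms(2) by auto
  then show ?thesis using assms(1) unfolding omega_bounded_def by blast
qed

text \<open>The second disjunct is the case that the well-order ends before the run does.\<close>

lemma run_follow:
  assumes "run p z d S d'" "run_on p z W c" "a \<in> Field W" "c a = d"
  shows "(\<exists>b. le a b \<and> c b = d' \<and> S = c ` seg a b) \<or> c ` {g. le a g} \<subseteq> S \<and> \<not> omega_bounded"
  using assms
proof (induction arbitrary: a rule: run.induct)
  case (refl d)
  then have "le a a \<and> c a = d \<and> {} = c ` seg a a" using le_refl seg_empty[of a a] by simp
  then show ?case by blast
next
  case (step d S d')
  from step.IH[OF step.prems] show ?case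
  proof
    assume "\<exists>b. le a b \<and> c b = d' \<and> S = c ` seg a b"
    then obtain b where b: "le a b" "c b = d'" "S = c ` seg a b" by blast
    show ?thesis
    proof (cases "\<exists>u. lt b u")
      case True
      then obtain b' where b': "imm_pred W b b'" using ex_succ by blast
      then have "c b' = Defs.step p z d'" using run_on_succ step.prems(1) b by blast
      moreover have "insert d' S = c ` seg a b'" using seg_imm_pred[OF b' b(1)] b by auto
      moreover have "le a b'" using b(1) imm_pred_lt[OF b'] by (meson le_trans lt_le)
      ultimately show ?thesis by blast
    next
      case False
      then have "le a g \<Longrightarrow> lt g b \<or> g = b" for g
        using le_or_lt[of g b] le_Field b(1) by (meson le_iff)
      then have "c ` {g. le a g} \<subseteq> insert d' S" using b by auto
      moreover have "\<not> omega_bounded"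
        using False le_Field[OF b(1)] omega_bounded_no_top by blast
      ultimately show ?thesis by blast
    qed
  qed blast
next
  case (lim f A)
  show ?case
  proof (rule disjCI)
    assume neg: "\<not> (c ` {g. le a g} \<subseteq> (\<Union>n. A n) \<and> \<not> omega_bounded)"
    let ?Q = "\<lambda>n x. le a x \<and> c x = f n \<and> c ` seg a x \<subseteq> (\<Union>n. A n)"
    let ?R = "\<lambda>n x y. lt x y \<and> A n = c ` seg x y"
    have "\<exists>b. \<forall>n. (?Q n (b n) \<and> (n = 0 \<longrightarrow> b n = a)) \<and> ?R n (b n) (b (Suc n))"
    proof (rule dependent_nat_choice)
      show "\<exists>x. ?Q 0 x \<and> (0 = (0::nat) \<longrightarrow> x = a)"
        using lim.prems le_refl seg_empty[of a a] by (intro exI[of _ a]) auto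
    next
      fix x n assume x: "?Q n x \<and> (n = 0 \<longrightarrow> x = a)"
      have "\<not> (c ` {g. le x g} \<subseteq> A n \<and> \<not> omega_bounded)"
      proof
        assume *: "c ` {g. le x g} \<subseteq> A n \<and> \<not> omega_bounded"
        have "c g \<in> (\<Union>n. A n)" if "le a g" for g
        proof (cases "le x g")
          case True
          then show ?thesis using * by blast
        next
          case False
          then have "lt g x" using le_or_lt that x le_Field by metis
          then show ?thesis using that x by blast
        qed
        then show False using neg * by blast
      qed
      moreover have "x \<in> Field W" "c x = f n" using x le_Field by blast+
      ultimately obtain y where y: "le x y" "c y = f (Suc n)" "A n = c ` seg x y"
        using lim.IH[OF lim.prems(1), of x n] by blast
      have "x \<noteq> y" using y(3) lim.hyps(2)[of n] seg_empty[OF y(1)] by auto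
      then have "lt x y" using y(1) by (simp add: sless_def)
      moreover have "c ` seg a y \<subseteq> (\<Union>n. A n)"
      proof -
        have "seg a y = seg a x \<union> seg x y" using seg_Un[of a x y] x y(1) by simp
        then have "c ` seg a y = c ` seg a x \<union> A n" using y(3) by (simp add: image_Un)
        then show ?thesis using x by blast
      qed
      moreover have "le a y" using x y(1) le_trans by blast
      ultimately show "\<exists>y. (?Q (Suc n) y \<and> (Suc n = 0 \<longrightarrow> y = a)) \<and> ?R n x y"
        using y by (intro exI[of _ y]) simp
    qed
    then obtain b where b': "\<forall>n. (?Q n (b n) \<and> (n = 0 \<longrightarrow> b n = a)) \<and> ?R n (b n) (b (Suc n))" ..
    have b: "?Q n (b n)" "?R n (b n) (b (Suc n))" for n using spec[OF b', of n] by simp_all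
    have b0: "b 0 = a" using spec[OF b', of 0] by simp
    \<comment> \<open>A bound for the chosen stages comes from \<open>omega_bounded\<close> or, in a
      shorter well-order, from a stage \<open>u\<close> whose configuration the run never
      passes.\<close>
    have "\<exists>u. \<forall>x\<in>range b. le x u"
    proof (cases omega_bounded)
      case True
      have "range b \<subseteq> Field W" "countable (range b)" using b(2) lt_Field by blast+
      then obtain u where "\<forall>x\<in>range b. lt x u" using True unfolding omega_bounded_def by blast
      then show ?thesis using lt_le by blast
    next
      case False
      then obtain u where u: "le a u" "c u \<notin> (\<Union>n. A n)" using neg by blast
      have "le (b n) u" for n
      proof -
        have "c u \<notin> c ` seg a (b n)" using b(1)[of n] u(2) by blast
        then have "\<not> lt u (b n)" using u by blast
        then show ?thesis using le_or_lt[of "b n" u] b(1)[of n] u(1) le_Field by metis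
      qed
      then show ?thesis by blast
    qed
    then obtain u where ub: "\<And>x. x \<in> range b \<Longrightarrow> le x u" by blast
    have "a \<in> range b" using b0 by blast
    moreover have "range b \<subseteq> Field W" using b(2) lt_Field by blast
    moreover have "\<exists>y\<in>range b. lt x y" if "x \<in> range b" for x using that b(2) by blast
    ultimately obtain L where L: "is_limit L" "le L u" "\<And>x. x \<in> range b \<Longrightarrow> lt x L"
      "\<And>g. lt g L \<Longrightarrow> \<exists>x\<in>range b. lt g x"
      using ub by (rule strict_sup) blast+
    have *: "\<And>n. lt (b n) (b (Suc n))" "\<And>n. lt (b n) L" "\<And>g. lt g L \<Longrightarrow> \<exists>n. lt g (b n)"
      using b L by blast+
    have "A = (\<lambda>n. c ` seg (b n) (b (Suc n)))" using b(2) by blast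
    then have "c L = limc A" "(\<Union>n. A n) = c ` seg a L"
      using run_on_limit_seq[OF lim.prems(1) L(1) *] lim_val_cofinal_seq(2)[OF *] b0
      by (simp_all flip: image_UN)
    then show "\<exists>b. le a b \<and> c b = limc A \<and> \<Union> (range A) = c ` seg a b"
      using *(2)[of 0] b0 lt_le by blast
  qed
qed


text \<open>Converse of \<open>run_follow\<close>, by induction on the last stage. Countability
  below \<open>b\<close> turns a limit stage into the supremum of an omega-sequence, as
  \<open>run\<close> demands.\<close>

lemma run_between:
  assumes "run_on p z W c" "le a b" "countable {g. lt g b}"
    and "\<And>g. g \<in> seg a b \<Longrightarrow> \<not> halted p (c g)"
  shows "run p z (c a) (c ` seg a b) (c b)"
  using assms
proof (induction b arbitrary: a rule: lt_induct)
  case (1 b)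
  consider "a = b" | q where "lt a b" "imm_pred W q b" | "lt a b" "is_limit b"
    using 1(3) not_minimal unfolding is_limit_def by (metis le_Field sless_def)
  then show ?case
  proof cases
    case 1
    then have "seg a b = {}" using seg_empty[OF \<open>le a b\<close>] by simp
    then have "c ` seg a b = {}" by blast
    then show ?thesis using \<open>a = b\<close> run.refl by metis
  next
    case (2 q)
    have q: "le a q" using imm_pred_le[OF 2(2,1)] .
    have q': "lt q b" using 2(2) by (rule imm_pred_lt)
    have "{g. lt g q} \<subseteq> {g. lt g b}" using q' lt_trans by blast
    then have "countable {g. lt g q}" using 1(4) countable_subset by blast
    then have "run p z (c a) (c ` seg a q) (c q)"
      using 1(1)[OF q' 1(2) q] 1(5) q' lt_trans by blast
    then have "run p z (c a) (insert (c q) (c ` seg a q)) (Defs.step p z (c q))"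
      using run.step 1(5) q q' by blast
    then show ?thesis
      using seg_imm_pred[OF 2(2) q] run_on_succ[OF 1(2) 2(2)] by simp
  next
    case 3
    \<comment> \<open>\<open>e\<close> enumerates the stages below \<open>b\<close>; choosing each
      next stage above \<open>e n\<close> makes the sequence cofinal.\<close>
    define e where "e = from_nat_into {g. lt g b}"
    have ne: "{g. lt g b} \<noteq> {}" using 3 by blast
    have e: "lt (e n) b" for n using from_nat_into[OF ne] e_def by blast
    have "\<exists>x. \<forall>n. (lt (x n) b \<and> (n = 0 \<longrightarrow> x n = a)) \<and> lt (x n) (x (Suc n)) \<and> lt (e n) (x (Suc n))"
    proof (rule dependent_nat_choice)
      show "\<exists>x. lt x b \<and> (0 = (0::nat) \<longrightarrow> x = a)" using 3 by blast
    next
      fix x and n :: nat assume "lt x b \<and> (n = 0 \<longrightarrow> x = a)"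
      then obtain y where "lt y b" "le x y" "le (e n) y"
        using e[of n] le_or_lt[of x "e n"] lt_Field lt_le le_refl by metis
      then show "\<exists>y. (lt y b \<and> (Suc n = 0 \<longrightarrow> y = a)) \<and> lt x y \<and> lt (e n) y"
        using limit_between[OF 3(2)] le_lt_trans by blast
    qed
    then obtain x where
      "\<forall>n. (lt (x n) b \<and> (n = 0 \<longrightarrow> x n = a)) \<and> lt (x n) (x (Suc n)) \<and> lt (e n) (x (Suc n))" ..
    then have x: "\<And>n. lt (x n) b" "x 0 = a" "\<And>n. lt (x n) (x (Suc n))"
      "\<And>n. lt (e n) (x (Suc n))" by simp_all
    have cof: "\<exists>n. lt g (x n)" if "lt g b" for g
      using x(4) that from_nat_into_surj[OF 1(4), of g] unfolding e_def by blast
    have ax: "le a (x n)" for n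
      by (induction n) (use x 1(3) le_Field le_refl le_trans lt_le in \<open>metis\<close>)+
    have "run p z (c (x 0)) (\<Union>n. c ` seg (x n) (x (Suc n))) (limc (\<lambda>n. c ` seg (x n) (x (Suc n))))"
    proof (rule run.lim[where f = "\<lambda>n. c (x n)"])
      fix n
      show "c ` seg (x n) (x (Suc n)) \<noteq> {}"
        using seg_empty[of "x n" "x (Suc n)"] x(3)[of n] lt_le lt_irrefl by auto
      have "{g. lt g (x (Suc n))} \<subseteq> {g. lt g b}" using x(1) lt_trans by blast
      then have "countable {g. lt g (x (Suc n))}" using 1(4) countable_subset by blast
      moreover have "\<not> halted p (c g)" if "g \<in> seg (x n) (x (Suc n))" for g
        using that 1(5)[of g] ax[of n] x(1)[of "Suc n"] le_trans lt_trans by blast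
      ultimately show "run p z (c (x n)) (c ` seg (x n) (x (Suc n))) (c (x (Suc n)))"
        using 1(1)[OF x(1) 1(2) lt_le[OF x(3)]] by blast
    qed
    then show ?thesis
      using run_on_limit_seq[OF 1(2) 3(2) x(3) x(1) cof] lim_val_cofinal_seq(2)[OF x(3) x(1) cof] x(2)
      by (simp flip: image_UN)
  qed
qed

text \<open>Halted configurations are fixed points of \<open>step\<close>, and the liminf of an
  eventually constant entry is that constant.\<close>

lemma halted_persists:
  assumes "run_on p z W c" "halted p (c a)" "le a b"
  shows "c b = c a"
  using assms(3)
proof (induction b rule: lt_induct)
  case (1 b)
  consider "a = b" | q where "lt a b" "imm_pred W q b" | "lt a b" "is_limit b"
    using 1(2) not_minimal unfolding is_limit_def by (metis le_Field sless_def)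
  then show ?case
  proof cases
    case (2 q)
    have "lt q b" using 2(2) by (rule imm_pred_lt)
    then have "c q = c a" using 1(1) imm_pred_le[OF 2(2,1)] by blast
    then show ?thesis using run_on_succ[OF assms(1) 2(2)] halted_step assms(2) by simp
  next
    case 3
    have *: "c g = c a" if "le a g" "lt g b" for g using 1(1) that by blast
    have "lim_val W b (\<lambda>b. entry (c b) e) = entry (c a) e" for e
    proof (rule lim_val_eqI[OF _ 3(1)])
      fix x assume "lt x b"
      then obtain y where "le x y" "le a y" "lt y b"
        using le_or_lt[of x a] 3(1) le_refl lt_Field lt_le by metis
      then show "\<exists>g. le x g \<and> lt g b \<and> entry (c g) e = entry (c a) e" using * by metis
    qed (simp add: *)
    then show ?thesis using run_on_limit[OF assms(1) 3(2)] by (intro config_eqI) simp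
  qed simp
qed

end

section \<open>Halting and looping\<close>

definition halting_run :: "program \<Rightarrow> nat set \<Rightarrow> nat \<Rightarrow> bool" where
  "halting_run p z out \<longleftrightarrow> (\<exists>S d. run p z init_config S d \<and> halted p d \<and> snd d 0 = out)"

text \<open>The classical loop criterion: since no entry drops below its value in \<open>c\<close>
  during the return trip, infinitely many trips have the limit \<open>c\<close> again.\<close>

definition looping :: "program \<Rightarrow> nat set \<Rightarrow> bool" where
  "looping p z \<longleftrightarrow> (\<exists>S c T. run p z init_config S c \<and> run p z c T c \<and> T \<noteq> {} \<and>
     (\<forall>d\<in>T. \<forall>e. entry c e \<le> entry d e))"

context wellord
begin

lemma ex_minimal:
  assumes "g \<in> Field W"
  obtains i0 where "is_minimal W i0" "i0 \<in> Field W" "\<And>x. x \<in> Field W \<Longrightarrow> le i0 x"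
  using ex_least[OF assms] le_Field le_antisym unfolding is_minimal_def by (metis subset_refl)

text \<open>A halted stage \<open>g\<close> would bound the set \<open>?B\<close> of returns to the
  looping configuration. Every return is followed by another one up to \<open>g\<close>, so
  \<open>?B\<close> has a supremum that is a limit. By domination the liminf there is again the
  looping configuration, so the supremum would belong to \<open>?B\<close> and lie strictly below
  itself.\<close>

lemma looping_not_halted:
  assumes "looping p z" "run_on p z W c" "g \<in> Field W"
  shows "\<not> halted p (c g)"
proof
  assume halt: "halted p (c g)"
  obtain S C T where r: "run p z init_config S C" "run p z C T C" "T \<noteq> {}"
    and T: "\<And>d e. d \<in> T \<Longrightarrow> entry C e \<le> entry d e"
    using assms(1) unfolding looping_def by blast
  obtain i0 where i0: "is_minimal W i0" "i0 \<in> Field W" "\<And>x. x \<in> Field W \<Longrightarrow> le i0 x"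
    using ex_minimal[OF assms(3)] by blast
  have "c i0 = init_config" using assms(2) i0 unfolding run_on_def by blast
  \<comment> \<open>A run passes no halted configuration, in particular not the one at
    \<open>g\<close>. This excludes the second alternative of \<open>run_follow\<close>.\<close>
  moreover have "c g \<notin> S" "c g \<notin> T" using run_not_halted r halt by blast+
  ultimately obtain a where a: "le i0 a" "c a = C" "S = c ` seg i0 a"
    using run_follow[OF r(1) assms(2) i0(2)] i0(3)[OF assms(3)] by blast
  have "\<not> lt g a" using \<open>c g \<notin> S\<close> a i0(3)[OF assms(3)] by blast
  then have "le a g" using le_or_lt[of a g] assms(3) le_Field[OF a(1)] by blast
  let ?B = "{b. le a b \<and> le b g \<and> c b = C \<and> (\<forall>x e. x \<in> seg a b \<longrightarrow> entry C e \<le> entry (c x) e)}"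
  have aB: "a \<in> ?B" using \<open>le a g\<close> a le_Field le_refl by (auto dest: not_lt)
  have next': "\<exists>b'\<in>?B. lt b b'" if b: "b \<in> ?B" for b
  proof -
    have bf: "b \<in> Field W" "c b = C" "le b g" using b le_Field by blast+
    then obtain b' where b': "le b b'" "c b' = C" "T = c ` seg b b'"
      using run_follow[OF r(2) assms(2)] \<open>c g \<notin> T\<close> by blast
    have "b \<noteq> b'" using b'(3) r(3) seg_empty[OF b'(1)] by auto
    then have "lt b b'" using b'(1) by (simp add: sless_def)
    moreover have "\<not> lt g b'" using \<open>c g \<notin> T\<close> b' bf(3) by blast
    then have "le b' g" using le_or_lt[of b' g] assms(3) le_Field[OF b'(1)] by blast
    moreover have "entry C e \<le> entry (c x) e" if "x \<in> seg a b'" for x e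
    proof -
      have "x \<in> seg a b \<or> x \<in> seg b b'" using seg_Un[of a b b'] b b' that by blast
      then show ?thesis using b b' T by blast
    qed
    moreover have "le a b'" using b b' le_trans by blast
    ultimately show ?thesis using b'(2) by blast
  qed
  have BF: "?B \<subseteq> Field W" using le_Field by blast
  have Bg: "\<And>x. x \<in> ?B \<Longrightarrow> le x g" by blast
  obtain L where L: "is_limit L" "le L g" "\<And>x. x \<in> ?B \<Longrightarrow> lt x L"
    "\<And>g. lt g L \<Longrightarrow> \<exists>x\<in>?B. lt g x"
    using strict_sup[OF aB BF next' Bg] by blast
  have ge: "entry C e \<le> entry (c x) e" if "le a x" "lt x L" for x e
    using L(4)[OF that(2)] that(1) by blast
  have "lim_val W L (\<lambda>b. entry (c b) e) = entry C e" for e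
  proof (rule lim_val_eqI[OF _ L(3)[OF aB]])
    fix x assume "lt x L"
    then obtain b where "b \<in> ?B" "lt x b" using L(4) by blast
    then show "\<exists>g. le x g \<and> lt g L \<and> entry (c g) e = entry C e" using L(3) lt_le by blast
  qed (rule ge)
  then have "c L = C" using run_on_limit[OF assms(2) L(1)] by (intro config_eqI) simp
  then have "L \<in> ?B" using L(2,3) aB ge lt_le by blast
  then show False using L(3) lt_irrefl by blast
qed

lemma first_halted_run:
  assumes "run_on p z W c" "halted p (c g)" "g \<in> Field W" "countable {x. lt x g}"
  shows "\<exists>out. halting_run p z out"
proof -
  have "g \<in> {x \<in> Field W. halted p (c x)}" "{x \<in> Field W. halted p (c x)} \<subseteq> Field W"
    using assms by auto
  then obtain h where h: "halted p (c h)" "h \<in> Field W"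
    "\<And>y. y \<in> Field W \<Longrightarrow> halted p (c y) \<Longrightarrow> le h y"
    by (rule ex_least) blast
  obtain i0 where i0: "is_minimal W i0" "i0 \<in> Field W" "\<And>x. x \<in> Field W \<Longrightarrow> le i0 x"
    using ex_minimal[OF assms(3)] by blast
  have "{x. lt x h} \<subseteq> {x. lt x g}" using h(3) assms lt_le_trans by blast
  then have "countable {x. lt x h}" using assms(4) countable_subset by blast
  moreover have "\<not> halted p (c x)" if "lt x h" for x
    using that h(3) not_lt lt_Field by blast
  ultimately have "run p z (c i0) (c ` seg i0 h) (c h)"
    using run_between[OF assms(1) i0(3)[OF h(2)]] by simp
  moreover have "c i0 = init_config" using assms(1) i0 unfolding run_on_def by blast
  ultimately have "run p z init_config (c ` seg i0 h) (c h)" by simp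
  then show ?thesis using h(1) unfolding halting_run_def by blast
qed

text \<open>If a stage before \<open>t\<close> were halted, its configuration would persist to
  \<open>t\<close> and hence equal that of \<open>s\<close>, which is not halted. So both parts of
  the path are genuine runs.\<close>

lemma loop_halted_or_looping:
  assumes "run_on p z W c" "lt s t" "countable {x. lt x t}"
    and "\<And>e. entry (c s) e = entry (c t) e"
    and "\<And>h e. h \<in> seg s t \<Longrightarrow> entry (c s) e \<le> entry (c h) e"
    and "\<not> halted p (c s)"
  shows "looping p z"
proof -
  have st: "c s = c t" using assms(4) by (rule config_eqI)
  have nh: "\<not> halted p (c x)" if "lt x t" for x
    using halted_persists[OF assms(1), of x t] that assms(6) st lt_le by metis
  obtain i0 where i0: "is_minimal W i0" "i0 \<in> Field W" "\<And>x. x \<in> Field W \<Longrightarrow> le i0 x"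
    using ex_minimal lt_Field assms(2) by blast
  have "c i0 = init_config" using assms(1) i0 unfolding run_on_def by blast
  moreover have "{x. lt x s} \<subseteq> {x. lt x t}" using assms(2) lt_trans by blast
  then have "countable {x. lt x s}" using assms(3) countable_subset by blast
  moreover have "le i0 s" using i0(3) lt_Field[OF assms(2)] by blast
  ultimately have "run p z init_config (c ` seg i0 s) (c s)"
    using run_between[OF assms(1), of i0 s] nh lt_trans[OF _ assms(2)] by simp
  moreover have "run p z (c s) (c ` seg s t) (c t)"
    using run_between[OF assms(1) lt_le[OF assms(2)] assms(3)] nh by blast
  moreover have "c ` seg s t \<noteq> {}"
    using seg_empty[OF lt_le[OF assms(2)]] assms(2) lt_irrefl by auto
  moreover have "\<forall>d\<in>c ` seg s t. \<forall>e. entry (c s) e \<le> entry d e" using assms(5) by blast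
  ultimately have "run p z init_config (c ` seg i0 s) (c s) \<and> run p z (c s) (c ` seg s t) (c s) \<and>
      c ` seg s t \<noteq> {} \<and> (\<forall>d\<in>c ` seg s t. \<forall>e. entry (c s) e \<le> entry d e)"
    unfolding st by (intro conjI)
  then show ?thesis unfolding looping_def by blast
qed


lemma omega_boundedE:
  assumes omega_bounded "X \<subseteq> Field W" "countable X"
  obtains u where "u \<in> Field W" "\<forall>x\<in>X. lt x u"
  using assms unfolding omega_bounded_def by meson

text \<open>Well-founded recursion: each of the three clauses determines a configuration from
  strictly earlier stages.\<close>

lemma run_on_exists: "\<exists>c. run_on p z W c"
proof -
  let ?R = "{(a, b). lt a b}"
  let ?F = "\<lambda>c g. if is_minimal W g then init_config
     else if \<exists>b. imm_pred W b g then Defs.step p z (c (THE b. imm_pred W b g))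
     else (lim_val W g (\<lambda>b. fst (c b)), \<lambda>j. lim_val W g (\<lambda>b. snd (c b) j))"
  have lim: "lim_val W g f = lim_val W g h" if "\<And>x. lt x g \<Longrightarrow> f x = h x" for g and f h :: "'a \<Rightarrow> nat"
  proof -
    have "cofinal_val W g f = cofinal_val W g h" using that unfolding cofinal_val_def by metis
    then show ?thesis by (simp add: lim_val_def)
  qed
  have the: "(THE b. imm_pred W b g) = b" if "imm_pred W b g" for b g
    using that imm_pred_unique by blast
  have "adm_wf ?R ?F"
    unfolding adm_wf_def
  proof (intro allI impI)
    fix f h :: "'a \<Rightarrow> config" and x assume eq: "\<forall>y. (y, x) \<in> ?R \<longrightarrow> f y = h y"
    have "f (THE b. imm_pred W b x) = h (THE b. imm_pred W b x)" if "\<exists>b. imm_pred W b x"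
      using that the eq imm_pred_lt by auto
    moreover have "lim_val W x (\<lambda>b. fst (f b)) = lim_val W x (\<lambda>b. fst (h b))"
      "lim_val W x (\<lambda>b. snd (f b) j) = lim_val W x (\<lambda>b. snd (h b) j)" for j
      by (rule lim, use eq in simp)+
    ultimately show "?F f x = ?F h x" by simp
  qed
  then have fix_eq: "wfrec ?R ?F = ?F (wfrec ?R ?F)" using wfrec_fixpoint[OF wf_lt] by blast
  define c where "c = wfrec ?R ?F"
  have c: "c g = ?F c g" for g using fun_cong[OF fix_eq] unfolding c_def by blast
  have r1: "c g = init_config" if "is_minimal W g" for g
    using that c[of g] by simp
  have r2: "c g = Defs.step p z (c b)" if b: "imm_pred W b g" for b g
  proof -
    have "\<not> is_minimal W g" using not_minimal[OF imm_pred_lt[OF b]] .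
    then show ?thesis using b the[OF b] c[of g] by auto
  qed
  have r3: "entry (c g) e = lim_val W g (\<lambda>b. entry (c b) e)"
    if "\<not> is_minimal W g" "\<not> (\<exists>b. imm_pred W b g)" for g e
  proof -
    have "c g = (lim_val W g (\<lambda>b. fst (c b)), \<lambda>j. lim_val W g (\<lambda>b. snd (c b) j))"
      using c[of g] that by simp
    then show ?thesis unfolding limit_config_iff ..
  qed
  have "run_on p z W c"
    unfolding run_on_def
    by (intro ballI conjI allI impI, erule r1, erule r2, erule conjE, erule (1) r3)
  then show ?thesis by blast
qed

text \<open>The loop stages: beyond a stage bounding all values that occur only boundedly often, every
  component attains its least remaining value cofinally, hence takes it at closure points.\<close>

lemma ex_common_loop:
  fixes f :: "nat \<Rightarrow> 'a \<Rightarrow> nat"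
  assumes ob: omega_bounded and lim: "\<And>e g. is_limit g \<Longrightarrow> f e g = lim_val W g (f e)"
  obtains s t where "lt s t" "is_limit s" "\<And>e. f e s = f e t" "\<And>e h. le s h \<Longrightarrow> f e s \<le> f e h"
proof -
  \<comment> \<open>These are the pairs of a component and a value whose occurrences are bounded.
    There are countably many, so a single stage \<open>\<sigma>\<close> passes all of their
    bounds.\<close>
  let ?bd = "{(e, v). \<exists>u\<in>Field W. \<forall>g. le u g \<longrightarrow> f e g \<noteq> v}"
  define bd where "bd = (\<lambda>(e, v). SOME u. u \<in> Field W \<and> (\<forall>g. le u g \<longrightarrow> f e g \<noteq> v))"
  have bd: "bd (e, v) \<in> Field W" "\<And>g. le (bd (e, v)) g \<Longrightarrow> f e g \<noteq> v" if "(e, v) \<in> ?bd" for e v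
  proof -
    have "\<exists>u. u \<in> Field W \<and> (\<forall>g. le u g \<longrightarrow> f e g \<noteq> v)" using that by blast
    then have "bd (e, v) \<in> Field W \<and> (\<forall>g. le (bd (e, v)) g \<longrightarrow> f e g \<noteq> v)"
      unfolding bd_def by (simp only: prod.case) (rule someI_ex)
    then show "bd (e, v) \<in> Field W" "\<And>g. le (bd (e, v)) g \<Longrightarrow> f e g \<noteq> v" by blast+
  qed
  have "bd ` ?bd \<subseteq> Field W" using bd(1) by fast
  moreover have "countable (bd ` ?bd)" by blast
  ultimately obtain \<sigma> where \<sigma>: "\<sigma> \<in> Field W" "\<forall>x\<in>bd ` ?bd. lt x \<sigma>"
    by (rule omega_boundedE[OF ob])
  define m where "m e = (LEAST v. \<exists>g. le \<sigma> g \<and> f e g = v)" for e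
  have m_le: "m e \<le> f e g" if "le \<sigma> g" for e g
    unfolding m_def by (rule Least_le) (use that in blast)
  have m_att: "\<exists>g. le \<sigma> g \<and> f e g = m e" for e
    unfolding m_def by (rule LeastI_ex) (use le_refl[OF \<sigma>(1)] in blast)
  \<comment> \<open>Otherwise the occurrences of \<open>m e\<close> would have a bound below
    \<open>\<sigma>\<close>, although the value is attained from \<open>\<sigma>\<close> on.\<close>
  have m_cof: "\<exists>g. le u g \<and> f e g = m e" if "u \<in> Field W" for u e
  proof (rule ccontr)
    assume "\<not> (\<exists>g. le u g \<and> f e g = m e)"
    then have b: "(e, m e) \<in> ?bd" using that by blast
    obtain g where "le \<sigma> g" "f e g = m e" using m_att by blast
    moreover have "lt (bd (e, m e)) \<sigma>" using \<sigma>(2) b by blast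
    ultimately show False using bd(2)[OF b] lt_le le_trans by blast
  qed
  \<comment> \<open>Omega many stages are chosen such that every component attains its minimum
    between any two consecutive ones. At their supremum each liminf is exactly that minimum.\<close>
  have closure: "\<exists>L. is_limit L \<and> lt r L \<and> (\<forall>e. f e L = m e)" if r: "le \<sigma> r" for r
  proof -
    have rF: "r \<in> Field W" using r le_Field by blast
    have step: "\<exists>y. lt x y \<and> (\<forall>e. \<exists>g. le x g \<and> lt g y \<and> f e g = m e)" if x: "x \<in> Field W" for x
    proof -
      define h where "h e = (SOME g. le x g \<and> f e g = m e)" for e
      have h: "le x (h e)" "f e (h e) = m e" for e
        using someI_ex[OF m_cof[OF x]] unfolding h_def by blast+
      have "range h \<subseteq> Field W" "countable (range h)" using h le_Field by blast+
      then obtain y where "y \<in> Field W" "\<forall>x\<in>range h. lt x y" by (rule omega_boundedE[OF ob])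
      then have "\<And>e. lt (h e) y" by blast
      then show ?thesis using h le_lt_trans by blast
    qed
    have "\<exists>b. \<forall>n. (b n \<in> Field W \<and> (n = 0 \<longrightarrow> b n = r)) \<and>
      (lt (b n) (b (Suc n)) \<and> (\<forall>e. \<exists>g. le (b n) g \<and> lt g (b (Suc n)) \<and> f e g = m e))"
    proof (rule dependent_nat_choice)
      show "\<exists>x. x \<in> Field W \<and> (0 = (0::nat) \<longrightarrow> x = r)" using rF by blast
    next
      fix x and n :: nat assume "x \<in> Field W \<and> (n = 0 \<longrightarrow> x = r)"
      then show "\<exists>y. (y \<in> Field W \<and> (Suc n = 0 \<longrightarrow> y = r)) \<and>
        (lt x y \<and> (\<forall>e. \<exists>g. le x g \<and> lt g y \<and> f e g = m e))"
        using step[of x] lt_Field by blast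
    qed
    then obtain b where b': "\<forall>n. (b n \<in> Field W \<and> (n = 0 \<longrightarrow> b n = r)) \<and>
      (lt (b n) (b (Suc n)) \<and> (\<forall>e. \<exists>g. le (b n) g \<and> lt g (b (Suc n)) \<and> f e g = m e))" ..
    have b: "b n \<in> Field W" "lt (b n) (b (Suc n))"
      "\<forall>e. \<exists>g. le (b n) g \<and> lt g (b (Suc n)) \<and> f e g = m e" for n
      using spec[OF b', of n] by simp_all
    have b0: "b 0 = r" using spec[OF b', of 0] by simp
    have rb: "r \<in> range b" using b0 by blast
    have bF: "range b \<subseteq> Field W" "countable (range b)" using b(1) by blast+
    then obtain u where "u \<in> Field W" "\<forall>x\<in>range b. lt x u" by (rule omega_boundedE[OF ob])
    then have ub: "\<And>x. x \<in> range b \<Longrightarrow> le x u" using lt_le by blast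
    have nx: "\<And>x. x \<in> range b \<Longrightarrow> \<exists>y\<in>range b. lt x y" using b(2) by blast
    obtain L where L: "is_limit L" "le L u" "\<And>x. x \<in> range b \<Longrightarrow> lt x L"
      "\<And>g. lt g L \<Longrightarrow> \<exists>x\<in>range b. lt g x"
      using strict_sup[OF rb bF(1) nx ub] by blast
    have "f e L = m e" for e
      unfolding lim[OF L(1)]
    proof (rule lim_val_eqI)
      show "lt r L" using L(3) rb .
      show "m e \<le> f e g" if "le r g" for g using m_le le_trans[OF r that] .
      fix x assume "lt x L"
      then obtain n where n: "lt x (b n)" using L(4) by blast
      then obtain g where "le (b n) g" "lt g (b (Suc n))" "f e g = m e" using b(3) by blast
      moreover have "lt (b (Suc n)) L" using L(3) by blast
      ultimately show "\<exists>g. le x g \<and> lt g L \<and> f e g = m e"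
        using n lt_le le_trans lt_trans by blast
    qed
    then show ?thesis using L(1) L(3)[OF rb] by blast
  qed
  obtain s where s: "is_limit s" "lt \<sigma> s" "\<And>e. f e s = m e" using closure[OF le_refl[OF \<sigma>(1)]] by blast
  obtain t where t: "lt s t" "\<And>e. f e t = m e" using closure[OF lt_le[OF s(2)]] by blast
  have "f e s \<le> f e h" if "le s h" for e h using m_le[of h e] s that lt_le le_trans by metis
  then show ?thesis using that[OF t(1) s(1)] s(3) t(2) by simp
qed

end

section \<open>The first uncountable ordinal as time scale\<close>

text \<open>The successor cardinal of the order of the naturals lives on \<open>nat set\<close>,
  which is the carrier of time points in \<open>halts_with\<close>.\<close>

definition omega1 :: "nat set rel" where
  "omega1 = cardSuc natLeq"

lemma wellord_omega1: "wellord omega1"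
  unfolding omega1_def wellord_def by (rule cardSuc_Well_order[OF natLeq_Card_order])

interpretation omega1: wellord omega1
  by (rule wellord_omega1)

lemma countable_below_omega1: "countable {x. sless omega1 x g}"
proof (cases "g \<in> Field omega1")
  case True
  have "{x. sless omega1 x g} = underS omega1 g" by (auto simp: sless_def underS_def)
  moreover have "(card_of (underS omega1 g), omega1) \<in> ordLess"
    using card_of_underS[OF cardSuc_Card_order[OF natLeq_Card_order]] True unfolding omega1_def .
  then have "(card_of (underS omega1 g), natLeq) \<in> ordLeq"
    unfolding omega1_def using cardSuc_ordLeq_ordLess[OF natLeq_Card_order card_of_Card_order] by blast
  ultimately show ?thesis by (simp add: countable_card_le_natLeq)
next
  case False
  then have "{x. sless omega1 x g} = {}" using omega1.lt_Field by blast
  then show ?thesis by simp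
qed

text \<open>Initial segments are countable, so countably many of them do not exhaust the uncountable
  field.\<close>

lemma omega_bounded_omega1: "omega1.omega_bounded"
  unfolding omega1.omega_bounded_def
proof (intro allI impI)
  fix X assume X: "X \<subseteq> Field omega1" "countable X"
  have "(card_of (Field omega1), natLeq) \<notin> ordLeq"
  proof
    assume "(card_of (Field omega1), natLeq) \<in> ordLeq"
    moreover have "(omega1, card_of (Field omega1)) \<in> ordIso"
      unfolding omega1_def
      using cardSuc_Card_order[OF natLeq_Card_order] card_of_Field_ordIso ordIso_symmetric by blast
    ultimately have "(omega1, natLeq) \<in> ordLeq" using ordIso_ordLeq_trans by blast
    then show False
      using cardSuc_greater[OF natLeq_Card_order] not_ordLess_ordLeq unfolding omega1_def by blast
  qed
  then have "\<not> countable (Field omega1)" by (simp add: countable_card_le_natLeq)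
  moreover have "countable ((\<Union>x\<in>X. {y. sless omega1 y x}) \<union> X)"
    using X(2) countable_below_omega1 by auto
  ultimately have "\<not> Field omega1 \<subseteq> (\<Union>x\<in>X. {y. sless omega1 y x}) \<union> X"
    using countable_subset by metis
  then obtain u where "u \<in> Field omega1" "u \<notin> (\<Union>x\<in>X. {y. sless omega1 y x}) \<union> X"
    by blast
  then show "\<exists>u\<in>Field omega1. \<forall>x\<in>X. sless omega1 x u"
    using X(1) omega1.le_or_lt[of u] omega1.le_iff[of u] by blast
qed

lemma run_follow_omega1:
  assumes "run p z init_config S d" "run_on p z omega1 c"
  obtains i0 b where "is_minimal omega1 i0" "(i0, b) \<in> omega1" "c b = d" "S = c ` omega1.seg i0 b"
proof -
  obtain u where "u \<in> Field omega1"
    by (rule omega1.omega_boundedE[OF omega_bounded_omega1, of "{}"]) auto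
  then obtain i0 where i0: "is_minimal omega1 i0" "i0 \<in> Field omega1"
    using omega1.ex_minimal by blast
  then have "c i0 = init_config" using assms(2) unfolding run_on_def by blast
  then obtain b where "(i0, b) \<in> omega1" "c b = d" "S = c ` omega1.seg i0 b"
    using omega1.run_follow[OF assms i0(2)] omega_bounded_omega1 by auto
  then show ?thesis using that i0(1) by blast
qed

text \<open>Along \<open>omega1\<close> every run has two stages as in
  \<open>ex_common_loop\<close>; the configuration at the first of them is either halted or starts a
  loop.\<close>

lemma halting_or_looping: "(\<exists>out. halting_run p z out) \<or> looping p z"
proof -
  obtain c where c: "run_on p z omega1 c" using omega1.run_on_exists by blast
  obtain s t where st: "sless omega1 s t" "\<And>e. entry (c s) e = entry (c t) e"
    "\<And>e h. (s, h) \<in> omega1 \<Longrightarrow> entry (c s) e \<le> entry (c h) e"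
    by (rule omega1.ex_common_loop[OF omega_bounded_omega1, of "\<lambda>e g. entry (c g) e"])
      (erule omega1.run_on_limit[OF c], blast)
  show ?thesis
  proof (cases "halted p (c s)")
    case True
    then show ?thesis
      using omega1.first_halted_run[OF c True] st(1) omega1.lt_Field countable_below_omega1 by blast
  next
    case False
    then show ?thesis
      using omega1.loop_halted_or_looping[OF c st(1) countable_below_omega1 st(2)] st(3) by blast
  qed
qed

lemma looping_not_halting: "looping p z \<Longrightarrow> \<not> halting_run p z out"
proof
  assume loop: "looping p z" and "halting_run p z out"
  then obtain S d where r: "run p z init_config S d" "halted p d" unfolding halting_run_def by blast
  obtain c where c: "run_on p z omega1 c" using omega1.run_on_exists by blast
  obtain i0 b where "(i0, b) \<in> omega1" "c b = d" using run_follow_omega1[OF r(1) c] by blast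
  then show False using omega1.looping_not_halted[OF loop c, of b] omega1.le_Field r(2) by blast
qed

section \<open>Agreement of the given halting predicate with countable runs\<close>

text \<open>The well-order in \<open>halts_with\<close> may have any length, so its computation
  cannot be turned into a \<open>run\<close> directly. Instead, looping is excluded on every
  well-order, so a countable halting run exists; followed inside the given well-order it ends at
  \<open>t\<close>, the only halted stage.\<close>

lemma halts_with_halting_run: "halts_with p z out \<Longrightarrow> halting_run p z out"
proof -
  assume "halts_with p z out"
  then obtain W :: "nat set rel" and c t where W: "Well_order W" "t \<in> Field W" "\<forall>a\<in>Field W. (a, t) \<in> W"
    and *: "\<forall>g\<in>Field W.
          (is_minimal W g \<longrightarrow> c g = init_config) \<and>
          (\<forall>b. imm_pred W b g \<longrightarrow> c g = Defs.step p z (c b)) \<and>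
          ((\<not> is_minimal W g \<and> \<not> (\<exists>b. imm_pred W b g)) \<longrightarrow>
              c g = (lim_val W g (\<lambda>b. fst (c b)), \<lambda>j. lim_val W g (\<lambda>b. snd (c b) j))) \<and>
          (g \<noteq> t \<longrightarrow> \<not> halted p (c g))"
    and t: "halted p (c t)" "snd (c t) 0 = out"
    unfolding halts_with_def by (elim exE conjE) (rule that)
  interpret wellord W using W(1) by unfold_locales
  have c: "run_on p z W c"
    using * unfolding run_on_def limit_config_iff[symmetric] by blast
  have "\<not> looping p z" using looping_not_halted[OF _ c W(2)] t by blast
  then obtain S d where r: "run p z init_config S d" "halted p d"
    using halting_or_looping unfolding halting_run_def by blast
  obtain i0 where i0: "is_minimal W i0" "i0 \<in> Field W" using ex_minimal[OF W(2)] by blast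
  then have "c i0 = init_config" using c unfolding run_on_def by blast
  moreover have "c t \<notin> S" using run_not_halted[OF r(1)] t(1) by blast
  moreover have "le i0 t" using W(3) i0(2) by blast
  ultimately obtain b where b: "le i0 b" "c b = d"
    using run_follow[OF r(1) c i0(2)] by blast
  then have "b = t" using * r(2) le_Field by blast
  then show ?thesis using b r t unfolding halting_run_def by blast
qed

text \<open>The well-order is the initial segment of \<open>omega1\<close> up to the stage that the
  run reaches. Minimality, immediate predecessors and limit values are the same in this
  segment.\<close>

lemma halting_run_halts_with: "halting_run p z out \<Longrightarrow> halts_with p z out"
proof -
  assume "halting_run p z out"
  then obtain S d where r: "run p z init_config S d" "halted p d" "snd d 0 = out"
    unfolding halting_run_def by blast
  obtain c where c: "run_on p z omega1 c" using omega1.run_on_exists by blast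
  obtain i0 b where b: "is_minimal omega1 i0" "(i0, b) \<in> omega1" "c b = d" "S = c ` omega1.seg i0 b"
    using run_follow_omega1[OF r(1) c] by blast
  define W where "W = Restr omega1 {x. (x, b) \<in> omega1}"
  have W: "(x, y) \<in> W \<longleftrightarrow> (x, y) \<in> omega1 \<and> (y, b) \<in> omega1" for x y
    unfolding W_def using omega1.le_trans by blast
  have FW: "Field W = {x. (x, b) \<in> omega1}"
  proof -
    have "(x, b) \<in> omega1 \<Longrightarrow> (x, x) \<in> W" for x using W omega1.le_refl omega1.le_Field by blast
    then show ?thesis using W omega1.le_trans unfolding Field_def by blast
  qed
  have lt: "sless W x y \<longleftrightarrow> sless omega1 x y \<and> (y, b) \<in> omega1" for x y
    unfolding sless_def W by blast
  have min: "is_minimal W g \<longleftrightarrow> is_minimal omega1 g" if "(g, b) \<in> omega1" for g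
    using that unfolding is_minimal_def W by blast
  have pred: "imm_pred W x g \<longleftrightarrow> imm_pred omega1 x g" if "(g, b) \<in> omega1" for x g
    using that omega1.le_trans[of _ g b] unfolding imm_pred_def W lt by blast
  have "cofinal_val W g f = cofinal_val omega1 g f" if "(g, b) \<in> omega1" for g and f :: "nat set \<Rightarrow> nat"
    using that omega1.lt_le omega1.le_trans[of _ g b] unfolding cofinal_val_def W lt by fast
  then have lim: "lim_val W g f = lim_val omega1 g f" if "(g, b) \<in> omega1" for g and f :: "nat set \<Rightarrow> nat"
    using that by (simp only: lim_val_def)
  have "Well_order W" unfolding W_def using Well_order_Restr omega1.wo by blast
  moreover have "b \<in> Field W" using FW omega1.le_refl omega1.le_Field b(2) by blast
  moreover have "\<forall>a\<in>Field W. (a, b) \<in> W" using FW W omega1.le_refl omega1.le_Field b(2) by blast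
  moreover have "\<not> halted p (c g)" if "g \<in> Field W" "g \<noteq> b" for g
  proof -
    have g: "(g, b) \<in> omega1" using that FW by blast
    then have "sless omega1 g b" using that(2) by (simp add: sless_def)
    moreover have "(i0, g) \<in> omega1"
      using b(1,2) g omega1.le_or_lt[of i0 g] omega1.le_Field omega1.not_minimal by blast
    ultimately show ?thesis using b(4) run_not_halted[OF r(1)] by blast
  qed
  moreover have "\<forall>g\<in>Field W.
          (is_minimal W g \<longrightarrow> c g = init_config) \<and>
          (\<forall>b. imm_pred W b g \<longrightarrow> c g = Defs.step p z (c b)) \<and>
          ((\<not> is_minimal W g \<and> \<not> (\<exists>b. imm_pred W b g)) \<longrightarrow>
              c g = (lim_val W g (\<lambda>b. fst (c b)), \<lambda>j. lim_val W g (\<lambda>b. snd (c b) j)))"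
  proof
    fix g assume "g \<in> Field W"
    then have g: "(g, b) \<in> omega1" "g \<in> Field omega1" using FW omega1.le_Field by blast+
    show "(is_minimal W g \<longrightarrow> c g = init_config) \<and>
          (\<forall>b. imm_pred W b g \<longrightarrow> c g = Defs.step p z (c b)) \<and>
          ((\<not> is_minimal W g \<and> \<not> (\<exists>b. imm_pred W b g)) \<longrightarrow>
              c g = (lim_val W g (\<lambda>b. fst (c b)), \<lambda>j. lim_val W g (\<lambda>b. snd (c b) j)))"
      using c[unfolded run_on_def, rule_format, OF g(2)]
      unfolding limit_config_iff min[OF g(1)] pred[OF g(1)] lim[OF g(1)] by blast
  qed
  ultimately show ?thesis
    unfolding halts_with_def using r b(3)
    by (intro exI[of _ W] exI[of _ c] exI[of _ b]) blast
qed

theorem halts_with_iff: "halts_with p z out \<longleftrightarrow> halting_run p z out"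
  using halts_with_halting_run halting_run_halts_with by blast

lemma halts_iff: "halts p z \<longleftrightarrow> (\<exists>out. halting_run p z out)"
  unfolding halts_def halts_with_iff ..

lemma not_halts_looping: "\<not> halts p z \<longleftrightarrow> looping p z"
  using halting_or_looping looping_not_halting unfolding halts_iff by blast

text \<open>Halting becomes a property of one configuration, which is how a jump can be computed
  from a certificate.\<close>

lemma (in wellord) halts_iff_halted_at_loop:
  assumes "run_on p z W c" "lt s t" "countable {x. lt x t}"
    and "\<And>e. entry (c s) e = entry (c t) e"
    and "\<And>h e. h \<in> seg s t \<Longrightarrow> entry (c s) e \<le> entry (c h) e"
  shows "halts p z \<longleftrightarrow> halted p (c s)"
  using loop_halted_or_looping[OF assms] looping_not_halted[OF _ assms(1), of s]
    lt_Field[OF assms(2)] not_halts_looping by blast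

section \<open>Uniform oracle computability\<close>

text \<open>One recursive code serves all oracles in \<open>D\<close>. Restricting the oracles to
  \<open>D\<close> makes room for functions whose evaluation relies on an unbounded search in the
  oracle.\<close>

definition ucomp :: "nat set set \<Rightarrow> nat \<Rightarrow> (nat set \<Rightarrow> nat list \<Rightarrow> nat) \<Rightarrow> bool" where
  "ucomp D n F \<longleftrightarrow> (\<exists>f. \<forall>z\<in>D. \<forall>xs. length xs = n \<longrightarrow> reval z f xs (F z xs))"

definition udec :: "nat set set \<Rightarrow> nat \<Rightarrow> (nat set \<Rightarrow> nat list \<Rightarrow> bool) \<Rightarrow> bool" where
  "udec D n Q \<longleftrightarrow> ucomp D n (\<lambda>z xs. if Q z xs then 1 else 0)"

lemma ucomp_cong:
  assumes "ucomp D n F" "\<And>z xs. z \<in> D \<Longrightarrow> length xs = n \<Longrightarrow> F z xs = G z xs"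
  shows "ucomp D n G"
  using assms unfolding ucomp_def by metis

lemma ucomp_compose:
  assumes H: "ucomp D (length Fs) H" and Fs: "\<And>F. F \<in> set Fs \<Longrightarrow> ucomp D n F"
  shows "ucomp D n (\<lambda>z xs. H z (map (\<lambda>F. F z xs) Fs))"
proof -
  obtain h where h: "\<And>z xs. z \<in> D \<Longrightarrow> length xs = length Fs \<Longrightarrow> reval z h xs (H z xs)"
    using H unfolding ucomp_def by blast
  have "\<exists>gs. length gs = length Fs \<and>
      (\<forall>z\<in>D. \<forall>xs. length xs = n \<longrightarrow> list_all2 (\<lambda>g y. reval z g xs y) gs (map (\<lambda>F. F z xs) Fs))"
    using Fs
  proof (induction Fs)
    case (Cons F Fs)
    obtain g gs where "\<forall>z\<in>D. \<forall>xs. length xs = n \<longrightarrow> reval z g xs (F z xs)" "length gs = length Fs"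
      "\<forall>z\<in>D. \<forall>xs. length xs = n \<longrightarrow> list_all2 (\<lambda>g y. reval z g xs y) gs (map (\<lambda>F. F z xs) Fs)"
      using Cons unfolding ucomp_def by (metis list.set_intros)
    then show ?case by (intro exI[of _ "g # gs"]) auto
  qed auto
  then obtain gs where "\<forall>z\<in>D. \<forall>xs. length xs = n \<longrightarrow>
      list_all2 (\<lambda>g y. reval z g xs y) gs (map (\<lambda>F. F z xs) Fs)" by blast
  then show ?thesis
    unfolding ucomp_def using reval.comp h by (intro exI[of _ "RComp h gs"]) (metis length_map)
qed

lemma ucomp_compose1: "ucomp D (Suc 0) H \<Longrightarrow> ucomp D n F \<Longrightarrow> ucomp D n (\<lambda>z xs. H z [F z xs])"
  using ucomp_compose[of D "[F]" H n] by simp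

lemma ucomp_compose2:
  "ucomp D (Suc (Suc 0)) H \<Longrightarrow> ucomp D n F \<Longrightarrow> ucomp D n G \<Longrightarrow> ucomp D n (\<lambda>z xs. H z [F z xs, G z xs])"
  using ucomp_compose[of D "[F, G]" H n] by auto

lemma ucomp_compose3:
  "ucomp D (Suc (Suc (Suc 0))) H \<Longrightarrow> ucomp D n F \<Longrightarrow> ucomp D n G \<Longrightarrow> ucomp D n K \<Longrightarrow>
    ucomp D n (\<lambda>z xs. H z [F z xs, G z xs, K z xs])"
  using ucomp_compose[of D "[F, G, K]" H n] by auto

lemma ucomp_proj: "i < n \<Longrightarrow> ucomp D n (\<lambda>z xs. xs ! i)"
  unfolding ucomp_def by (intro exI[of _ "RProj i"]) (auto intro: reval.proj)

lemma ucomp_Suc: "ucomp D n F \<Longrightarrow> ucomp D n (\<lambda>z xs. Suc (F z xs))"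
proof -
  have "ucomp D (Suc 0) (\<lambda>z xs. Suc (xs ! 0))"
    unfolding ucomp_def by (intro exI[of _ RS]) (auto simp: length_Suc_conv intro: reval.suc)
  from ucomp_compose1[OF this] show "ucomp D n F \<Longrightarrow> ?thesis" by simp
qed

lemma ucomp_const: "ucomp D n (\<lambda>z xs. c)"
proof (induction c)
  case 0
  show ?case unfolding ucomp_def using reval.zero by blast
qed (rule ucomp_Suc)

lemma ucomp_rec:
  assumes "ucomp D n N" "ucomp D n F" "ucomp D (Suc (Suc n)) G"
  shows "ucomp D n (\<lambda>z xs. rec_nat (F z xs) (\<lambda>k y. G z (y # k # xs)) (N z xs))"
proof -
  obtain f where f: "\<And>z xs. z \<in> D \<Longrightarrow> length xs = n \<Longrightarrow> reval z f xs (F z xs)"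
    using assms(2) unfolding ucomp_def by blast
  obtain g where g: "\<And>z xs. z \<in> D \<Longrightarrow> length xs = Suc (Suc n) \<Longrightarrow> reval z g xs (G z xs)"
    using assms(3) unfolding ucomp_def by blast
  have "reval z (RPrec f g) (k # xs) (rec_nat (F z xs) (\<lambda>k y. G z (y # k # xs)) k)"
    if "z \<in> D" "length xs = n" for z xs k
  proof (induction k)
    case 0
    show ?case using f[OF that] by (simp add: reval.prec0)
  next
    case (Suc k)
    show ?case using reval.precS[OF Suc g] that by simp
  qed
  then have "ucomp D (Suc n) (\<lambda>z xs. rec_nat (F z (tl xs)) (\<lambda>k y. G z (y # k # tl xs)) (hd xs))"
    unfolding ucomp_def by (intro exI[of _ "RPrec f g"]) (auto simp: length_Suc_conv)
  \<comment> \<open>The recursion bound is computed first and placed in front of the projections,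
    which gives the argument order of \<open>RPrec\<close>.\<close>
  then have "ucomp D n (\<lambda>z xs. (\<lambda>z xs. rec_nat (F z (tl xs)) (\<lambda>k y. G z (y # k # tl xs)) (hd xs)) z
      (map (\<lambda>F. F z xs) (N # map (\<lambda>i z xs. xs ! i) [0..<n])))"
    by (intro ucomp_compose) (auto intro: assms(1) ucomp_proj)
  then show ?thesis by (rule ucomp_cong) (auto simp: comp_def map_nth)
qed

lemma ucomp_Least:
  assumes "ucomp D (Suc n) F" "\<And>z xs. z \<in> D \<Longrightarrow> length xs = n \<Longrightarrow> \<exists>k. F z (k # xs) = 0"
  shows "ucomp D n (\<lambda>z xs. LEAST k. F z (k # xs) = 0)"
proof -
  obtain f where f: "\<And>z xs. z \<in> D \<Longrightarrow> length xs = Suc n \<Longrightarrow> reval z f xs (F z xs)"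
    using assms(1) unfolding ucomp_def by blast
  have "reval z (RMn f) xs (LEAST k. F z (k # xs) = 0)" if z: "z \<in> D" "length xs = n" for z xs
  proof (rule reval.mn)
    have "F z ((LEAST k. F z (k # xs) = 0) # xs) = 0" using LeastI_ex[OF assms(2)[OF z]] .
    then show "reval z f ((LEAST k. F z (k # xs) = 0) # xs) 0"
      using f[OF z(1), of "(LEAST k. F z (k # xs) = 0) # xs"] z(2) by simp
    show "\<forall>m<LEAST k. F z (k # xs) = 0. \<exists>y. reval z f (m # xs) y \<and> y \<noteq> 0"
    proof (intro allI impI)
      fix m assume "m < (LEAST k. F z (k # xs) = 0)"
      then have "F z (m # xs) \<noteq> 0" by (rule not_less_Least)
      then show "\<exists>y. reval z f (m # xs) y \<and> y \<noteq> 0" using f[OF z(1), of "m # xs"] z(2) by auto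
    qed
  qed
  then show ?thesis unfolding ucomp_def by blast
qed

lemma udec_Orc: "ucomp D n F \<Longrightarrow> udec D n (\<lambda>z xs. F z xs \<in> z)"
proof -
  have "ucomp D (Suc 0) (\<lambda>z xs. if xs ! 0 \<in> z then 1 else 0)"
    unfolding ucomp_def
  proof (intro exI[of _ ROrc] ballI allI impI)
    fix z and xs :: "nat list" assume "length xs = Suc 0"
    then obtain x where "xs = [x]" by (auto simp: length_Suc_conv)
    then show "reval z ROrc xs (if xs ! 0 \<in> z then 1 else 0)" using reval.orc[of z x "[]"] by simp
  qed
  from ucomp_compose1[OF this] show "ucomp D n F \<Longrightarrow> ?thesis" by (simp add: udec_def)
qed

lemma ucomp_add: "ucomp D n F \<Longrightarrow> ucomp D n G \<Longrightarrow> ucomp D n (\<lambda>z xs. F z xs + G z xs)"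
proof -
  have "ucomp D 2 (\<lambda>z xs. rec_nat (xs ! 1) (\<lambda>k y. Suc ((y # k # xs) ! 0)) (xs ! 0))"
    by (intro ucomp_rec ucomp_proj ucomp_Suc) simp_all
  moreover have "rec_nat b (\<lambda>k y. Suc ((y # k # xs) ! 0)) a = a + b" for a b xs
    by (induction a) auto
  ultimately have "ucomp D (Suc (Suc 0)) (\<lambda>z xs. xs ! 0 + xs ! 1)" by (simp add: numeral_2_eq_2)
  from ucomp_compose2[OF this] show "ucomp D n F \<Longrightarrow> ucomp D n G \<Longrightarrow> ?thesis" by simp
qed

lemma ucomp_mult: "ucomp D n F \<Longrightarrow> ucomp D n G \<Longrightarrow> ucomp D n (\<lambda>z xs. F z xs * G z xs)"
proof -
  have "ucomp D 2 (\<lambda>z xs. rec_nat 0 (\<lambda>k y. (y # k # xs) ! 3 + (y # k # xs) ! 0) (xs ! 0))"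
    by (intro ucomp_rec ucomp_proj ucomp_add ucomp_const) simp_all
  moreover have "rec_nat 0 (\<lambda>k y. (y # k # xs) ! 3 + (y # k # xs) ! 0) a = a * xs ! 1" for a xs
    by (induction a) (auto simp: numeral_3_eq_3)
  ultimately have "ucomp D (Suc (Suc 0)) (\<lambda>z xs. xs ! 0 * xs ! 1)" by (simp add: numeral_2_eq_2)
  from ucomp_compose2[OF this] show "ucomp D n F \<Longrightarrow> ucomp D n G \<Longrightarrow> ?thesis" by simp
qed

lemma ucomp_diff: "ucomp D n F \<Longrightarrow> ucomp D n G \<Longrightarrow> ucomp D n (\<lambda>z xs. F z xs - G z xs)"
proof -
  have "ucomp D (Suc 0) (\<lambda>z xs. rec_nat 0 (\<lambda>k y. (y # k # xs) ! 1) (xs ! 0))"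
    by (intro ucomp_rec ucomp_proj ucomp_const) simp_all
  moreover have "rec_nat 0 (\<lambda>k y. (y # k # xs) ! 1) a = a - 1" for a xs
    by (cases a) auto
  ultimately have "ucomp D (Suc 0) (\<lambda>z xs. xs ! 0 - 1)" by simp
  from ucomp_compose1[OF this] have pred: "ucomp D n F \<Longrightarrow> ucomp D n (\<lambda>z xs. F z xs - 1)" for n F
    by simp
  have "ucomp D 2 (\<lambda>z xs. rec_nat (xs ! 0) (\<lambda>k y. (y # k # xs) ! 0 - 1) (xs ! 1))"
    by (intro ucomp_rec ucomp_proj pred) simp_all
  moreover have "rec_nat a (\<lambda>k y. (y # k # xs) ! 0 - 1) b = a - b" for a b xs
    by (induction b) auto
  ultimately have "ucomp D (Suc (Suc 0)) (\<lambda>z xs. xs ! 0 - xs ! 1)" by (simp add: numeral_2_eq_2)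
  from ucomp_compose2[OF this] show "ucomp D n F \<Longrightarrow> ucomp D n G \<Longrightarrow> ?thesis" by simp
qed

lemma ucomp_if:
  assumes "udec D n Q" "ucomp D n F" "ucomp D n G"
  shows "ucomp D n (\<lambda>z xs. if Q z xs then F z xs else G z xs)"
proof -
  have "ucomp D 3 (\<lambda>z xs. rec_nat (xs ! 2) (\<lambda>k y. (y # k # xs) ! 3) (xs ! 0))"
    by (intro ucomp_rec ucomp_proj) simp_all
  moreover have "rec_nat (xs ! 2) (\<lambda>k y. (y # k # xs) ! 3) a = (if a = 0 then xs ! 2 else xs ! 1)" for a xs
    by (cases a) (auto simp: numeral_3_eq_3)
  ultimately have "ucomp D (Suc (Suc (Suc 0))) (\<lambda>z xs. if xs ! 0 = 0 then xs ! 2 else xs ! 1)"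
    by (simp add: numeral_3_eq_3)
  from ucomp_compose3[OF this assms(1)[unfolded udec_def] assms(2,3)] show ?thesis
    by (rule ucomp_cong) simp
qed

lemma udec_eq_0: "ucomp D n F \<Longrightarrow> udec D n (\<lambda>z xs. F z xs = 0)"
  using ucomp_diff[OF ucomp_const[of D n 1], of F] unfolding udec_def
  by (rule ucomp_cong) auto

lemma udec_le:
  assumes "ucomp D n F" "ucomp D n G"
  shows "udec D n (\<lambda>z xs. F z xs \<le> G z xs)"
  using udec_eq_0[OF ucomp_diff[OF assms]] by simp

lemma udec_not: "udec D n Q \<Longrightarrow> udec D n (\<lambda>z xs. \<not> Q z xs)"
  unfolding udec_def by (drule udec_eq_0, unfold udec_def, erule ucomp_cong) simp

lemma udec_conj:
  assumes "udec D n Q" "udec D n Q'"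
  shows "udec D n (\<lambda>z xs. Q z xs \<and> Q' z xs)"
  using ucomp_mult[OF assms[unfolded udec_def]] unfolding udec_def by (rule ucomp_cong) auto

lemma udec_disj:
  assumes "udec D n Q" "udec D n Q'"
  shows "udec D n (\<lambda>z xs. Q z xs \<or> Q' z xs)"
  using udec_not[OF udec_conj[OF udec_not[OF assms(1)] udec_not[OF assms(2)]]] by simp

lemma udec_imp:
  assumes "udec D n Q" "udec D n Q'"
  shows "udec D n (\<lambda>z xs. Q z xs \<longrightarrow> Q' z xs)"
  using udec_disj[OF udec_not[OF assms(1)] assms(2)] by simp

lemma udec_eq:
  assumes "ucomp D n F" "ucomp D n G"
  shows "udec D n (\<lambda>z xs. F z xs = G z xs)"
  using udec_conj[OF udec_le[OF assms] udec_le[OF assms(2,1)]] by (simp add: eq_iff)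

lemma udec_less:
  assumes "ucomp D n F" "ucomp D n G"
  shows "udec D n (\<lambda>z xs. F z xs < G z xs)"
  using udec_not[OF udec_le[OF assms(2,1)]] by (simp add: not_le)

lemma ucomp_Least_dec:
  assumes "udec D (Suc n) Q" "\<And>z xs. z \<in> D \<Longrightarrow> length xs = n \<Longrightarrow> \<exists>k. Q z (k # xs)"
  shows "ucomp D n (\<lambda>z xs. LEAST k. Q z (k # xs))"
proof -
  have eq: "(if \<not> b then 1 else 0) = (0::nat) \<longleftrightarrow> b" for b by simp
  show ?thesis
    using ucomp_Least[OF udec_not[OF assms(1), unfolded udec_def]] assms(2) unfolding eq by blast
qed

section \<open>Pairing, division by five and list codes\<close>

lemma ucomp_triangle: "ucomp D n F \<Longrightarrow> ucomp D n (\<lambda>z xs. triangle (F z xs))"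
proof -
  have "ucomp D (Suc 0) (\<lambda>z xs. rec_nat 0 (\<lambda>k y. (y # k # xs) ! 0 + Suc ((y # k # xs) ! 1)) (xs ! 0))"
    by (intro ucomp_rec ucomp_proj ucomp_const ucomp_add ucomp_Suc) simp_all
  moreover have "rec_nat 0 (\<lambda>k y. (y # k # xs) ! 0 + Suc ((y # k # xs) ! 1)) a = triangle a" for a xs
    by (induction a) auto
  ultimately have "ucomp D (Suc 0) (\<lambda>z xs. triangle (xs ! 0))" by simp
  from ucomp_compose1[OF this] show "ucomp D n F \<Longrightarrow> ?thesis" by simp
qed

lemma ucomp_prod_encode:
  "ucomp D n F \<Longrightarrow> ucomp D n G \<Longrightarrow> ucomp D n (\<lambda>z xs. prod_encode (F z xs, G z xs))"
  unfolding prod_encode_def by (simp add: ucomp_add ucomp_triangle)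

lemma triangle_mono: "m \<le> n \<Longrightarrow> triangle m \<le> triangle n"
  by (induction n rule: dec_induct) auto

text \<open>The code of (a, b) is \<open>triangle (a + b) + a\<close>. The diagonal a + b is the
  last one whose triangular number does not exceed the code, and the search finds it.\<close>

lemma prod_decode_Least:
  fixes n :: nat
  defines "s \<equiv> LEAST s. n < triangle (Suc s)"
  shows "fst (prod_decode n) = n - triangle s" "snd (prod_decode n) = s - (n - triangle s)"
proof -
  obtain a b where ab: "prod_decode n = (a, b)" by fastforce
  then have "n = prod_encode (a, b)" by (simp flip: ab)
  then have n: "n = triangle (a + b) + a" by (simp add: prod_encode_def)
  have "s = a + b"
    unfolding s_def
  proof (rule Least_equality)
    show "n < triangle (Suc (a + b))" using n by simp
    fix y assume y: "n < triangle (Suc y)"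
    show "a + b \<le> y"
    proof (rule ccontr)
      assume "\<not> a + b \<le> y"
      then have "triangle (Suc y) \<le> triangle (a + b)" by (intro triangle_mono) simp
      then show False using y n by linarith
    qed
  qed
  then show "fst (prod_decode n) = n - triangle s" "snd (prod_decode n) = s - (n - triangle s)"
    using ab n by simp_all
qed

lemma ucomp_prod_decode:
  assumes "ucomp D n F"
  shows "ucomp D n (\<lambda>z xs. fst (prod_decode (F z xs)))" "ucomp D n (\<lambda>z xs. snd (prod_decode (F z xs)))"
proof -
  have ex: "\<exists>s. n < triangle (Suc s)" for n
    by (rule exI[of _ n]) simp
  have "ucomp D (Suc 0) (\<lambda>z xs. LEAST k. (k # xs) ! 1 < triangle (Suc ((k # xs) ! 0)))"
    by (intro ucomp_Least_dec udec_less ucomp_triangle ucomp_Suc ucomp_proj) (simp_all add: ex del: triangle_Suc)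
  then have L: "ucomp D (Suc 0) (\<lambda>z xs. LEAST s. xs ! 0 < triangle (Suc s))" by (simp del: triangle_Suc)
  have "ucomp D (Suc 0) (\<lambda>z xs. fst (prod_decode (xs ! 0)))"
    unfolding prod_decode_Least by (intro ucomp_diff ucomp_triangle L ucomp_proj) simp
  from ucomp_compose1[OF this assms] show "ucomp D n (\<lambda>z xs. fst (prod_decode (F z xs)))" by simp
  have "ucomp D (Suc 0) (\<lambda>z xs. snd (prod_decode (xs ! 0)))"
    unfolding prod_decode_Least by (intro ucomp_diff ucomp_triangle L ucomp_proj) simp_all
  from ucomp_compose1[OF this assms] show "ucomp D n (\<lambda>z xs. snd (prod_decode (F z xs)))" by simp
qed

lemma ucomp_div5: "ucomp D n F \<Longrightarrow> ucomp D n (\<lambda>z xs. F z xs div 5)"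
proof -
  have "n < 5 * Suc (n div 5)" for n :: nat by presburger
  then have ex: "\<exists>q. n < 5 * Suc q" for n :: nat by blast
  have "ucomp D (Suc 0) (\<lambda>z xs. LEAST k. (k # xs) ! 1 < 5 * Suc ((k # xs) ! 0))"
    by (intro ucomp_Least_dec udec_less ucomp_mult ucomp_const ucomp_Suc ucomp_proj) (simp_all add: ex del: mult_Suc_right)
  moreover have "(LEAST k. n < 5 * Suc k) = n div 5" for n :: nat
    by (rule Least_equality) presburger+
  ultimately have "ucomp D (Suc 0) (\<lambda>z xs. xs ! 0 div 5)" by (simp del: mult_Suc_right)
  from ucomp_compose1[OF this] show "ucomp D n F \<Longrightarrow> ?thesis" by simp
qed

lemma ucomp_mod5: "ucomp D n F \<Longrightarrow> ucomp D n (\<lambda>z xs. F z xs mod 5)"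
  unfolding minus_mult_div_eq_mod[symmetric] by (intro ucomp_diff ucomp_mult ucomp_div5 ucomp_const)

lemmas ucomp_intros = ucomp_proj ucomp_const ucomp_Suc ucomp_add ucomp_mult ucomp_diff ucomp_if
  ucomp_prod_encode ucomp_prod_decode ucomp_div5 ucomp_mod5
  udec_eq udec_le udec_less udec_not udec_conj udec_disj udec_imp udec_Orc

text \<open>\<open>code_drop\<close> acts on list codes; since \<open>prod_decode 0 = (0, 0)\<close>, the tail of the empty list's
  code \<open>0\<close> is \<open>0\<close> again.\<close>

definition code_drop :: "nat \<Rightarrow> nat \<Rightarrow> nat" where
  "code_drop k i = ((\<lambda>c. snd (prod_decode (c - 1))) ^^ i) k"

definition code_nth :: "nat \<Rightarrow> nat \<Rightarrow> nat" where
  "code_nth k i = fst (prod_decode (code_drop k i - 1))"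

lemma list_decode_code_drop: "list_decode (code_drop k i) = drop i (list_decode k)"
proof (induction i)
  case 0
  show ?case by (simp add: code_drop_def)
next
  case (Suc i)
  have "prod_encode (0, 0) = 0" by (simp add: prod_encode_def)
  then have "prod_decode 0 = (0, 0)" using prod_encode_inverse[of "(0, 0)"] by simp
  then have "list_decode (snd (prod_decode (c - 1))) = tl (list_decode c)" for c
    by (cases c) (auto split: prod.split)
  then show ?case using Suc by (simp add: code_drop_def drop_Suc tl_drop)
qed

text \<open>With \<open>k\<close> a program index and \<open>i\<close> a program counter this is the
  halting condition, as an arithmetical test.\<close>

lemma code_drop_eq_0: "code_drop k i = 0 \<longleftrightarrow> length (list_decode k) \<le> i"
  by (metis drop_eq_Nil list_decode.simps(1) list_decode_code_drop list_decode_inverse list_encode.simps(1))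

lemma code_nth_eq: "i < length (list_decode k) \<Longrightarrow> code_nth k i = list_decode k ! i"
proof -
  assume i: "i < length (list_decode k)"
  then obtain c where c: "code_drop k i = Suc c" using code_drop_eq_0 by (metis not_less not0_implies_Suc)
  have "list_decode (Suc c) ! 0 = list_decode k ! i" using list_decode_code_drop[of k i] c i by simp
  then show ?thesis by (simp add: code_nth_def c split: prod.splits)
qed

lemma ucomp_code_drop:
  "ucomp D n F \<Longrightarrow> ucomp D n G \<Longrightarrow> ucomp D n (\<lambda>z xs. code_drop (F z xs) (G z xs))"
proof -
  have "ucomp D 2 (\<lambda>z xs. rec_nat (xs ! 0) (\<lambda>k y. snd (prod_decode ((y # k # xs) ! 0 - 1))) (xs ! 1))"
    by (intro ucomp_rec ucomp_intros) simp_all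
  moreover have "rec_nat a (\<lambda>k y. snd (prod_decode ((y # k # xs) ! 0 - 1))) b = code_drop a b" for a b xs
    unfolding code_drop_def by (induction b) auto
  ultimately have "ucomp D (Suc (Suc 0)) (\<lambda>z xs. code_drop (xs ! 0) (xs ! 1))" by (simp add: numeral_2_eq_2)
  from ucomp_compose2[OF this] show "ucomp D n F \<Longrightarrow> ucomp D n G \<Longrightarrow> ?thesis" by simp
qed

lemma ucomp_code_nth:
  "ucomp D n F \<Longrightarrow> ucomp D n G \<Longrightarrow> ucomp D n (\<lambda>z xs. code_nth (F z xs) (G z xs))"
  unfolding code_nth_def by (intro ucomp_code_drop ucomp_intros)

section \<open>Code fragments and compilation of recursive functions\<close>

fun reloc :: "nat \<Rightarrow> instr \<Rightarrow> instr" where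
  "reloc b (Jeq i j q) = Jeq i j (b + q)"
| "reloc b x = x"

lemma reloc_reloc: "reloc a (reloc b x) = reloc (a + b) x"
  by (cases x) auto

text \<open>\<open>p\<close> contains the instructions \<open>xs\<close> from position \<open>b + k\<close> on, where \<open>b\<close> is the origin of the
  jump targets in \<open>xs\<close>.\<close>

definition cat :: "program \<Rightarrow> nat \<Rightarrow> nat \<Rightarrow> instr list \<Rightarrow> bool" where
  "cat p b k xs \<longleftrightarrow> (\<forall>i<length xs. b + k + i < length p \<and> p ! (b + k + i) = reloc b (xs ! i))"

lemma cat_Nil [simp]: "cat p b k []"
  by (simp add: cat_def)

lemma cat_Cons [simp]:
  "cat p b k (x # xs) \<longleftrightarrow> b + k < length p \<and> p ! (b + k) = reloc b x \<and> cat p b (Suc k) xs"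
  by (auto simp: cat_def less_Suc_eq_0_disj)

lemma cat_append [simp]: "cat p b k (xs @ ys) \<longleftrightarrow> cat p b k xs \<and> cat p b (k + length xs) ys"
proof (induction xs arbitrary: k)
  case (Cons x xs)
  then show ?case by (simp add: conj_ac)
qed simp

lemma cat_reloc [simp]: "cat p b k (map (reloc m) xs) \<longleftrightarrow> (\<forall>i<length xs. b + k + i < length p \<and> p ! (b + k + i) = reloc (b + m) (xs ! i))"
  by (simp add: cat_def reloc_reloc)

lemma cat_shift: "cat p (b + k) 0 xs \<longleftrightarrow> cat p b k (map (reloc k) xs)"
  by (simp add: cat_def reloc_reloc)

text \<open>Registers in \<open>U\<close> are preserved at every intermediate configuration and the
  program counter stays in a window until the end: an enclosing infinite loop has limit values that
  depend on all configurations passed, not only on the last.\<close>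

definition brun :: "program \<Rightarrow> nat set \<Rightarrow> nat \<Rightarrow> nat \<Rightarrow> nat set \<Rightarrow> config \<Rightarrow> config \<Rightarrow> bool" where
  "brun p z lo hi U c d \<longleftrightarrow>
    (\<exists>S. run p z c S d \<and> (\<forall>e\<in>S. lo \<le> fst e \<and> fst e < hi \<and> (\<forall>r\<in>U. snd e r = snd c r))) \<and>
    (\<forall>r\<in>U. snd d r = snd c r)"

lemma brun_refl: "brun p z lo hi U c c"
  unfolding brun_def using run.refl by fastforce

lemma brun_trans:
  assumes "brun p z lo hi U c d" "brun p z lo hi U d e"
  shows "brun p z lo hi U c e"
proof -
  obtain S T where "run p z c S d" "run p z d T e"
    "\<forall>e\<in>S. lo \<le> fst e \<and> fst e < hi \<and> (\<forall>r\<in>U. snd e r = snd c r)"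
    "\<forall>e\<in>T. lo \<le> fst e \<and> fst e < hi \<and> (\<forall>r\<in>U. snd e r = snd d r)"
    using assms unfolding brun_def by blast
  moreover have "\<forall>r\<in>U. snd d r = snd c r" "\<forall>r\<in>U. snd e r = snd d r"
    using assms unfolding brun_def by blast+
  moreover have "run p z c (S \<union> T) e" using calculation run_trans by blast
  ultimately show ?thesis unfolding brun_def by (intro conjI exI[of _ "S \<union> T"]) auto
qed

lemma brun_mono:
  assumes "brun p z lo hi U c d" "lo' \<le> lo" "hi \<le> hi'" "U' \<subseteq> U"
  shows "brun p z lo' hi' U' c d"
proof -
  obtain S where "run p z c S d"
    "\<forall>e\<in>S. lo \<le> fst e \<and> fst e < hi \<and> (\<forall>r\<in>U. snd e r = snd c r)" "\<forall>r\<in>U. snd d r = snd c r"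
    using assms(1) unfolding brun_def by blast
  then show ?thesis unfolding brun_def using assms(2-4) by (intro conjI exI[of _ S]) force+
qed

lemma brun_step:
  assumes "pc < length p" "lo \<le> pc" "pc < hi" "exec z (p ! pc) (pc, R) = d" "\<And>r. r \<in> U \<Longrightarrow> snd d r = R r"
  shows "brun p z lo hi U (pc, R) d"
proof -
  have "run p z (pc, R) {(pc, R)} d"
    using run_step1[of p "(pc, R)" z] assms by (simp add: halted_def step_def)
  then show ?thesis unfolding brun_def using assms by (intro conjI exI[of _ "{(pc, R)}"]) auto
qed

lemma brun_Zero:
  "p ! pc = Zero n \<Longrightarrow> pc < length p \<Longrightarrow> lo \<le> pc \<Longrightarrow> pc < hi \<Longrightarrow> n \<notin> U \<Longrightarrow>
    brun p z lo hi U (pc, R) (Suc pc, R(n := 0))"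
  by (rule brun_step) auto

lemma brun_Inc:
  "p ! pc = Inc n \<Longrightarrow> pc < length p \<Longrightarrow> lo \<le> pc \<Longrightarrow> pc < hi \<Longrightarrow> n \<notin> U \<Longrightarrow>
    brun p z lo hi U (pc, R) (Suc pc, R(n := Suc (R n)))"
  by (rule brun_step) auto

lemma brun_Copy:
  "p ! pc = Copy i n \<Longrightarrow> pc < length p \<Longrightarrow> lo \<le> pc \<Longrightarrow> pc < hi \<Longrightarrow> n \<notin> U \<Longrightarrow>
    brun p z lo hi U (pc, R) (Suc pc, R(n := R i))"
  by (rule brun_step) auto

lemma brun_Orc:
  "p ! pc = Orc n \<Longrightarrow> pc < length p \<Longrightarrow> lo \<le> pc \<Longrightarrow> pc < hi \<Longrightarrow> n \<notin> U \<Longrightarrow>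
    brun p z lo hi U (pc, R) (Suc pc, R(n := (if R n \<in> z then 1 else 0)))"
  by (rule brun_step) auto

lemma brun_Jeq:
  "p ! pc = Jeq i j q \<Longrightarrow> pc < length p \<Longrightarrow> lo \<le> pc \<Longrightarrow> pc < hi \<Longrightarrow>
    brun p z lo hi U (pc, R) (if R i = R j then q else Suc pc, R)"
  by (rule brun_step) auto

lemma brun_Goto:
  "p ! pc = Jeq i i q \<Longrightarrow> pc < length p \<Longrightarrow> lo \<le> pc \<Longrightarrow> pc < hi \<Longrightarrow>
    brun p z lo hi U (pc, R) (q, R)"
  by (rule brun_step) auto

text \<open>The registers that the surroundings of a fragment can rely on: the fragment may write
  its output \<open>o'\<close> and the scratch registers from \<open>s\<close> to below
  \<open>N\<close>.\<close>

definition keep :: "nat \<Rightarrow> nat \<Rightarrow> nat \<Rightarrow> nat set" where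
  "keep o' s N = {r. r < s \<and> r \<noteq> o' \<or> N \<le> r}"

text \<open>Evaluation by \<open>reval\<close> is a premise, so nothing is claimed where the
  function is undefined. The same fragment serves all oracles and all load addresses.\<close>

definition computes :: "instr list \<Rightarrow> nat \<Rightarrow> recf \<Rightarrow> nat list \<Rightarrow> nat \<Rightarrow> nat \<Rightarrow> bool" where
  "computes fr N f is o' s \<longleftrightarrow> s \<le> N \<and> (\<forall>z xs y p b R. cat p b 0 fr \<longrightarrow> reval z f xs y \<longrightarrow> map R is = xs \<longrightarrow>
     (\<exists>R'. brun p z b (b + length fr) (keep o' s N) (b, R) (b + length fr, R') \<and> R' o' = y))"

lemma computesD:
  assumes "computes fr N f is o' s" "cat p b 0 fr" "reval z f xs y" "map R is = xs"
  obtains R' where "brun p z b (b + length fr) (keep o' s N) (b, R) (b + length fr, R')" "R' o' = y"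
  using assms unfolding computes_def by blast

lemma computesD':
  assumes "computes fr N f is o' s" "cat p b 0 fr" "reval z f xs y" "map R is = xs"
    and "lo \<le> b" "b + length fr \<le> hi" "U \<subseteq> keep o' s N" "pc' = b + length fr"
  obtains R' where "brun p z lo hi U (b, R) (pc', R')" "R' o' = y" "\<And>r. r \<in> keep o' s N \<Longrightarrow> R' r = R r"
proof -
  obtain R' where R': "brun p z b (b + length fr) (keep o' s N) (b, R) (b + length fr, R')" "R' o' = y"
    using computesD[OF assms(1-4)] .
  then have "\<And>r. r \<in> keep o' s N \<Longrightarrow> R' r = R r" by (simp add: brun_def)
  then show ?thesis using that brun_mono[OF R'(1) assms(5-7)] R'(2) assms(8) by blast
qed

lemma reval_RZ: "reval z RZ xs y \<Longrightarrow> y = 0"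
  by (erule reval.cases) auto

lemma reval_RS: "reval z RS xs y \<Longrightarrow> \<exists>x ys. xs = x # ys \<and> y = Suc x"
  by (erule reval.cases) auto

lemma reval_RProj: "reval z (RProj i) xs y \<Longrightarrow> i < length xs \<and> y = xs ! i"
  by (erule reval.cases) auto

lemma reval_ROrc: "reval z ROrc xs y \<Longrightarrow> \<exists>x ys. xs = x # ys \<and> y = (if x \<in> z then 1 else 0)"
  by (erule reval.cases) auto

lemma reval_RComp:
  "reval z (RComp f gs) xs y \<Longrightarrow> \<exists>ys. list_all2 (\<lambda>g y. reval z g xs y) gs ys \<and> reval z f ys y"
  by (erule reval.cases) auto

lemma reval_RMn:
  "reval z (RMn f) xs n \<Longrightarrow> reval z f (n # xs) 0 \<and> (\<forall>m<n. \<exists>y. reval z f (m # xs) y \<and> y \<noteq> 0)"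
  by (erule reval.cases) auto

lemma reval_RPrec:
  assumes "reval z (RPrec f g) xs y"
  shows "\<exists>n ys h. xs = n # ys \<and> reval z f ys (h 0) \<and> (\<forall>k<n. reval z g (h k # k # ys) (h (Suc k))) \<and> h n = y"
proof -
  obtain n ys where xs: "xs = n # ys" using assms by cases auto
  have "\<exists>h. reval z f ys (h 0) \<and> (\<forall>k<n. reval z g (h k # k # ys) (h (Suc k))) \<and> h n = y"
    using assms unfolding xs
  proof (induction n arbitrary: y)
    case 0
    then have "reval z f ys y" by (cases rule: reval.cases) auto
    then show ?case by (intro exI[of _ "\<lambda>_. y"]) simp
  next
    case (Suc n)
    from Suc.prems obtain y' where y': "reval z (RPrec f g) (n # ys) y'" "reval z g (y' # n # ys) y"
      by (cases rule: reval.cases) auto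
    then obtain h where "reval z f ys (h 0)" "\<forall>k<n. reval z g (h k # k # ys) (h (Suc k))" "h n = y'"
      using Suc.IH by blast
    then show ?case using y' by (intro exI[of _ "h(Suc n := y)"]) (auto simp: less_Suc_eq)
  qed
  then show ?thesis using xs by blast
qed

text \<open>The functions are compiled in sequence, with results in consecutive registers from
  \<open>t\<close> on. Scratch space begins at \<open>s\<close>, above all result registers, so
  arguments and earlier results survive.\<close>

lemma compile_list:
  assumes "\<And>g is o' s. g \<in> set gs \<Longrightarrow> \<forall>i\<in>set is. i < s \<Longrightarrow> o' < s \<Longrightarrow> \<exists>fr N. computes fr N g is o' s"
    and "\<forall>i\<in>set is. i < t" "t + length gs \<le> s"
  shows "\<exists>fr N. s \<le> N \<and> (\<forall>z xs ys p b R. cat p b 0 fr \<longrightarrow> list_all2 (\<lambda>g y. reval z g xs y) gs ys \<longrightarrow>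
     map R is = xs \<longrightarrow> (\<exists>R'. brun p z b (b + length fr) {r. r < s \<and> \<not> (t \<le> r \<and> r < t + length gs) \<or> N \<le> r}
       (b, R) (b + length fr, R') \<and> map R' [t..<t + length gs] = ys))"
  using assms
proof (induction gs arbitrary: t)
  case Nil
  show ?case by (intro exI[of _ "[]"] exI[of _ s]) (auto intro: brun_refl)
next
  case (Cons g gs)
  have "\<forall>i\<in>set is. i < s" "t < s" using Cons.prems(2,3) by force+
  then obtain f1 N1 where f1: "computes f1 N1 g is t s"
    using Cons.prems(1)[of g "is" s t] by auto
  obtain f2 N2 where N2: "s \<le> N2" and f2: "\<And>z xs ys p b R. cat p b 0 f2 \<Longrightarrow> list_all2 (\<lambda>g y. reval z g xs y) gs ys \<Longrightarrow>
     map R is = xs \<Longrightarrow> (\<exists>R'. brun p z b (b + length f2) {r. r < s \<and> \<not> (Suc t \<le> r \<and> r < Suc t + length gs) \<or> N2 \<le> r}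
       (b, R) (b + length f2, R') \<and> map R' [Suc t..<Suc t + length gs] = ys)"
  proof -
    have "\<forall>i\<in>set is. i < Suc t" "Suc t + length gs \<le> s" using Cons.prems(2,3) by auto
    from Cons.IH[OF Cons.prems(1)[OF list.set_intros(2)] this] show ?thesis using that by blast
  qed
  let ?fr = "f1 @ map (reloc (length f1)) f2" and ?N = "max N1 N2"
  let ?U = "{r. r < s \<and> \<not> (t \<le> r \<and> r < t + length (g # gs)) \<or> ?N \<le> r}"
  have "\<exists>R'. brun p z b (b + length ?fr) ?U (b, R) (b + length ?fr, R') \<and> map R' [t..<t + length (g # gs)] = ys"
    if c: "cat p b 0 ?fr" and l: "list_all2 (\<lambda>g y. reval z g xs y) (g # gs) ys" and R: "map R is = xs"
    for z xs ys p b R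
  proof -
    obtain y ys' where ys: "ys = y # ys'" "reval z g xs y" "list_all2 (\<lambda>g y. reval z g xs y) gs ys'"
      using l by (auto simp: list_all2_Cons1)
    have c1: "cat p b 0 f1" and c2: "cat p (b + length f1) 0 f2"
      using c unfolding cat_append cat_shift by simp_all
    obtain R1 where R1: "brun p z b (b + length ?fr) ?U (b, R) (b + length f1, R1)" "R1 t = y"
      "\<And>r. r \<in> keep t s N1 \<Longrightarrow> R1 r = R r"
      by (rule computesD'[OF f1 c1 ys(2) R, of b "b + length ?fr" ?U "b + length f1"])
        (auto simp: keep_def)
    have "map R1 is = xs" using R R1(3) Cons.prems(2,3) by (fastforce simp: keep_def)
    then obtain R2 where R2: "brun p z (b + length f1) (b + length f1 + length f2)
        {r. r < s \<and> \<not> (Suc t \<le> r \<and> r < Suc t + length gs) \<or> N2 \<le> r}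
       (b + length f1, R1) (b + length f1 + length f2, R2)" "map R2 [Suc t..<Suc t + length gs] = ys'"
      using f2[OF c2 ys(3)] by blast
    have "brun p z b (b + length ?fr) ?U (b + length f1, R1) (b + length ?fr, R2)"
    proof -
      have "brun p z b (b + length ?fr) ?U (b + length f1, R1) (b + length f1 + length f2, R2)"
        using R2(1) by (rule brun_mono) auto
      then show ?thesis by (simp add: add.assoc)
    qed
    moreover have "R2 t = y" using R2(1) R1(2) Cons.prems(3) by (simp add: brun_def)
    then have "map R2 [t..<t + length (g # gs)] = ys"
    proof -
      have "[t..<t + length (g # gs)] = t # [Suc t..<Suc t + length gs]"
        by (simp add: upt_conv_Cons del: upt_Suc)
      then show ?thesis using \<open>R2 t = y\<close> R2(2) ys(1) by simp
    qed
    ultimately show ?thesis using R1(1) brun_trans by blast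
  qed
  moreover have "s \<le> ?N" using N2 by simp
  ultimately show ?case by blast
qed

text \<open>The constructors with subterms reserve some registers from \<open>s\<close> on for their
  own variables and compile the subterms with scratch space above these.\<close>

theorem compile:
  assumes "\<forall>i\<in>set is. i < s" "o' < s"
  shows "\<exists>fr N. computes fr N f is o' s"
  using assms
proof (induction f arbitrary: "is" o' s)
  case RZ
  have "computes [Zero o'] s RZ is o' s"
    unfolding computes_def using RZ
    by (auto dest!: reval_RZ simp: keep_def intro!: exI brun_Zero)
  then show ?case by blast
next
  case RS
  have "computes [Copy (is ! 0) o', Inc o'] s RS is o' s"
    unfolding computes_def
  proof (intro conjI allI impI)
    fix z xs y p b R assume c: "cat p b 0 [Copy (is ! 0) o', Inc o']" and r: "reval z RS xs y" and R: "map R is = xs"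
    obtain x ys where x: "xs = x # ys" "y = Suc x" using reval_RS[OF r] by blast
    then have x': "R (is ! 0) = x" using R by (cases "is") auto
    have "brun p z b (b + 2) (keep o' s s) (b, R) (Suc b, R(o' := x))"
      using brun_Copy[of p b "is ! 0" o' b "b + 2" "keep o' s s" z R] c RS x' by (auto simp: keep_def)
    moreover have "brun p z b (b + 2) (keep o' s s) (Suc b, R(o' := x)) (Suc (Suc b), R(o' := y))"
      using brun_Inc[of p "Suc b" o' b "b + 2" "keep o' s s" z "R(o' := x)"] c RS x by (auto simp: keep_def)
    ultimately have "brun p z b (b + 2) (keep o' s s) (b, R) (Suc (Suc b), R(o' := y))" by (rule brun_trans)
    then show "\<exists>R'. brun p z b (b + length [Copy (is ! 0) o', Inc o']) (keep o' s s) (b, R)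
        (b + length [Copy (is ! 0) o', Inc o'], R') \<and> R' o' = y"
      by (intro exI[of _ "R(o' := y)"]) simp
  qed simp
  then show ?case by blast
next
  case (RProj i)
  have "computes [Copy (is ! i) o'] s (RProj i) is o' s"
    unfolding computes_def using RProj
    by (fastforce dest!: reval_RProj simp: keep_def intro!: exI brun_Copy)
  then show ?case by blast
next
  case (RComp f gs)
  let ?k = "length gs"
  obtain f1 N1 where N1: "s + ?k \<le> N1" and f1: "\<And>z xs ys p b R. cat p b 0 f1 \<Longrightarrow>
     list_all2 (\<lambda>g y. reval z g xs y) gs ys \<Longrightarrow> map R is = xs \<Longrightarrow>
     (\<exists>R'. brun p z b (b + length f1) {r. r < s + ?k \<and> \<not> (s \<le> r \<and> r < s + ?k) \<or> N1 \<le> r}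
       (b, R) (b + length f1, R') \<and> map R' [s..<s + ?k] = ys)"
    using compile_list[of gs "is" s "s + ?k"] RComp.IH(2) RComp.prems by blast
  obtain f2 N2 where f2: "computes f2 N2 f [s..<s + ?k] o' (s + ?k)"
    using RComp.IH(1)[of "[s..<s + ?k]" "s + ?k" o'] RComp.prems by fastforce
  let ?fr = "f1 @ map (reloc (length f1)) f2" and ?N = "max N1 N2"
  have "computes ?fr ?N (RComp f gs) is o' s"
    unfolding computes_def
  proof (intro conjI allI impI)
    show "s \<le> ?N" using N1 by simp
    fix z xs y p b R assume c: "cat p b 0 ?fr" and r: "reval z (RComp f gs) xs y" and R: "map R is = xs"
    obtain ys where ys: "list_all2 (\<lambda>g y. reval z g xs y) gs ys" "reval z f ys y"
      using reval_RComp[OF r] by blast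
    have c1: "cat p b 0 f1" and c2: "cat p (b + length f1) 0 f2"
      using c unfolding cat_append cat_shift by simp_all
    obtain R1 where R1: "brun p z b (b + length f1) {r. r < s + ?k \<and> \<not> (s \<le> r \<and> r < s + ?k) \<or> N1 \<le> r}
       (b, R) (b + length f1, R1)" "map R1 [s..<s + ?k] = ys" using f1[OF c1 ys(1) R] by blast
    have "brun p z b (b + length ?fr) (keep o' s ?N) (b, R) (b + length f1, R1)"
      using R1(1) by (rule brun_mono) (auto simp: keep_def)
    moreover obtain R2 where "brun p z b (b + length ?fr) (keep o' s ?N) (b + length f1, R1) (b + length ?fr, R2)" "R2 o' = y"
      by (rule computesD'[OF f2 c2 ys(2) R1(2), of b "b + length ?fr" "keep o' s ?N" "b + length ?fr"]) (auto simp: keep_def)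
    ultimately show "\<exists>R'. brun p z b (b + length ?fr) (keep o' s ?N) (b, R) (b + length ?fr, R') \<and> R' o' = y"
      using brun_trans by blast
  qed
  then show ?case by blast
next
  case (RPrec f g)
  show ?case
  proof (cases "is")
    case Nil
    \<comment> \<open>\<open>RPrec\<close> has no value on an empty argument list, so the empty
      fragment is correct.\<close>
    have "computes [] s (RPrec f g) is o' s"
      unfolding computes_def Nil by (auto dest!: reval_RPrec)
    then show ?thesis by blast
  next
    case (Cons n0 js)
    obtain ff N1 where ff: "computes ff N1 f js (s + 1) (s + 3)"
      using RPrec.IH(1)[of js "s + 3" "s + 1"] RPrec.prems Cons by fastforce
    obtain gg N2 where gg: "computes gg N2 g ((s + 1) # s # js) (s + 2) (s + 3)"
      using RPrec.IH(2)[of "(s + 1) # s # js" "s + 3" "s + 2"] RPrec.prems Cons by fastforce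
    let ?A = "length ff" and ?B = "length gg"
    \<comment> \<open>Register \<open>s\<close> counts up to the argument in \<open>n0\<close>,
      \<open>s + 1\<close> holds the current value and \<open>s + 2\<close> receives the next one.
      \<open>Jeq 0 0\<close> is an unconditional jump.\<close>
    define fr where "fr = ff @ [Zero s, Jeq s n0 (?A + ?B + 5)] @ map (reloc (?A + 2)) gg @
      [Copy (s + 2) (s + 1), Inc s, Jeq 0 0 (?A + 1), Copy (s + 1) o']"
    have len: "length fr = ?A + ?B + 6" by (simp add: fr_def)
    define N where "N = max N1 N2"
    have "computes fr N (RPrec f g) is o' s"
      unfolding computes_def
    proof (intro conjI allI impI)
      have "s + 3 \<le> N1" using ff unfolding computes_def by blast
      then have sN: "s + 3 \<le> N" unfolding N_def by auto
      then show "s \<le> N" by simp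
      fix z xs y p b R assume c: "cat p b 0 fr" and r: "reval z (RPrec f g) xs y" and R: "map R is = xs"
      obtain n ys h where h: "xs = n # ys" "reval z f ys (h 0)" "\<And>k. k < n \<Longrightarrow> reval z g (h k # k # ys) (h (Suc k))" "h n = y"
        using reval_RPrec[OF r] by blast
      have Rn: "R n0 = n" "map R js = ys" using R h(1) Cons by auto
      have c1: "cat p b 0 ff" and c2: "cat p (b + ?A + 2) 0 gg"
        using c unfolding fr_def cat_append cat_shift[of p b "?A + 2", unfolded add.assoc[symmetric]] by (simp_all add: cat_def)
      have ci: "b + ?A + ?B + 5 < length p"
        "p ! (b + ?A) = Zero s" "p ! (b + ?A + 1) = Jeq s n0 (b + ?A + ?B + 5)"
        "p ! (b + ?A + ?B + 2) = Copy (s + 2) (s + 1)" "p ! (b + ?A + ?B + 3) = Inc s"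
        "p ! (b + ?A + ?B + 4) = Jeq 0 0 (b + ?A + 1)" "p ! (b + ?A + ?B + 5) = Copy (s + 1) o'"
        using c unfolding fr_def by (simp_all add: add_ac eval_nat_numeral)
      let ?br = "brun p z b (b + length fr) (keep o' s N)"
      have out: "s \<notin> keep o' s N" "s + 1 \<notin> keep o' s N" "s + 2 \<notin> keep o' s N" "o' \<notin> keep o' s N"
        using sN RPrec.prems by (auto simp: keep_def)
      have old: "n0 < s" "\<And>j. j \<in> set js \<Longrightarrow> j < s" using RPrec.prems Cons by auto
      have inv: "k \<le> n \<Longrightarrow> \<exists>R'. ?br (b, R) (b + ?A + 1, R') \<and> R' s = k \<and> R' (s + 1) = h k \<and> (\<forall>r<s. R' r = R r)" for k
      proof (induction k)
        case 0
        obtain R1 where R1: "?br (b, R) (b + ?A, R1)" "R1 (s + 1) = h 0" "\<And>r. r \<in> keep (s + 1) (s + 3) N1 \<Longrightarrow> R1 r = R r"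
          by (rule computesD'[OF ff c1 h(2) Rn(2), of b "b + length fr" "keep o' s N" "b + ?A"])
            (auto simp: len keep_def N_def)
        have "?br (b + ?A, R1) (Suc (b + ?A), R1(s := 0))"
          by (rule brun_Zero) (use ci out len in auto)
        then have "?br (b, R) (b + ?A + 1, R1(s := 0))" using R1(1) brun_trans by simp
        moreover have "(R1(s := 0)) s = 0" "(R1(s := 0)) (s + 1) = h 0"
          "\<forall>r<s. (R1(s := 0)) r = R r"
          using R1 by (auto simp: keep_def)
        ultimately show ?case by blast
      next
        case (Suc k)
        then obtain R1 where R1: "?br (b, R) (b + ?A + 1, R1)" "R1 s = k" "R1 (s + 1) = h k" "\<forall>r<s. R1 r = R r"
          by auto
        have R1n: "R1 n0 = n" "map R1 js = ys" using R1(4) Rn old Cons by auto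
        have "?br (b + ?A + 1, R1) (if R1 s = R1 n0 then b + ?A + ?B + 5 else Suc (b + ?A + 1), R1)"
          by (rule brun_Jeq) (use ci len in auto)
        then have s1: "?br (b + ?A + 1, R1) (b + ?A + 2, R1)" using R1(2) R1n Suc.prems by simp
        have args: "map R1 ((s + 1) # s # js) = h k # k # ys" using R1 R1n by simp
        obtain R2 where R2: "?br (b + ?A + 2, R1) (b + ?A + ?B + 2, R2)" "R2 (s + 2) = h (Suc k)"
          "\<And>r. r \<in> keep (s + 2) (s + 3) N2 \<Longrightarrow> R2 r = R1 r"
          by (rule computesD'[OF gg c2 h(3) args, of b "b + length fr" "keep o' s N" "b + ?A + ?B + 2"])
            (use Suc.prems in \<open>auto simp: len keep_def N_def\<close>)
        have s3: "?br (b + ?A + ?B + 2, R2) (Suc (b + ?A + ?B + 2), R2(s + 1 := R2 (s + 2)))"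
          by (rule brun_Copy) (use ci out len in auto)
        let ?R3 = "R2(s + 1 := R2 (s + 2))"
        have s4: "?br (Suc (b + ?A + ?B + 2), ?R3) (Suc (Suc (b + ?A + ?B + 2)), ?R3(s := Suc (?R3 s)))"
          by (rule brun_Inc) (use ci out len in \<open>auto simp: eval_nat_numeral\<close>)
        have s5: "?br (Suc (Suc (b + ?A + ?B + 2)), ?R3(s := Suc (?R3 s))) (b + ?A + 1, ?R3(s := Suc (?R3 s)))"
          by (rule brun_Goto[of _ _ 0]) (use ci out len in \<open>auto simp: eval_nat_numeral\<close>)
        have "?br (b, R) (b + ?A + 1, ?R3(s := Suc (?R3 s)))"
          using brun_trans[OF brun_trans[OF brun_trans[OF brun_trans[OF brun_trans[OF R1(1) s1] R2(1)] s3] s4] s5] .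
        moreover have "R2 r = R1 r" if "r < s + 2" for r using R2(3) that by (simp add: keep_def)
        then have "(?R3(s := Suc (?R3 s))) s = Suc k" "(?R3(s := Suc (?R3 s))) (s + 1) = h (Suc k)"
          "\<forall>r<s. (?R3(s := Suc (?R3 s))) r = R r"
          using R1(2,4) R2(2) by auto
        ultimately show ?case by blast
      qed
      obtain R1 where R1: "?br (b, R) (b + ?A + 1, R1)" "R1 s = n" "R1 (s + 1) = y" "\<forall>r<s. R1 r = R r"
        using inv[of n] h(4) by blast
      have "R1 n0 = n" using R1(4) Rn old Cons by auto
      have "?br (b + ?A + 1, R1) (if R1 s = R1 n0 then b + ?A + ?B + 5 else Suc (b + ?A + 1), R1)"
        by (rule brun_Jeq) (use ci len in auto)
      then have "?br (b + ?A + 1, R1) (b + ?A + ?B + 5, R1)" using R1(2) \<open>R1 n0 = n\<close> by simp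
      moreover have "?br (b + ?A + ?B + 5, R1) (Suc (b + ?A + ?B + 5), R1(o' := R1 (s + 1)))"
        by (rule brun_Copy) (use ci out len in auto)
      ultimately have "?br (b, R) (Suc (b + ?A + ?B + 5), R1(o' := R1 (s + 1)))"
        using R1(1) brun_trans by blast
      moreover have "Suc (b + ?A + ?B + 5) = b + length fr" using len by simp
      ultimately show "\<exists>R'. ?br (b, R) (b + length fr, R') \<and> R' o' = y"
        using R1(3) by (intro exI[of _ "R1(o' := R1 (s + 1))"]) simp
    qed
    then show ?thesis by blast
  qed
next
  case (RMn f)
  obtain ff N where ff: "computes ff N f (s # is) (s + 1) (s + 3)"
    using RMn.IH[of "s # is" "s + 3" "s + 1"] RMn.prems by fastforce
  let ?A = "length ff"
  \<comment> \<open>Register \<open>s\<close> holds the candidate, \<open>s + 1\<close> the value at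
    it and \<open>s + 2\<close> the constant 0 for comparison.\<close>
  define fr where "fr = [Zero s, Zero (s + 2)] @ map (reloc 2) ff @
    [Jeq (s + 1) (s + 2) (?A + 5), Inc s, Jeq 0 0 2, Copy s o']"
  have len: "length fr = ?A + 6" by (simp add: fr_def)
  have "computes fr N (RMn f) is o' s"
    unfolding computes_def
  proof (intro conjI allI impI)
    have sN: "s + 3 \<le> N" using ff unfolding computes_def by blast
    then show "s \<le> N" by simp
    fix z xs y p b R assume c: "cat p b 0 fr" and r: "reval z (RMn f) xs y" and R: "map R is = xs"
    have h: "reval z f (y # xs) 0" "\<And>m. m < y \<Longrightarrow> \<exists>v. reval z f (m # xs) v \<and> v \<noteq> 0"
      using reval_RMn[OF r] by blast+
    have c1: "cat p (b + 2) 0 ff"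
      using c unfolding fr_def cat_append cat_shift[of p b 2] by (simp add: eval_nat_numeral)
    have ci: "b + ?A + 5 < length p" "p ! b = Zero s" "p ! (b + 1) = Zero (s + 2)"
      "p ! (b + ?A + 2) = Jeq (s + 1) (s + 2) (b + ?A + 5)" "p ! (b + ?A + 3) = Inc s"
      "p ! (b + ?A + 4) = Jeq 0 0 (b + 2)" "p ! (b + ?A + 5) = Copy s o'"
      using c unfolding fr_def by (simp_all add: add_ac eval_nat_numeral)
    let ?br = "brun p z b (b + length fr) (keep o' s N)"
    have out: "s \<notin> keep o' s N" "s + 1 \<notin> keep o' s N" "s + 2 \<notin> keep o' s N" "o' \<notin> keep o' s N"
      using sN RMn.prems by (auto simp: keep_def)
    have fresh: "s \<notin> set is" "s + 2 \<notin> set is" using RMn.prems by auto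
    have body: "\<exists>R'. ?br (b + 2, R1) (b + ?A + 2, R') \<and> R' (s + 1) = v \<and> R' (s + 2) = 0 \<and> R' s = m \<and> map R' is = xs"
      if R1: "R1 s = m" "map R1 is = xs" "R1 (s + 2) = 0" "reval z f (m # xs) v" for R1 m v
    proof -
      have args: "map R1 (s # is) = m # xs" using R1 by simp
      obtain R2 where R2: "?br (b + 2, R1) (b + ?A + 2, R2)" "R2 (s + 1) = v"
        "\<And>r. r \<in> keep (s + 1) (s + 3) N \<Longrightarrow> R2 r = R1 r"
        by (rule computesD'[OF ff c1 R1(4) args, of b "b + length fr" "keep o' s N" "b + ?A + 2"])
          (auto simp: len keep_def)
      have "R2 (s + 2) = 0" "R2 s = m" using R2(3) R1 by (auto simp: keep_def)
      moreover have "map R2 is = xs" using R2(3) R1(2) RMn.prems by (fastforce simp: keep_def)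
      ultimately show ?thesis using R2 by blast
    qed
    have inv: "m \<le> y \<Longrightarrow> \<exists>R'. ?br (b, R) (b + 2, R') \<and> R' s = m \<and> R' (s + 2) = 0 \<and> map R' is = xs" for m
    proof (induction m)
      case 0
      have "?br (b, R) (Suc b, R(s := 0))" by (rule brun_Zero) (use ci out len in auto)
      moreover have "?br (Suc b, R(s := 0)) (Suc (Suc b), R(s := 0, s + 2 := 0))"
        by (rule brun_Zero) (use ci out len in auto)
      ultimately have "?br (b, R) (b + 2, R(s := 0, s + 2 := 0))" using brun_trans by simp
      moreover have "(R(s := 0, s + 2 := 0)) s = 0" "(R(s := 0, s + 2 := 0)) (s + 2) = 0"
        "map (R(s := 0, s + 2 := 0)) is = xs" using R fresh by auto
      ultimately show ?case by blast
    next
      case (Suc m)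
      then obtain R1 where R1: "?br (b, R) (b + 2, R1)" "R1 s = m" "R1 (s + 2) = 0" "map R1 is = xs" by auto
      obtain v where v: "reval z f (m # xs) v" "v \<noteq> 0" using h(2)[of m] Suc.prems by auto
      obtain R2 where R2: "?br (b + 2, R1) (b + ?A + 2, R2)" "R2 (s + 1) = v" "R2 (s + 2) = 0" "R2 s = m" "map R2 is = xs"
        using body[OF R1(2,4,3) v(1)] by blast
      have "?br (b + ?A + 2, R2) (if R2 (s + 1) = R2 (s + 2) then b + ?A + 5 else Suc (b + ?A + 2), R2)"
        by (rule brun_Jeq) (use ci len in auto)
      then have s3: "?br (b + ?A + 2, R2) (b + ?A + 3, R2)" using R2 v by (simp add: eval_nat_numeral)
      have s4: "?br (b + ?A + 3, R2) (Suc (b + ?A + 3), R2(s := Suc (R2 s)))"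
        by (rule brun_Inc) (use ci out len in auto)
      have s5: "?br (Suc (b + ?A + 3), R2(s := Suc (R2 s))) (b + 2, R2(s := Suc (R2 s)))"
        by (rule brun_Goto[of _ _ 0]) (use ci out len in \<open>auto simp: eval_nat_numeral\<close>)
      have "?br (b, R) (b + 2, R2(s := Suc (R2 s)))"
        using brun_trans[OF brun_trans[OF brun_trans[OF brun_trans[OF R1(1) R2(1)] s3] s4] s5] .
      moreover have "(R2(s := Suc (R2 s))) s = Suc m" "(R2(s := Suc (R2 s))) (s + 2) = 0"
        "map (R2(s := Suc (R2 s))) is = xs" using R2 fresh by auto
      ultimately show ?case by blast
    qed
    obtain R1 where R1: "?br (b, R) (b + 2, R1)" "R1 s = y" "R1 (s + 2) = 0" "map R1 is = xs" using inv by blast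
    obtain R2 where R2: "?br (b + 2, R1) (b + ?A + 2, R2)" "R2 (s + 1) = 0" "R2 (s + 2) = 0" "R2 s = y"
      using body[OF R1(2,4,3) h(1)] by blast
    have "?br (b + ?A + 2, R2) (if R2 (s + 1) = R2 (s + 2) then b + ?A + 5 else Suc (b + ?A + 2), R2)"
      by (rule brun_Jeq) (use ci len in auto)
    then have s3: "?br (b + ?A + 2, R2) (b + ?A + 5, R2)" using R2 by simp
    have s4: "?br (b + ?A + 5, R2) (Suc (b + ?A + 5), R2(o' := R2 s))"
      by (rule brun_Copy) (use ci out len in auto)
    have "?br (b, R) (b + length fr, R2(o' := R2 s))"
      using brun_trans[OF brun_trans[OF brun_trans[OF R1(1) R2(1)] s3] s4] len by (simp add: add_ac)
    then show "\<exists>R'. ?br (b, R) (b + length fr, R') \<and> R' o' = y"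
      using R2(4) by (intro exI[of _ "R2(o' := R2 s)"]) simp
  qed
  then show ?case by blast
next
  case ROrc
  have "computes [Copy (is ! 0) o', Orc o'] s ROrc is o' s"
    unfolding computes_def
  proof (intro conjI allI impI)
    fix z xs y p b R assume c: "cat p b 0 [Copy (is ! 0) o', Orc o']" and r: "reval z ROrc xs y" and R: "map R is = xs"
    obtain x ys where x: "xs = x # ys" "y = (if x \<in> z then 1 else 0)" using reval_ROrc[OF r] by blast
    then have x': "R (is ! 0) = x" using R by (cases "is") auto
    have "brun p z b (b + 2) (keep o' s s) (b, R) (Suc b, R(o' := x))"
      using brun_Copy[of p b "is ! 0" o' b "b + 2" "keep o' s s" z R] c ROrc x' by (auto simp: keep_def)
    moreover have "brun p z b (b + 2) (keep o' s s) (Suc b, R(o' := x)) (Suc (Suc b), R(o' := y))"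
      using brun_Orc[of p "Suc b" o' b "b + 2" "keep o' s s" z "R(o' := x)"] c ROrc x by (auto simp: keep_def)
    ultimately have "brun p z b (b + 2) (keep o' s s) (b, R) (Suc (Suc b), R(o' := y))" by (rule brun_trans)
    then show "\<exists>R'. brun p z b (b + length [Copy (is ! 0) o', Orc o']) (keep o' s s) (b, R)
        (b + length [Copy (is ! 0) o', Orc o'], R') \<and> R' o' = y"
      by (intro exI[of _ "R(o' := y)"]) simp
  qed simp
  then show ?case by blast
qed

section \<open>Deciding well-foundedness by depth-first search\<close>

text \<open>A whole search stack in one register: \<open>x\<close> pushed onto \<open>s\<close>. The
  \<open>Suc\<close> makes every push increase the code, so the register stays at or above the code
  of a node while its subtree is explored, and it tends to infinity along an infinite
  descent.\<close>

definition node :: "nat \<Rightarrow> nat \<Rightarrow> nat" where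
  "node x s = Suc (prod_encode (x, s))"

lemma node_gt: "s < node x s"
  unfolding node_def using le_prod_encode_2[of s x] by simp

text \<open>\<open>brun\<close> enriched by what the next limit depends on: a lower bound
  \<open>s\<close> for the node register 1, and whether the flag register 3 passes through
  0.\<close>

definition arun :: "program \<Rightarrow> nat set \<Rightarrow> nat \<Rightarrow> nat \<Rightarrow> nat set \<Rightarrow> bool \<Rightarrow> nat \<Rightarrow> config \<Rightarrow> config \<Rightarrow> bool" where
  "arun p z lo hi U fl s c d \<longleftrightarrow>
    (\<exists>S. run p z c S d \<and> (\<forall>e\<in>S. lo \<le> fst e \<and> fst e < hi \<and> (\<forall>r\<in>U. snd e r = snd c r) \<and> s \<le> snd e 1) \<and>
      (fl \<longrightarrow> (\<exists>e\<in>S. snd e 3 = 0))) \<and> (\<forall>r\<in>U. snd d r = snd c r)"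

lemma arun_trans:
  assumes "arun p z lo hi U f1 s c d" "arun p z lo hi U f2 s d e"
  shows "arun p z lo hi U (f1 \<or> f2) s c e"
proof -
  obtain S where S: "run p z c S d" "\<forall>e\<in>S. lo \<le> fst e \<and> fst e < hi \<and> (\<forall>r\<in>U. snd e r = snd c r) \<and> s \<le> snd e 1"
    "f1 \<longrightarrow> (\<exists>e\<in>S. snd e 3 = 0)" "\<forall>r\<in>U. snd d r = snd c r"
    using assms(1) unfolding arun_def by blast
  obtain T where T: "run p z d T e" "\<forall>e\<in>T. lo \<le> fst e \<and> fst e < hi \<and> (\<forall>r\<in>U. snd e r = snd d r) \<and> s \<le> snd e 1"
    "f2 \<longrightarrow> (\<exists>e\<in>T. snd e 3 = 0)" "\<forall>r\<in>U. snd e r = snd d r"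
    using assms(2) unfolding arun_def by blast
  have "run p z c (S \<union> T) e" using S(1) T(1) run_trans by blast
  moreover have "\<forall>e\<in>S \<union> T. lo \<le> fst e \<and> fst e < hi \<and> (\<forall>r\<in>U. snd e r = snd c r) \<and> s \<le> snd e 1"
    using S(2,4) T(2) by auto
  moreover have "f1 \<or> f2 \<longrightarrow> (\<exists>e\<in>S \<union> T. snd e 3 = 0)" using S(3) T(3) by blast
  moreover have "\<forall>r\<in>U. snd e r = snd c r" using S(4) T(4) by simp
  ultimately show ?thesis unfolding arun_def by blast
qed

lemma arun_mono: "arun p z lo hi U f s c d \<Longrightarrow> t \<le> s \<Longrightarrow> g \<longrightarrow> f \<Longrightarrow> arun p z lo hi U g t c d"
  unfolding arun_def by (meson order_trans)

lemma arun_brun: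
  assumes "brun p z lo hi (insert 1 U) c d" "s \<le> snd c 1"
  shows "arun p z lo hi U False s c d"
proof -
  obtain S where "run p z c S d" "\<forall>e\<in>S. lo \<le> fst e \<and> fst e < hi \<and> (\<forall>r\<in>insert 1 U. snd e r = snd c r)"
    "\<forall>r\<in>insert 1 U. snd d r = snd c r"
    using assms(1) unfolding brun_def by blast
  then show ?thesis unfolding arun_def using assms(2) by (intro conjI exI[of _ S]) auto
qed

lemma arun_step:
  assumes "pc < length p" "lo \<le> pc" "pc < hi" "exec z (p ! pc) (pc, R) = d" "\<And>r. r \<in> U \<Longrightarrow> snd d r = R r"
    "s \<le> R 1" "fl \<Longrightarrow> R 3 = 0"
  shows "arun p z lo hi U fl s (pc, R) d"
proof -
  have "run p z (pc, R) {(pc, R)} d"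
    using run_step1[of p "(pc, R)" z] assms by (simp add: halted_def step_def)
  then show ?thesis unfolding arun_def using assms by (intro conjI exI[of _ "{(pc, R)}"]) auto
qed

lemma brun_arun: "arun p z lo hi U f s c d \<Longrightarrow> brun p z lo hi U c d"
  unfolding arun_def brun_def by blast

lemma liminf_const:
  assumes "\<And>n. \<exists>w. w \<in> A n" "\<And>n w. w \<in> A n \<Longrightarrow> w = v"
  shows "liminf A = v"
proof (rule liminf_eqI)
  have "v \<in> A n" for n using assms by metis
  then show "often A v" unfolding often_def by blast
  show "\<And>n w. w \<in> A n \<Longrightarrow> v \<le> w" using assms(2) by auto
qed

locale dfs =
  fixes p :: program and z :: "nat set" and L hi :: nat and U :: "nat set" and E :: "nat \<Rightarrow> nat \<Rightarrow> bool"
  assumes U: "5 \<in> U" "6 \<in> U"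
begin

definition at_node :: "nat \<Rightarrow> nat \<Rightarrow> (nat \<Rightarrow> nat) \<Rightarrow> bool" where
  "at_node s x R \<longleftrightarrow> R 1 = s \<and> R 2 = x \<and> R 3 = 1 \<and> R 5 = 0 \<and> R 6 = 1"

definition at_limit :: "nat \<Rightarrow> (nat \<Rightarrow> nat) \<Rightarrow> bool" where
  "at_limit s R \<longleftrightarrow> R 1 = s \<and> R 3 = 0 \<and> R 5 = 0 \<and> R 6 = 1"

abbreviation "ar \<equiv> arun p z L hi U"

text \<open>Every round starts at \<open>L\<close> and never runs below it, so the limit resumes at
  \<open>L\<close>; the flag passes through 0 in every round, so it reads 0 there. If the node
  register keeps returning to \<open>s 0\<close> without falling below, this is its liminf; if it
  grows strictly from round to round, no value recurs and it is reset to 0.\<close>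

lemma omega_limit:
  assumes r: "\<And>n. ar True (s n) (L, R n) (L, R (Suc n))" and R1: "\<And>n. R n 1 = s n" and s: "\<And>n. s 0 \<le> s n"
    and R5: "R 0 5 = 0" "R 0 6 = 1"
  obtains R' where "ar True (s 0) (L, R 0) (L, R')"
    "(\<forall>n. s n = s 0) \<Longrightarrow> at_limit (s 0) R'" "strict_mono s \<Longrightarrow> at_limit 0 R'"
proof -
  have "\<exists>S. \<forall>n. run p z (L, R n) (S n) (L, R (Suc n)) \<and>
     (\<forall>e\<in>S n. L \<le> fst e \<and> fst e < hi \<and> (\<forall>r\<in>U. snd e r = R n r) \<and> s n \<le> snd e 1) \<and> (\<exists>e\<in>S n. snd e 3 = 0)"
    using r unfolding arun_def by (intro choice) auto
  then obtain S where S: "\<And>n. run p z (L, R n) (S n) (L, R (Suc n))"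
    "\<And>n e. e \<in> S n \<Longrightarrow> L \<le> fst e \<and> fst e < hi \<and> (\<forall>r\<in>U. snd e r = R n r) \<and> s n \<le> snd e 1"
    "\<And>n. \<exists>e\<in>S n. snd e 3 = 0" by blast
  have ne: "S n \<noteq> {}" for n using S(3) by blast
  have start: "(L, R n) \<in> S n" for n using run_start[OF S(1)] ne by blast
  have Uc: "R n r = R 0 r" if "r \<in> U" for n r
    using that by (induction n) (use r in \<open>auto simp: arun_def\<close>)
  have run: "run p z (L, R 0) (\<Union>n. S n) (limc S)" using run.lim[of p z "\<lambda>n. (L, R n)" S] S(1) ne by blast
  have pc: "fst (limc S) = L"
    unfolding limc_def fst_conv
    by (rule liminf_eqI) (use start S(2) in \<open>force simp: often_def\<close>)+
  have reg3: "snd (limc S) 3 = 0"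
    unfolding limc_def snd_conv
    by (rule liminf_eqI) (use S(3) in \<open>force simp: often_def\<close>)+
  have regU: "snd (limc S) r = R 0 r" if "r \<in> U" for r
    unfolding limc_def snd_conv
    by (rule liminf_const) (use ne S(2) Uc[OF that] that in \<open>fastforce+\<close>)
  have lim: "limc S = (L, snd (limc S))" using pc by (metis prod.collapse)
  have "ar True (s 0) (L, R 0) (L, snd (limc S))"
    unfolding arun_def
  proof (intro conjI exI[of _ "\<Union>n. S n"])
    show "run p z (L, R 0) (\<Union>n. S n) (L, snd (limc S))" using run lim by simp
    show "\<forall>e\<in>\<Union>n. S n. L \<le> fst e \<and> fst e < hi \<and> (\<forall>r\<in>U. snd e r = snd (L, R 0) r) \<and> s 0 \<le> snd e 1"
    proof
      fix e assume "e \<in> (\<Union>n. S n)"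
      then obtain n where n: "e \<in> S n" by blast
      have "\<forall>r\<in>U. snd e r = snd (L, R 0) r" using S(2)[OF n] Uc[of _ n] by simp
      moreover have "s 0 \<le> snd e 1" using S(2)[OF n] s[of n] by linarith
      ultimately show "L \<le> fst e \<and> fst e < hi \<and> (\<forall>r\<in>U. snd e r = snd (L, R 0) r) \<and> s 0 \<le> snd e 1"
        using S(2)[OF n] by blast
    qed
    show "True \<longrightarrow> (\<exists>e\<in>\<Union>n. S n. snd e 3 = 0)" using S(3) by blast
  qed (use regU in simp)
  moreover have "at_limit (s 0) (snd (limc S))" if "\<forall>n. s n = s 0"
  proof -
    have "snd (limc S) 1 = s 0"
      unfolding limc_def snd_conv
    proof (rule liminf_eqI)
      show "often (\<lambda>n. (\<lambda>d. snd d 1) ` S n) (s 0)"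
        unfolding often_def using start R1 that by (metis (no_types, lifting) image_eqI order_refl snd_conv)
      show "\<And>n w. w \<in> (\<lambda>d. snd d 1) ` S n \<Longrightarrow> s 0 \<le> w" using S(2) that by (metis imageE)
    qed
    then show ?thesis using reg3 regU U R5 by (simp add: at_limit_def)
  qed
  moreover have "at_limit 0 (snd (limc S))" if m: "strict_mono s"
  proof -
    have "\<not> often (\<lambda>n. (\<lambda>d. snd d 1) ` S n) v" for v
    proof
      assume "often (\<lambda>n. (\<lambda>d. snd d 1) ` S n) v"
      then obtain n d where "n \<ge> Suc v" "d \<in> S n" "v = snd d 1" unfolding often_def by blast
      moreover from this have "s n \<le> v" using S(2) by blast
      moreover have "n \<le> s n" using m by (rule strict_mono_imp_increasing)
      ultimately show False by linarith
    qed
    then have "\<nexists>v. often (\<lambda>n. (\<lambda>d. snd d 1) ` S n) v" by blast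
    then have "snd (limc S) 1 = 0" unfolding limc_def snd_conv liminf_def by (rule if_not_P)
    then show ?thesis using reg3 regU U R5 by (simp add: at_limit_def)
  qed
  ultimately show ?thesis using that by blast
qed

end

text \<open>What the rounds of the search loop achieve in terms of the edge relation. The outcome of
  the search follows from these three facts, separately from the code.\<close>

locale dfs_steps = dfs +
  assumes push: "\<And>s x R. at_node s x R \<Longrightarrow> E x s \<Longrightarrow> \<exists>R'. ar True s (L, R) (L, R') \<and> at_node (node x s) 0 R'"
    and skip: "\<And>s x R. at_node s x R \<Longrightarrow> \<not> E x s \<Longrightarrow> \<exists>R'. ar True s (L, R) (L, R') \<and> at_node s (Suc x) R'"
    and pop: "\<And>s x R. at_limit (node x s) R \<Longrightarrow> 1 \<le> s \<Longrightarrow> \<exists>R'. ar False s (L, R) (L, R') \<and> at_node s (Suc x) R'"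
begin

definition child :: "nat \<Rightarrow> nat \<Rightarrow> bool" where
  "child t s \<longleftrightarrow> (\<exists>x. t = node x s \<and> E x s)"

lemma next_child:
  assumes "E x s \<Longrightarrow> \<forall>R. at_node (node x s) 0 R \<longrightarrow>
      (\<exists>R'. ar True (node x s) (L, R) (L, R') \<and> at_limit (node x s) R')"
    and "at_node s x R" "1 \<le> s"
  shows "\<exists>R'. ar True s (L, R) (L, R') \<and> at_node s (Suc x) R'"
proof (cases "E x s")
  case True
  obtain R1 where R1: "ar True s (L, R) (L, R1)" "at_node (node x s) 0 R1" using push[OF assms(2) True] by blast
  obtain R2 where R2: "ar True (node x s) (L, R1) (L, R2)" "at_limit (node x s) R2"
    using assms(1)[OF True] R1(2) by blast
  obtain R3 where R3: "ar False s (L, R2) (L, R3)" "at_node s (Suc x) R3" using pop[OF R2(2) assms(3)] by blast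
  have "ar True s (L, R1) (L, R2)" using R2(1) by (rule arun_mono) (use node_gt[of s x] in auto)
  then have "ar True s (L, R) (L, R3)" using arun_trans[OF arun_trans[OF R1(1)] R3(1)] by simp
  then show ?thesis using R3(2) by blast
next
  case False
  then show ?thesis using skip assms(2) by blast
qed

text \<open>Induction on accessibility. All natural numbers are tried as children in omega many
  steps, each returning to \<open>s\<close> after completing the subtree if there is one. The limit
  signals that \<open>s\<close> is exhausted; even a leaf takes a limit.\<close>

lemma explore_wf:
  assumes "Wellfounded.accp child s" "1 \<le> s" "at_node s x R"
  shows "\<exists>R'. ar True s (L, R) (L, R') \<and> at_limit s R'"
  using assms
proof (induction arbitrary: x R rule: accp.induct)
  case (accI s)
  have step: "\<exists>R'. ar True s (L, R) (L, R') \<and> at_node s (Suc y) R'" if "at_node s y R" for y R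
  proof (rule next_child[OF _ that accI.prems(1)], intro allI impI)
    fix R1 assume "E y s" "at_node (node y s) 0 R1"
    then show "\<exists>R'. ar True (node y s) (L, R1) (L, R') \<and> at_limit (node y s) R'"
      using accI.IH[of "node y s" 0 R1] node_gt[of s y] accI.prems(1) unfolding child_def by fastforce
  qed
  have "\<exists>Q. \<forall>n. (at_node s (x + n) (Q n) \<and> (n = 0 \<longrightarrow> Q n = R)) \<and> ar True s (L, Q n) (L, Q (Suc n))"
    by (rule dependent_nat_choice) (use accI.prems(2) step in auto)
  then obtain Q where "\<forall>n. (at_node s (x + n) (Q n) \<and> (n = 0 \<longrightarrow> Q n = R)) \<and> ar True s (L, Q n) (L, Q (Suc n))" ..
  then have Q: "\<And>n. at_node s (x + n) (Q n)" "Q 0 = R" "\<And>n. ar True s (L, Q n) (L, Q (Suc n))" by simp_all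
  obtain R' where "ar True s (L, Q 0) (L, R')" "at_limit s R'"
    by (rule omega_limit[of "\<lambda>_. s" Q]) (use Q in \<open>auto simp: at_node_def\<close>)
  then show ?case using Q(2) by blast
qed

text \<open>From an inaccessible node the search completes the accessible children before the least
  inaccessible one and then descends into that one. Repeating this gives strictly increasing node
  codes, so the register is reset to 0 at the limit.\<close>

lemma explore_not_wf:
  assumes "\<not> Wellfounded.accp child s" "1 \<le> s" "at_node s 0 R"
  shows "\<exists>R'. ar True s (L, R) (L, R') \<and> at_limit 0 R'"
proof -
  let ?bad = "\<lambda>(s, R). \<not> Wellfounded.accp child s \<and> 1 \<le> s \<and> at_node s 0 R"
  have step: "\<exists>y. ?bad y \<and> (fst w < fst y \<and> ar True (fst w) (L, snd w) (L, snd y))" if "?bad w" for w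
  proof -
    obtain s R where w: "w = (s, R)" by fastforce
    have s: "\<not> Wellfounded.accp child s" "1 \<le> s" "at_node s 0 R" using that w by auto
    define x where "x = (LEAST x. E x s \<and> \<not> Wellfounded.accp child (node x s))"
    have "\<exists>x. E x s \<and> \<not> Wellfounded.accp child (node x s)"
      using s(1) accp.accI[of child s] unfolding child_def by blast
    then have x: "E x s" "\<not> Wellfounded.accp child (node x s)" unfolding x_def by (metis (mono_tags, lifting) LeastI_ex)+
    have less: "Wellfounded.accp child (node y s)" if "y < x" "E y s" for y
      using that not_less_Least unfolding x_def by blast
    have "y \<le> x \<Longrightarrow> \<exists>R'. (y = 0 \<and> R' = R \<or> ar True s (L, R) (L, R')) \<and> at_node s y R'" for y
    proof (induction y)
      case 0
      then show ?case using s(3) by blast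
    next
      case (Suc y)
      then obtain R1 where R1: "y = 0 \<and> R1 = R \<or> ar True s (L, R) (L, R1)" "at_node s y R1" by auto
      have "\<exists>R'. ar True s (L, R1) (L, R') \<and> at_node s (Suc y) R'"
      proof (rule next_child[OF _ R1(2) s(2)], intro allI impI)
        fix R2 assume "E y s" "at_node (node y s) 0 R2"
        then show "\<exists>R'. ar True (node y s) (L, R2) (L, R') \<and> at_limit (node y s) R'"
          using explore_wf less Suc.prems node_gt[of s y] s(2) by (metis Suc_le_lessD less_imp_le order_trans)
      qed
      then obtain R2 where R2: "ar True s (L, R1) (L, R2)" "at_node s (Suc y) R2" by blast
      have "ar True s (L, R) (L, R2)" using R1(1) R2(1) arun_trans[of p z L hi U True s "(L, R)" "(L, R1)" True "(L, R2)"] by auto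
      then show ?case using R2(2) by blast
    qed
    then obtain R1 where R1: "x = 0 \<and> R1 = R \<or> ar True s (L, R) (L, R1)" "at_node s x R1" by blast
    obtain R2 where R2: "ar True s (L, R1) (L, R2)" "at_node (node x s) 0 R2" using push[OF R1(2) x(1)] by blast
    have "ar True s (L, R) (L, R2)" using R1(1) R2(1) arun_trans[of p z L hi U True s "(L, R)" "(L, R1)" True "(L, R2)"] by auto
    then show ?thesis using R2(2) x(2) node_gt[of s x] s(2) w by (intro exI[of _ "(node x s, R2)"]) auto
  qed
  have "\<exists>Q. \<forall>n. (?bad (Q n) \<and> (n = 0 \<longrightarrow> Q n = (s, R))) \<and>
      (fst (Q n) < fst (Q (Suc n)) \<and> ar True (fst (Q n)) (L, snd (Q n)) (L, snd (Q (Suc n))))"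
  proof (rule dependent_nat_choice)
    show "\<exists>w. ?bad w \<and> (0 = (0::nat) \<longrightarrow> w = (s, R))" using assms by (intro exI[of _ "(s, R)"]) simp
  next
    fix w and n :: nat assume "?bad w \<and> (n = 0 \<longrightarrow> w = (s, R))"
    then show "\<exists>y. (?bad y \<and> (Suc n = 0 \<longrightarrow> y = (s, R))) \<and>
      (fst w < fst y \<and> ar True (fst w) (L, snd w) (L, snd y))"
      using step[of w] by auto
  qed
  then obtain Q where Q': "\<forall>n. (?bad (Q n) \<and> (n = 0 \<longrightarrow> Q n = (s, R))) \<and>
      (fst (Q n) < fst (Q (Suc n)) \<and> ar True (fst (Q n)) (L, snd (Q n)) (L, snd (Q (Suc n))))" ..
  have Q: "?bad (Q n)" "fst (Q n) < fst (Q (Suc n))" "ar True (fst (Q n)) (L, snd (Q n)) (L, snd (Q (Suc n)))" for n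
    using conjunct1[OF conjunct1[OF spec[OF Q', of n]]] conjunct2[OF spec[OF Q', of n]] by simp_all
  have Q0: "Q 0 = (s, R)" using spec[OF Q', of 0] by simp
  have m: "strict_mono (\<lambda>n. fst (Q n))" using Q(2) by (simp add: strict_mono_Suc_iff)
  have an: "at_node (fst (Q n)) 0 (snd (Q n))" for n using Q(1)[of n] by (simp add: case_prod_beta)
  obtain R' where "ar True (fst (Q 0)) (L, snd (Q 0)) (L, R')" "at_limit 0 R'"
  proof (rule omega_limit[of "\<lambda>n. fst (Q n)" "\<lambda>n. snd (Q n)"])
    show "fst (Q 0) \<le> fst (Q n)" for n using strict_mono_less_eq[OF m, of 0 n] by simp
    show "snd (Q n) 1 = fst (Q n)" for n using an by (simp add: at_node_def)
    show "snd (Q 0) 5 = 0" "snd (Q 0) 6 = 1" using an[of 0] by (auto simp: at_node_def)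
  qed (use Q(3) m in blast)+
  then show ?thesis using Q0 by auto
qed

end

definition tree_child :: "(nat \<Rightarrow> nat \<Rightarrow> bool) \<Rightarrow> nat \<Rightarrow> nat \<Rightarrow> bool" where
  "tree_child E t s \<longleftrightarrow> (\<exists>x. t = node x s \<and> E x s)"

text \<open>Registers: 0 output (untouched), 1 current node, 2 next child to try, 3 limit flag,
  4 result of the edge test, 5 constant 0, 6 constant 1, 7 auxiliary. The flag is reset to 0 and back
  to 1 in every round, so it reads 0 at the top of the loop exactly after a limit. There the node
  register holds the node whose children have been exhausted, or 0 if the search descended
  infinitely often.\<close>

definition search_code :: "instr list \<Rightarrow> instr list \<Rightarrow> instr list \<Rightarrow> instr list \<Rightarrow> instr list" where
  "search_code fe fc fl fp = (let k1 = length fe; k2 = k1 + length fc; k3 = k2 + length fl; k4 = k3 + length fp in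
    [Zero 5, Zero 6, Inc 6, Zero 1, Inc 1, Zero 2, Copy 6 3,
     Jeq 3 5 (k2 + 16), Copy 5 3, Copy 6 3] @ map (reloc 10) fe @
    [Jeq 4 5 (k2 + 14)] @ map (reloc (k1 + 11)) fc @
    [Copy 7 1, Zero 2, Jeq 0 0 7, Inc 2, Jeq 0 0 7, Jeq 1 5 (k4 + 22), Jeq 1 6 (k4 + 22)] @
    map (reloc (k2 + 18)) fl @ [Inc 2] @ map (reloc (k3 + 19)) fp @
    [Copy 7 1, Copy 6 3, Jeq 0 0 7])"

text \<open>The verdict is left in register 1 and register 5 is 0, so \<open>Jeq 1 5\<close>
  branches on it. Register 0 is never touched, which reserves it for the output of the program
  around the test.\<close>

definition tests :: "instr list \<Rightarrow> nat \<Rightarrow> nat set set \<Rightarrow> (nat set \<Rightarrow> bool) \<Rightarrow> bool" where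
  "tests fr N D Q \<longleftrightarrow> 8 \<le> N \<and> (\<forall>p b z R. z \<in> D \<longrightarrow> cat p b 0 fr \<longrightarrow>
    (\<exists>R'. brun p z b (b + length fr) (insert 0 {N..}) (b, R) (b + length fr, R') \<and>
       R' 5 = 0 \<and> R' 1 = (if Q z then 1 else 0)))"

text \<open>The edge test, the node code and its two inverses are compiled from recursive functions;
  the rest is control. The loop is left with register 1 equal to 1 when the root is exhausted and 0
  after an infinite descent, so the root code 1 makes the node register itself the verdict.\<close>

lemma well_foundedness_test:
  assumes E: "udec D 2 (\<lambda>z xs. E z (xs ! 0) (xs ! 1))"
  shows "\<exists>fr N. tests fr N D (\<lambda>z. Wellfounded.accp (tree_child (E z)) 1)"
proof -
  obtain e where e': "\<forall>z\<in>D. \<forall>xs. length xs = 2 \<longrightarrow> reval z e xs (if E z (xs ! 0) (xs ! 1) then 1 else 0)"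
    using E unfolding udec_def ucomp_def ..
  have e: "reval z e [x, s] (if E z x s then 1 else 0)" if "z \<in> D" for z x s
    using e'[rule_format, OF that, of "[x, s]"] by simp
  have "ucomp UNIV 2 (\<lambda>z xs. node (xs ! 0) (xs ! 1))"
    unfolding node_def by (intro ucomp_intros) auto
  then obtain c where c': "\<forall>z\<in>UNIV. \<forall>xs. length xs = 2 \<longrightarrow> reval z c xs (node (xs ! 0) (xs ! 1))"
    unfolding ucomp_def ..
  have c: "reval z c [x, s] (node x s)" for z x s using c'[rule_format, OF UNIV_I, of "[x, s]"] by simp
  have "ucomp UNIV 1 (\<lambda>z xs. fst (prod_decode (xs ! 0 - 1)))" by (intro ucomp_intros) simp
  then obtain l where l': "\<forall>z\<in>UNIV. \<forall>xs. length xs = 1 \<longrightarrow> reval z l xs (fst (prod_decode (xs ! 0 - 1)))"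
    unfolding ucomp_def ..
  have l: "reval z l [s] (fst (prod_decode (s - 1)))" for z s using l'[rule_format, OF UNIV_I, of "[s]"] by simp
  have "ucomp UNIV 1 (\<lambda>z xs. snd (prod_decode (xs ! 0 - 1)))" by (intro ucomp_intros) simp
  then obtain q where q': "\<forall>z\<in>UNIV. \<forall>xs. length xs = 1 \<longrightarrow> reval z q xs (snd (prod_decode (xs ! 0 - 1)))"
    unfolding ucomp_def ..
  have q: "reval z q [s] (snd (prod_decode (s - 1)))" for z s using q'[rule_format, OF UNIV_I, of "[s]"] by simp
  obtain fe N1 where fe: "computes fe N1 e [2, 1] 4 8" using compile[of "[2, 1]" 8 4 e] by auto
  obtain fc N2 where fc: "computes fc N2 c [2, 1] 7 8" using compile[of "[2, 1]" 8 7 c] by auto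
  obtain fl N3 where fl: "computes fl N3 l [1] 2 8" using compile[of "[1]" 8 2 l] by auto
  obtain fp N4 where fp: "computes fp N4 q [1] 7 8" using compile[of "[1]" 8 7 q] by auto
  define N where "N = Max {N1, N2, N3, N4}"
  have N: "N1 \<le> N" "N2 \<le> N" "N3 \<le> N" "N4 \<le> N" unfolding N_def by simp_all
  have N8: "8 \<le> N" using fe N(1) unfolding computes_def by simp
  define fr where "fr = search_code fe fc fl fp"
  define k1 where "k1 = length fe"
  define k2 where "k2 = k1 + length fc"
  define k3 where "k3 = k2 + length fl"
  define k4 where "k4 = k3 + length fp"
  have len: "length fr = k4 + 22"
    by (simp add: fr_def search_code_def Let_def k1_def k2_def k3_def k4_def)
  have "\<exists>R'. brun p z b (b + length fr) (insert 0 {N..}) (b, R) (b + length fr, R') \<and>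
       R' 5 = 0 \<and> R' 1 = (if Wellfounded.accp (tree_child (E z)) 1 then 1 else 0)"
    if z: "z \<in> D" and cat: "cat p b 0 fr" for p b z R
  proof -
    have cats: "cat p b 0 [Zero 5, Zero 6, Inc 6, Zero 1, Inc 1, Zero 2, Copy 6 3, Jeq 3 5 (k2 + 16), Copy 5 3, Copy 6 3]"
      "cat p b 10 (map (reloc 10) fe)" "cat p b (k1 + 10) [Jeq 4 5 (k2 + 14)]"
      "cat p b (k1 + 11) (map (reloc (k1 + 11)) fc)"
      "cat p b (k2 + 11) [Copy 7 1, Zero 2, Jeq 0 0 7, Inc 2, Jeq 0 0 7, Jeq 1 5 (k4 + 22), Jeq 1 6 (k4 + 22)]"
      "cat p b (k2 + 18) (map (reloc (k2 + 18)) fl)" "cat p b (k3 + 18) [Inc 2]"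
      "cat p b (k3 + 19) (map (reloc (k3 + 19)) fp)" "cat p b (k4 + 19) [Copy 7 1, Copy 6 3, Jeq 0 0 7]"
      using cat unfolding fr_def search_code_def Let_def k1_def[symmetric] k2_def[symmetric] k3_def[symmetric] k4_def[symmetric]
      unfolding cat_append length_append length_map k1_def[symmetric]
      by (simp_all del: cat_reloc cat_Cons add: k2_def k3_def k4_def add_ac eval_nat_numeral)
    note fcats = cats(2,4,6,8)[folded cat_shift]
    have i: "b + (k4 + 22) \<le> length p" "p ! b = Zero 5" "p ! (b + 1) = Zero 6" "p ! (b + 2) = Inc 6" "p ! (b + 3) = Zero 1"
      "p ! (b + 4) = Inc 1" "p ! (b + 5) = Zero 2" "p ! (b + 6) = Copy 6 3"
      "p ! (b + 7) = Jeq 3 5 (b + (k2 + 16))" "p ! (b + 8) = Copy 5 3" "p ! (b + 9) = Copy 6 3"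
      using cats(1,9) by (simp_all add: eval_nat_numeral)
    have j: "p ! (b + (k1 + 10)) = Jeq 4 5 (b + (k2 + 14))"
      "p ! (b + (k2 + 11)) = Copy 7 1" "p ! (b + (k2 + 12)) = Zero 2" "p ! (b + (k2 + 13)) = Jeq 0 0 (b + 7)"
      "p ! (b + (k2 + 14)) = Inc 2" "p ! (b + (k2 + 15)) = Jeq 0 0 (b + 7)"
      "p ! (b + (k2 + 16)) = Jeq 1 5 (b + (k4 + 22))" "p ! (b + (k2 + 17)) = Jeq 1 6 (b + (k4 + 22))"
      "p ! (b + (k3 + 18)) = Inc 2" "p ! (b + (k4 + 19)) = Copy 7 1" "p ! (b + (k4 + 20)) = Copy 6 3"
      "p ! (b + (k4 + 21)) = Jeq 0 0 (b + 7)"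
      using cats(3,5,7,9) by (simp_all add: eval_nat_numeral)
    have k: "k1 \<le> k2" "k2 \<le> k3" "k3 \<le> k4" unfolding k2_def k3_def k4_def by auto
    let ?L = "b + 7" and ?hi = "b + (k4 + 22)"
    let ?U = "{0, 5, 6} \<union> {N..}"
    interpret dfs p z ?L ?hi ?U "E z" by unfold_locales auto
    have UN: "1 \<notin> ?U" "2 \<notin> ?U" "3 \<notin> ?U" "4 \<notin> ?U" "7 \<notin> ?U" using N8 by auto
    have keep: "insert 1 ?U \<subseteq> keep 4 8 N1" "insert 1 ?U \<subseteq> keep 7 8 N2" "insert 1 ?U \<subseteq> keep 2 8 N3" "insert 1 ?U \<subseteq> keep 7 8 N4"
      using N by (auto simp: keep_def)
    have test: "\<exists>R'. ar True s (?L, R) (b + (k1 + 10), R') \<and> R' 4 = (if E z x s then 1 else 0) \<and> at_node s x R'"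
      if R: "at_node s x R" for s x R
    proof -
      have R': "R 1 = s" "R 2 = x" "R 3 = 1" "R 5 = 0" "R 6 = 1" using R by (auto simp: at_node_def)
      have s1: "ar False s (?L, R) (b + 8, R)"
        by (rule arun_step) (use i k R' in auto)
      have s2: "ar False s (b + 8, R) (b + 9, R(3 := 0))"
        by (rule arun_step) (use i k R' UN in auto)
      have s3: "ar True s (b + 9, R(3 := 0)) (b + 10, R(3 := 1))"
        by (rule arun_step) (use i k R' UN in auto)
      have args: "map (R(3 := 1)) [2, 1] = [x, s]" using R' by simp
      obtain R4 where R4: "brun p z ?L ?hi (insert 1 ?U) (b + 10, R(3 := 1)) (b + (k1 + 10), R4)" "R4 4 = (if E z x s then 1 else 0)"
        "\<And>r. r \<in> keep 4 8 N1 \<Longrightarrow> R4 r = (R(3 := 1)) r"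
        by (rule computesD'[OF fe fcats(1) e[OF z] args, where lo = ?L and hi = ?hi and U = "insert 1 ?U" and pc' = "b + (k1 + 10)"])
          (use k keep in \<open>auto simp: k1_def\<close>)
      have s4: "ar False s (b + 10, R(3 := 1)) (b + (k1 + 10), R4)"
        by (rule arun_brun[OF R4(1)]) (use R' in simp)
      have "at_node s x R4" using R4(3) R' by (auto simp: at_node_def keep_def)
      moreover have "ar True s (?L, R) (b + (k1 + 10), R4)"
        using arun_trans[OF arun_trans[OF arun_trans[OF s1 s2] s3] s4] by simp
      ultimately show ?thesis using R4(2) by blast
    qed
    interpret dfs_steps p z ?L ?hi ?U "E z"
    proof
      fix s x R assume R: "at_node s x R" and Ex: "E z x s"
      obtain R1 where R1: "ar True s (?L, R) (b + (k1 + 10), R1)" "R1 4 = 1" "at_node s x R1"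
        using test[OF R] Ex by auto
      have R1': "R1 1 = s" "R1 2 = x" "R1 3 = 1" "R1 5 = 0" "R1 6 = 1" using R1(3) by (auto simp: at_node_def)
      have s1: "ar False s (b + (k1 + 10), R1) (b + (k1 + 11), R1)"
        by (rule arun_step) (use i j k R1' R1(2) in auto)
      have args: "map R1 [2, 1] = [x, s]" using R1' by simp
      obtain R2 where R2: "brun p z ?L ?hi (insert 1 ?U) (b + (k1 + 11), R1) (b + (k2 + 11), R2)" "R2 7 = node x s"
        "\<And>r. r \<in> keep 7 8 N2 \<Longrightarrow> R2 r = R1 r"
        by (rule computesD'[OF fc fcats(2) c args, where lo = ?L and hi = ?hi and U = "insert 1 ?U" and pc' = "b + (k2 + 11)"])
          (use k keep in \<open>auto simp: k2_def\<close>)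
      have s2: "ar False s (b + (k1 + 11), R1) (b + (k2 + 11), R2)"
        by (rule arun_brun[OF R2(1)]) (use R1' in simp)
      have R2': "R2 1 = s" "R2 3 = 1" "R2 5 = 0" "R2 6 = 1" using R2(3) R1' by (auto simp: keep_def)
      have s3: "ar False s (b + (k2 + 11), R2) (b + (k2 + 12), R2(1 := node x s))"
        by (rule arun_step) (use i j k R2' R2(2) UN in auto)
      have s4: "ar False s (b + (k2 + 12), R2(1 := node x s)) (b + (k2 + 13), R2(1 := node x s, 2 := 0))"
        by (rule arun_step) (use i j k UN node_gt[of s x] in auto)
      have s5: "ar False s (b + (k2 + 13), R2(1 := node x s, 2 := 0)) (?L, R2(1 := node x s, 2 := 0))"
        by (rule arun_step) (use i j k UN node_gt[of s x] in auto)
      have "ar True s (?L, R) (?L, R2(1 := node x s, 2 := 0))"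
        using arun_trans[OF arun_trans[OF arun_trans[OF arun_trans[OF arun_trans[OF R1(1) s1] s2] s3] s4] s5] by simp
      moreover have "at_node (node x s) 0 (R2(1 := node x s, 2 := 0))" using R2' by (auto simp: at_node_def)
      ultimately show "\<exists>R'. ar True s (?L, R) (?L, R') \<and> at_node (node x s) 0 R'" by blast
    next
      fix s x R assume R: "at_node s x R" and Ex: "\<not> E z x s"
      obtain R1 where R1: "ar True s (?L, R) (b + (k1 + 10), R1)" "R1 4 = 0" "at_node s x R1"
        using test[OF R] Ex by auto
      have R1': "R1 1 = s" "R1 2 = x" "R1 3 = 1" "R1 5 = 0" "R1 6 = 1" using R1(3) by (auto simp: at_node_def)
      have s1: "ar False s (b + (k1 + 10), R1) (b + (k2 + 14), R1)"
        by (rule arun_step) (use i j k R1' R1(2) in auto)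
      have s2: "ar False s (b + (k2 + 14), R1) (b + (k2 + 15), R1(2 := Suc x))"
        by (rule arun_step) (use i j k R1' UN in auto)
      have s3: "ar False s (b + (k2 + 15), R1(2 := Suc x)) (?L, R1(2 := Suc x))"
        by (rule arun_step) (use i j k R1' UN in auto)
      have "ar True s (?L, R) (?L, R1(2 := Suc x))"
        using arun_trans[OF arun_trans[OF arun_trans[OF R1(1) s1] s2] s3] by simp
      moreover have "at_node s (Suc x) (R1(2 := Suc x))" using R1' by (auto simp: at_node_def)
      ultimately show "\<exists>R'. ar True s (?L, R) (?L, R') \<and> at_node s (Suc x) R'" by blast
    next
      fix s x R assume R: "at_limit (node x s) R" and s: "1 \<le> s"
      have R': "R 1 = node x s" "R 3 = 0" "R 5 = 0" "R 6 = 1" using R by (auto simp: at_limit_def)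
      have gt: "s < node x s" "node x s \<noteq> 0" "node x s \<noteq> 1" using node_gt[of s x] s by auto
      have s1: "ar False s (?L, R) (b + (k2 + 16), R)"
        by (rule arun_step) (use i k R' gt in auto)
      have s2: "ar False s (b + (k2 + 16), R) (b + (k2 + 17), R)"
        by (rule arun_step) (use i j k R' gt in auto)
      have s3: "ar False s (b + (k2 + 17), R) (b + (k2 + 18), R)"
        by (rule arun_step) (use i j k R' gt in auto)
      have args: "map R [1] = [node x s]" using R' by simp
      obtain R2 where R2: "brun p z ?L ?hi (insert 1 ?U) (b + (k2 + 18), R) (b + (k3 + 18), R2)"
        "R2 2 = fst (prod_decode (node x s - 1))" "\<And>r. r \<in> keep 2 8 N3 \<Longrightarrow> R2 r = R r"
        by (rule computesD'[OF fl fcats(3) l args, where lo = ?L and hi = ?hi and U = "insert 1 ?U" and pc' = "b + (k3 + 18)"])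
          (use k keep in \<open>auto simp: k3_def\<close>)
      have s4: "ar False s (b + (k2 + 18), R) (b + (k3 + 18), R2)"
        by (rule arun_brun[OF R2(1)]) (use R' gt in simp)
      have R2': "R2 1 = node x s" "R2 2 = x" "R2 5 = 0" "R2 6 = 1" using R2(2,3) R' by (auto simp: keep_def node_def)
      let ?R3 = "R2(2 := Suc x)"
      have s5: "ar False s (b + (k3 + 18), R2) (b + (k3 + 19), ?R3)"
        by (rule arun_step) (use i j k R2' UN gt in auto)
      have args: "map ?R3 [1] = [node x s]" using R2' by simp
      obtain R4 where R4: "brun p z ?L ?hi (insert 1 ?U) (b + (k3 + 19), ?R3) (b + (k4 + 19), R4)"
        "R4 7 = snd (prod_decode (node x s - 1))" "\<And>r. r \<in> keep 7 8 N4 \<Longrightarrow> R4 r = ?R3 r"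
        by (rule computesD'[OF fp fcats(4) q args, where lo = ?L and hi = ?hi and U = "insert 1 ?U" and pc' = "b + (k4 + 19)"])
          (use k keep in \<open>auto simp: k4_def\<close>)
      have s6: "ar False s (b + (k3 + 19), ?R3) (b + (k4 + 19), R4)"
        by (rule arun_brun[OF R4(1)]) (use R2' gt in simp)
      have R4': "R4 1 = node x s" "R4 2 = Suc x" "R4 5 = 0" "R4 6 = 1" "R4 7 = s"
        using R4(2,3) R2' by (auto simp: keep_def node_def)
      have s7: "ar False s (b + (k4 + 19), R4) (b + (k4 + 20), R4(1 := s))"
        by (rule arun_step) (use i j k R4' UN gt in auto)
      have s8: "ar False s (b + (k4 + 20), R4(1 := s)) (b + (k4 + 21), R4(1 := s, 3 := 1))"
        by (rule arun_step) (use i j k R4' UN gt in auto)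
      have s9: "ar False s (b + (k4 + 21), R4(1 := s, 3 := 1)) (?L, R4(1 := s, 3 := 1))"
        by (rule arun_step) (use i j k R4' UN gt in auto)
      have "ar False s (?L, R) (b + (k3 + 19), ?R3)"
        using arun_trans[OF arun_trans[OF arun_trans[OF arun_trans[OF s1 s2] s3] s4] s5] by simp
      moreover have "ar False s (b + (k3 + 19), ?R3) (?L, R4(1 := s, 3 := 1))"
        using arun_trans[OF arun_trans[OF arun_trans[OF s6 s7] s8] s9] by simp
      ultimately have "ar False s (?L, R) (?L, R4(1 := s, 3 := 1))"
        using arun_trans by fastforce
      moreover have "at_node s (Suc x) (R4(1 := s, 3 := 1))" using R4' by (auto simp: at_node_def)
      ultimately show "\<exists>R'. ar False s (?L, R) (?L, R') \<and> at_node s (Suc x) R'" by blast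
    qed
    let ?V = "insert 0 {N..}"
    let ?br = "brun p z b (b + length fr) ?V"
    have VN: "1 \<notin> ?V" "2 \<notin> ?V" "3 \<notin> ?V" "5 \<notin> ?V" "6 \<notin> ?V" using N8 by auto
    let ?R1 = "R(5 := 0, 6 := 0)" and ?R2 = "R(5 := 0, 6 := 1)" and ?R3 = "R(5 := 0, 6 := 1, 1 := 0)"
      and ?R4 = "R(5 := 0, 6 := 1, 1 := 1)" and ?R5 = "R(5 := 0, 6 := 1, 1 := 1, 2 := 0)"
      and ?R6 = "R(5 := 0, 6 := 1, 1 := 1, 2 := 0, 3 := 1)"
    have "?br (b, R) (b + 1, R(5 := 0))" by (rule brun_step) (use i VN len in auto)
    moreover have "?br (b + 1, R(5 := 0)) (b + 2, ?R1)" by (rule brun_step) (use i VN len in auto)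
    moreover have "?br (b + 2, ?R1) (b + 3, ?R2)" by (rule brun_step) (use i VN len in auto)
    moreover have "?br (b + 3, ?R2) (b + 4, ?R3)" by (rule brun_step) (use i VN len in auto)
    moreover have "?br (b + 4, ?R3) (b + 5, ?R4)" by (rule brun_step) (use i VN len in auto)
    moreover have "?br (b + 5, ?R4) (b + 6, ?R5)" by (rule brun_step) (use i VN len in auto)
    moreover have "?br (b + 6, ?R5) (?L, ?R6)" by (rule brun_step) (use i VN len in auto)
    ultimately have start: "?br (b, R) (?L, ?R6)" by (meson brun_trans)
    have node1: "at_node 1 0 ?R6" by (simp add: at_node_def)
    have ch: "child = tree_child (E z)" by (intro ext) (simp add: child_def tree_child_def)
    let ?v = "if Wellfounded.accp (tree_child (E z)) 1 then 1 else 0"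
    obtain R7 where R7: "ar True 1 (?L, ?R6) (?L, R7)" "at_limit ?v R7"
      using explore_wf[OF _ _ node1] explore_not_wf[OF _ _ node1] unfolding ch by (cases "Wellfounded.accp (tree_child (E z)) 1") auto
    have R7': "R7 1 = ?v" "R7 3 = 0" "R7 5 = 0" "R7 6 = 1" using R7(2) by (auto simp: at_limit_def)
    have "brun p z ?L ?hi ?U (?L, ?R6) (?L, R7)" using R7(1) by (rule brun_arun)
    then have mid: "?br (?L, ?R6) (?L, R7)" by (rule brun_mono) (auto simp: len)
    have t1: "?br (?L, R7) (b + (k2 + 16), R7)" by (rule brun_step) (use i k R7' len in auto)
    have "?br (b + (k2 + 16), R7) (b + length fr, R7)"
    proof (cases "R7 1 = 0")
      case True
      show ?thesis by (rule brun_step) (use i j k R7' True len in auto)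
    next
      case False
      have "?br (b + (k2 + 16), R7) (b + (k2 + 17), R7)" by (rule brun_step) (use i j k R7' False len in auto)
      moreover have "?br (b + (k2 + 17), R7) (b + length fr, R7)"
        by (rule brun_step) (use i j k R7' False len in \<open>auto split: if_splits\<close>)
      ultimately show ?thesis by (rule brun_trans)
    qed
    then have "?br (b, R) (b + length fr, R7)" using start mid t1 by (meson brun_trans)
    then show ?thesis using R7' by blast
  qed
  then have "tests fr N D (\<lambda>z. Wellfounded.accp (tree_child (E z)) 1)"
    unfolding tests_def using N8 by simp
  then show ?thesis by blast
qed

section \<open>Universal-existential conditions as well-foundedness\<close>

text \<open>The label of a node \<open>s\<close> other than the root is the last number pushed,
  \<open>fst (prod_decode (s - 1))\<close>. Labels (0, a) spell descending chains of
  \<open>S\<close>. A label (k + 1, n) has the child (k + 2, n) exactly if \<open>Q n k\<close>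
  fails, so the branch starting with (1, n) is finite iff some \<open>Q n m\<close> holds. One tree
  thus expresses both conditions.\<close>

definition cond_tree :: "(nat \<Rightarrow> nat \<Rightarrow> bool) \<Rightarrow> (nat \<Rightarrow> nat \<Rightarrow> bool) \<Rightarrow> nat \<Rightarrow> nat \<Rightarrow> bool" where
  "cond_tree S Q x s \<longleftrightarrow>
    (s = 1 \<and> fst (prod_decode x) \<le> 1) \<or>
    (s \<noteq> 1 \<and> fst (prod_decode (fst (prod_decode (s - 1)))) = 0 \<and> fst (prod_decode x) = 0 \<and>
      S (snd (prod_decode x)) (snd (prod_decode (fst (prod_decode (s - 1)))))) \<or>
    (s \<noteq> 1 \<and> 0 < fst (prod_decode (fst (prod_decode (s - 1)))) \<and>
      fst (prod_decode x) = Suc (fst (prod_decode (fst (prod_decode (s - 1))))) \<and>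
      snd (prod_decode x) = snd (prod_decode (fst (prod_decode (s - 1)))) \<and>
      \<not> Q (snd (prod_decode x)) (fst (prod_decode (fst (prod_decode (s - 1)))) - 1))"

lemma accp_cond_tree:
  "Wellfounded.accp (tree_child (cond_tree S Q)) 1 \<longleftrightarrow> wf {(a, b). S a b} \<and> (\<forall>n. \<exists>m. Q n m)"
proof -
  let ?T = "tree_child (cond_tree S Q)"
  let ?h = "\<lambda>s. fst (prod_decode (s - 1))"
  have hn: "?h (node x s) = x" for x s by (simp add: node_def)
  have wf1: "a \<in> Wellfounded.acc {(a, b). S a b}" if "Wellfounded.accp ?T s" "s > 1" "?h s = prod_encode (0, a)" for a s
    using that
  proof (induction arbitrary: a rule: accp.induct)
    case (accI s)
    show ?case
    proof (rule Wellfounded.accI)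
      fix b assume "(b, a) \<in> {(a, b). S a b}"
      then have "?T (node (prod_encode (0, b)) s) s"
        using accI.prems unfolding tree_child_def cond_tree_def by (intro exI[of _ "prod_encode (0, b)"]) auto
      then show "b \<in> Wellfounded.acc {(a, b). S a b}"
        using accI.IH[of "node (prod_encode (0, b)) s" b] accI.prems hn node_gt[of s "prod_encode (0, b)"] by auto
    qed
  qed
  \<comment> \<open>An accessible branch must stop, and it stops only at some \<open>k\<close> with
    \<open>Q n k\<close>.\<close>
  have ex1: "\<exists>m. Q n m" if "Wellfounded.accp ?T s" "s > 1" "?h s = prod_encode (Suc k, n)" for n k s
    using that
  proof (induction arbitrary: k rule: accp.induct)
    case (accI s)
    show ?case
    proof (cases "Q n k")
      case False
      then have "?T (node (prod_encode (Suc (Suc k), n)) s) s"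
        using accI.prems unfolding tree_child_def cond_tree_def
        by (intro exI[of _ "prod_encode (Suc (Suc k), n)"]) auto
      then show ?thesis
        using accI.IH[of "node (prod_encode (Suc (Suc k), n)) s" "Suc k"] accI.prems hn
          node_gt[of s "prod_encode (Suc (Suc k), n)"] by auto
    qed blast
  qed
  have root: "?T (node x 1) 1 \<longleftrightarrow> fst (prod_decode x) \<le> 1" for x
    unfolding tree_child_def cond_tree_def by (auto simp: node_def)
  have fwd: "wf {(a, b). S a b} \<and> (\<forall>n. \<exists>m. Q n m)" if acc: "Wellfounded.accp ?T 1"
  proof
    have "Wellfounded.accp ?T (node x 1)" if "fst (prod_decode x) \<le> 1" for x
      using acc that root accp_downward by metis
    then have *: "Wellfounded.accp ?T (node (prod_encode (0, a)) 1)"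
      "Wellfounded.accp ?T (node (prod_encode (Suc 0, a)) 1)" for a by simp_all
    show "wf {(a, b). S a b}"
      by (rule acc_wfI) (use wf1[OF *(1)] hn node_gt[of 1] in auto)
    show "\<forall>n. \<exists>m. Q n m" using ex1[OF *(2)] hn node_gt[of 1] by blast
  qed
  have wf2: "Wellfounded.accp ?T s" if w: "wf {(a, b). S a b}" and s: "s > 1" "?h s = prod_encode (0, a)" for a s
    using s
  proof (induction a arbitrary: s rule: wf_induct_rule[OF w])
    case (1 a)
    show ?case
    proof (rule accp.accI)
      fix t assume "?T t s"
      then obtain x where x: "t = node x s" "cond_tree S Q x s" unfolding tree_child_def by blast
      then have "fst (prod_decode x) = 0" "S (snd (prod_decode x)) a" using 1(2,3) unfolding cond_tree_def by auto
      moreover from this have "x = prod_encode (0, snd (prod_decode x))" by (metis prod.collapse prod_decode_inverse)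
      ultimately show "Wellfounded.accp ?T t"
        using 1(1)[of "snd (prod_decode x)" t] x(1) hn[of x s] node_gt[of s x] 1(2) by auto
    qed
  qed
  \<comment> \<open>Here \<open>d\<close> is the distance from the current position to the known
    witness \<open>k + d\<close>.\<close>
  have ex2: "Wellfounded.accp ?T s" if "Q n (k + d)" "s > 1" "?h s = prod_encode (Suc k, n)" for n k d s
    using that
  proof (induction d arbitrary: s k)
    case 0
    show ?case
    proof (rule accp.accI)
      fix t assume "?T t s"
      then obtain x where x: "t = node x s" "cond_tree S Q x s" unfolding tree_child_def by blast
      then show "Wellfounded.accp ?T t" using 0 unfolding cond_tree_def by auto
    qed
  next
    case (Suc d)
    show ?case
    proof (rule accp.accI)
      fix t assume "?T t s"
      then obtain x where x: "t = node x s" "cond_tree S Q x s" unfolding tree_child_def by blast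
      then have "fst (prod_decode x) = Suc (Suc k)" "snd (prod_decode x) = n" using Suc.prems unfolding cond_tree_def by auto
      then have "x = prod_encode (Suc (Suc k), n)" by (metis prod.collapse prod_decode_inverse)
      then show "Wellfounded.accp ?T t"
        using Suc.IH[of "Suc k" t] Suc.prems x(1) hn[of x s] node_gt[of s x] by auto
    qed
  qed
  have bwd: "Wellfounded.accp ?T 1" if w: "wf {(a, b). S a b}" and e: "\<forall>n. \<exists>m. Q n m"
  proof (rule accp.accI)
    fix t assume t: "?T t 1"
    then obtain x where x: "t = node x 1" unfolding tree_child_def by blast
    obtain i a where ia: "x = prod_encode (i, a)" by (metis prod_decode_inverse surj_pair)
    have "i = 0 \<or> i = 1" using t root[of x] x ia by auto
    moreover have "t > 1" "?h t = x" using x hn node_gt[of 1 x] by auto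
    moreover obtain m where "Q a m" using e by blast
    ultimately show "Wellfounded.accp ?T t"
      using wf2[OF w, of t a] ex2[of a 0 m t] ia by auto
  qed
  show ?thesis using fwd bwd by blast
qed

lemma udec_compose2:
  assumes "udec D 2 (\<lambda>z xs. Q z (xs ! 0) (xs ! 1))" "ucomp D n F" "ucomp D n G"
  shows "udec D n (\<lambda>z xs. Q z (F z xs) (G z xs))"
  using ucomp_compose2[OF assms(1)[unfolded udec_def numeral_2_eq_2] assms(2,3)] by (simp add: udec_def)

lemma condition_test:
  assumes S: "udec D 2 (\<lambda>z xs. S z (xs ! 0) (xs ! 1))" and Q: "udec D 2 (\<lambda>z xs. Q z (xs ! 0) (xs ! 1))"
  shows "\<exists>fr N. tests fr N D (\<lambda>z. wf {(a, b). S z a b} \<and> (\<forall>n. \<exists>m. Q z n m))"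
proof -
  have "udec D 2 (\<lambda>z xs. cond_tree (S z) (Q z) (xs ! 0) (xs ! 1))"
    unfolding cond_tree_def
    by (intro ucomp_intros udec_compose2[OF S] udec_compose2[OF Q]) simp_all
  from well_foundedness_test[OF this] show ?thesis unfolding accp_cond_tree .
qed

section \<open>Certificates for the iterated jumps\<close>

text \<open>A certificate is a function \<open>g\<close> coding a well-order of the natural numbers together with, for
  all \<open>j\<close> and \<open>k\<close>, the configurations of \<open>P k\<close> with oracle \<open>itrm_jump_iter j\<close> along it
  (\<open>cert_val g a e\<close> is entry \<open>r\<close> at node \<open>a\<close>, for \<open>e\<close> coding \<open>((j, k), r)\<close>), and Skolem functions for
  the arithmetical conditions. \<open>cert_kind g a\<close> is 0 at the least node, 1 at limit nodes and \<open>b + 2\<close>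
  at the successor of \<open>b\<close>. Between the nodes 0 and 1 all computations loop simultaneously.\<close>

definition cert_le :: "(nat \<Rightarrow> nat) \<Rightarrow> nat \<Rightarrow> nat \<Rightarrow> bool" where
  "cert_le g a b \<longleftrightarrow> g (prod_encode (0, prod_encode (a, b))) = 1"

definition cert_lt :: "(nat \<Rightarrow> nat) \<Rightarrow> nat \<Rightarrow> nat \<Rightarrow> bool" where
  "cert_lt g a b \<longleftrightarrow> cert_le g a b \<and> a \<noteq> b"

definition cert_kind :: "(nat \<Rightarrow> nat) \<Rightarrow> nat \<Rightarrow> nat" where
  "cert_kind g a = g (prod_encode (1, a))"

definition cert_val :: "(nat \<Rightarrow> nat) \<Rightarrow> nat \<Rightarrow> nat \<Rightarrow> nat" where
  "cert_val g a e = g (prod_encode (2, prod_encode (a, e)))"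

definition cert_between :: "(nat \<Rightarrow> nat) \<Rightarrow> nat \<Rightarrow> nat \<Rightarrow> nat" where
  "cert_between g a b = g (prod_encode (3, prod_encode (a, b)))"

definition cert_bound :: "(nat \<Rightarrow> nat) \<Rightarrow> nat \<Rightarrow> nat \<Rightarrow> nat \<Rightarrow> nat" where
  "cert_bound g a e v = g (prod_encode (4, prod_encode (a, prod_encode (e, v))))"

definition cert_cofinal :: "(nat \<Rightarrow> nat) \<Rightarrow> nat \<Rightarrow> nat \<Rightarrow> nat \<Rightarrow> nat" where
  "cert_cofinal g a e b = g (prod_encode (5, prod_encode (a, prod_encode (e, b))))"

definition cert_overflow :: "(nat \<Rightarrow> nat) \<Rightarrow> nat \<Rightarrow> nat \<Rightarrow> bool" where
  "cert_overflow g a e \<longleftrightarrow> g (prod_encode (6, prod_encode (a, e))) = 1"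

text \<open>Level 0 is the empty set; \<open>k\<close> belongs to level \<open>j\<close> if the
  recorded run of \<open>P k\<close> at level \<open>j - 1\<close> is halted at node 0, the start of
  the loop. The true jump does not enter, so this is computable from \<open>g\<close>.\<close>

definition cert_oracle :: "(nat \<Rightarrow> nat) \<Rightarrow> nat \<Rightarrow> nat \<Rightarrow> bool" where
  "cert_oracle g j k \<longleftrightarrow> 0 < j \<and> code_drop k (cert_val g 0 (prod_encode (prod_encode (j - 1, k), 0))) = 0"

text \<open>Entry \<open>r\<close> of the successor configuration, by cases on the opcode
  \<open>m\<close> and operand code \<open>q\<close> as in \<open>instr_of\<close>. Entry indices
  are one more than register numbers, since index 0 is the program counter.\<close>

definition step_entry :: "(nat \<Rightarrow> nat) \<Rightarrow> nat \<Rightarrow> nat \<Rightarrow> nat \<Rightarrow> nat \<Rightarrow> nat \<Rightarrow> nat \<Rightarrow> nat \<Rightarrow> nat" where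
  "step_entry g a jk k r pc m q =
    (if code_drop k pc = 0 then cert_val g a (prod_encode (jk, r))
     else if r = 0 then
       (if m = 3 \<and> cert_val g a (prod_encode (jk, Suc (fst (prod_decode q)))) =
          cert_val g a (prod_encode (jk, Suc (fst (prod_decode (snd (prod_decode q))))))
        then snd (prod_decode (snd (prod_decode q))) else Suc pc)
     else if m = 0 \<and> r = Suc q then 0
     else if m = 1 \<and> r = Suc q then Suc (cert_val g a (prod_encode (jk, r)))
     else if m = 2 \<and> r = Suc (snd (prod_decode q)) then cert_val g a (prod_encode (jk, Suc (fst (prod_decode q))))
     else if m = 4 \<and> r = Suc q then
       (if cert_oracle g (fst (prod_decode jk)) (cert_val g a (prod_encode (jk, r))) then 1 else 0)
     else cert_val g a (prod_encode (jk, r)))"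

definition cert_step :: "(nat \<Rightarrow> nat) \<Rightarrow> nat \<Rightarrow> nat \<Rightarrow> nat" where
  "cert_step g a e =
    (let jk = fst (prod_decode e); k = snd (prod_decode jk); pc = cert_val g a (prod_encode (jk, 0));
       i = code_nth k pc
     in step_entry g a jk k (snd (prod_decode e)) pc (i mod 5) (i div 5))"

text \<open>The limit clauses Skolemize the liminf rule: \<open>cert_bound\<close> names a stage
  from which on the value \<open>v\<close> no longer occurs, \<open>cert_cofinal\<close> names
  stages where the limit value recurs, and \<open>cert_overflow\<close> marks that no value recurs,
  with the default 0. Everything except well-foundedness thereby becomes universal with a decidable
  matrix.\<close>

definition cert_cond :: "(nat \<Rightarrow> nat) \<Rightarrow> nat \<Rightarrow> nat \<Rightarrow> nat \<Rightarrow> nat \<Rightarrow> nat \<Rightarrow> bool" where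
  "cert_cond g a b d e v \<longleftrightarrow>
    cert_le g a a \<and> (cert_le g a b \<and> cert_le g b a \<longrightarrow> a = b) \<and>
    (cert_le g a b \<and> cert_le g b d \<longrightarrow> cert_le g a d) \<and> (cert_le g a b \<or> cert_le g b a) \<and>
    (cert_kind g a = 0 \<longrightarrow> cert_le g a b \<and> cert_val g a e = 0) \<and>
    (cert_kind g a = 1 \<longrightarrow>
      cert_lt g (cert_between g a b) a \<and> (cert_lt g b a \<longrightarrow> cert_lt g b (cert_between g a b)) \<and>
      (v < cert_val g a e \<or> cert_overflow g a e \<longrightarrow> cert_lt g (cert_bound g a e v) a \<and>
        (cert_le g (cert_bound g a e v) b \<and> cert_lt g b a \<longrightarrow> cert_val g b e \<noteq> v)) \<and>
      (\<not> cert_overflow g a e \<and> cert_lt g b a \<longrightarrow> cert_le g b (cert_cofinal g a e b) \<and>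
        cert_lt g (cert_cofinal g a e b) a \<and> cert_val g (cert_cofinal g a e b) e = cert_val g a e) \<and>
      (cert_overflow g a e \<longrightarrow> cert_val g a e = 0)) \<and>
    (1 < cert_kind g a \<longrightarrow>
      cert_lt g (cert_kind g a - 2) a \<and> \<not> (cert_lt g (cert_kind g a - 2) b \<and> cert_lt g b a) \<and>
      cert_val g a e = cert_step g (cert_kind g a - 2) e) \<and>
    cert_lt g 0 1 \<and> cert_val g 0 e = cert_val g 1 e \<and>
    (cert_le g 0 b \<and> cert_lt g b 1 \<longrightarrow> cert_val g 0 e \<le> cert_val g b e)"

definition certificate :: "(nat \<Rightarrow> nat) \<Rightarrow> bool" where
  "certificate g \<longleftrightarrow> wf {(a, b). cert_lt g a b} \<and> (\<forall>a b d e v. cert_cond g a b d e v)"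

definition cert_config :: "(nat \<Rightarrow> nat) \<Rightarrow> nat \<Rightarrow> nat \<Rightarrow> nat \<Rightarrow> config" where
  "cert_config g j k a = (cert_val g a (prod_encode (prod_encode (j, k), 0)),
     \<lambda>i. cert_val g a (prod_encode (prod_encode (j, k), Suc i)))"

lemma entry_cert_config: "entry (cert_config g j k a) r = cert_val g a (prod_encode (prod_encode (j, k), r))"
  by (cases r) (simp_all add: cert_config_def)

lemma halted_cert_config:
  "halted (P k) (cert_config g j k a) \<longleftrightarrow> code_drop k (cert_val g a (prod_encode (prod_encode (j, k), 0))) = 0"
  by (simp add: halted_def P_def cert_config_def code_drop_eq_0)

text \<open>The arithmetical form of a machine step agrees with the machine, provided its oracle is
  the one read off the certificate itself.\<close>

lemma entry_step_cert_config:
  "entry (Defs.step (P k) {u. cert_oracle g j u} (cert_config g j k a)) r =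
    cert_step g a (prod_encode (prod_encode (j, k), r))"
proof -
  let ?c = "cert_config g j k a" and ?pc = "cert_val g a (prod_encode (prod_encode (j, k), 0))"
  have reg: "snd ?c i = cert_val g a (prod_encode (prod_encode (j, k), Suc i))" for i by (simp add: cert_config_def)
  have pc: "fst ?c = ?pc" by (simp add: cert_config_def)
  show ?thesis
  proof (cases "code_drop k ?pc = 0")
    case True
    then show ?thesis
      by (simp add: step_def halted_cert_config cert_step_def step_entry_def entry_cert_config Let_def)
  next
    case False
    define m where "m = code_nth k ?pc"
    have "?pc < length (list_decode k)" using False code_drop_eq_0 by (simp add: not_le)
    then have i: "P k ! ?pc = instr_of m" unfolding m_def P_def by (simp add: code_nth_eq)
    have c: "?c = (?pc, snd ?c)" using pc by (metis prod.collapse)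
    have st: "Defs.step (P k) {u. cert_oracle g j u} ?c = exec {u. cert_oracle g j u} (instr_of m) (?pc, snd ?c)"
      using False i pc c by (simp add: step_def halted_cert_config)
    have "m mod 5 < 5" by simp
    then consider "m mod 5 = 0" | "m mod 5 = 1" | "m mod 5 = 2" | "m mod 5 = 3" | "m mod 5 = 4" by linarith
    then show ?thesis
      unfolding st cert_step_def step_entry_def Let_def prod_encode_inverse fst_conv snd_conv m_def[symmetric]
      using False
      by cases (cases r; simp add: instr_of_def Let_def reg)+
  qed
qed

text \<open>Induction on the level. If level \<open>j\<close> is the true jump, the columns (j, k)
  are genuine runs of \<open>P k\<close> along a well-order of the naturals, and the loop between
  the nodes 0 and 1 decides halting.\<close>

lemma certificate_oracle:
  assumes "certificate g"
  shows "{k. cert_oracle g j k} = itrm_jump_iter j"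
proof (induction j)
  case 0
  show ?case by (simp add: cert_oracle_def)
next
  case (Suc j)
  have cc: "cert_cond g a b d e v" for a b d e v using assms unfolding certificate_def by blast
  define W where "W = {(a, b). cert_le g a b}"
  have F: "Field W = UNIV"
  proof -
    have "cert_le g a a" for a using cc[of a] unfolding cert_cond_def by blast
    then show ?thesis unfolding W_def Field_def by blast
  qed
  have lt: "sless W a b \<longleftrightarrow> cert_lt g a b" for a b by (simp add: W_def sless_def cert_lt_def)
  have order: "cert_le g a a" "cert_le g a b \<and> cert_le g b a \<longrightarrow> a = b"
    "cert_le g a b \<and> cert_le g b d \<longrightarrow> cert_le g a d" "cert_le g a b \<or> cert_le g b a" for a b d
    using cc[of a b d] unfolding cert_cond_def by blast+
  have "refl W" "trans W" "antisym W" "total W"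
    unfolding W_def refl_on_def trans_def antisym_def total_on_def using order by blast+
  then have "Linear_order W" unfolding order_on_defs F by auto
  moreover have "W - Id = {(a, b). cert_lt g a b}" by (auto simp: W_def cert_lt_def)
  ultimately have wo: "Well_order W"
    using assms unfolding well_order_on_def certificate_def by simp
  interpret wellord W using wo by unfold_locales
  have kind0: "cert_kind g a = 0 \<Longrightarrow> is_minimal W a" for a
    using cc[of a] le_antisym unfolding cert_cond_def is_minimal_def by (auto simp: W_def)
  have kind1: "cert_kind g a = 1 \<Longrightarrow> is_limit a" for a
  proof -
    assume k: "cert_kind g a = 1"
    have b: "lt (cert_between g a b) a" "lt b a \<Longrightarrow> lt b (cert_between g a b)" for b
      using cc[of a b] k unfolding cert_cond_def lt by auto
    have "\<not> imm_pred W b a" for b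
      using b[of b] imm_pred_lt imm_pred_le not_lt by blast
    then show "is_limit a" using b(1) not_minimal F unfolding is_limit_def by blast
  qed
  have kind2: "1 < cert_kind g a \<Longrightarrow> imm_pred W (cert_kind g a - 2) a" for a
  proof -
    assume k: "1 < cert_kind g a"
    have "lt (cert_kind g a - 2) a" "\<not> (lt (cert_kind g a - 2) b \<and> lt b a)" for b
      using cc[of a b] k unfolding cert_cond_def lt by auto
    then show ?thesis unfolding imm_pred_def by (metis sless_def)
  qed
  \<comment> \<open>The tags are exhaustive and the three kinds of stages exclude each other, so the
    implications from tag to kind can be reversed.\<close>
  have kinds: "cert_kind g a = 0 \<or> cert_kind g a = 1 \<or> 1 < cert_kind g a" for a by linarith
  have run: "run_on (P k) (itrm_jump_iter j) W (cert_config g j k)" for k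
    unfolding run_on_def
  proof (intro ballI conjI allI impI)
    fix a assume "is_minimal W a"
    then have "cert_kind g a = 0"
      using kinds[of a] kind1 kind2 imm_pred_lt not_minimal unfolding is_limit_def by blast
    then have "entry (cert_config g j k a) r = entry init_config r" for r
      using cc[of a] unfolding cert_cond_def entry_cert_config by (cases r) (auto simp: init_config_def)
    then show "cert_config g j k a = init_config" by (rule config_eqI)
  next
    fix a b assume b: "imm_pred W b a"
    then have k: "1 < cert_kind g a"
      using kinds[of a] kind0 kind1 imm_pred_lt not_minimal unfolding is_limit_def by blast
    then have "b = cert_kind g a - 2" using kind2 b imm_pred_unique by blast
    then have "entry (cert_config g j k a) r = entry (Defs.step (P k) {u. cert_oracle g j u} (cert_config g j k b)) r" for r
      unfolding entry_step_cert_config entry_cert_config using cc[of a] k unfolding cert_cond_def by auto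
    then show "cert_config g j k a = Defs.step (P k) (itrm_jump_iter j) (cert_config g j k b)"
      unfolding Suc.IH by (rule config_eqI)
  next
    fix a r assume "\<not> is_minimal W a \<and> \<not> (\<exists>b. imm_pred W b a)"
    then have k: "cert_kind g a = 1" using kinds[of a] kind0 kind2 by blast
    let ?e = "prod_encode (prod_encode (j, k), r)"
    let ?f = "\<lambda>b. cert_val g b ?e"
    have C: "(v < ?f a \<or> cert_overflow g a ?e \<longrightarrow> lt (cert_bound g a ?e v) a \<and>
        (le (cert_bound g a ?e v) b \<and> lt b a \<longrightarrow> ?f b \<noteq> v)) \<and>
      (\<not> cert_overflow g a ?e \<and> lt b a \<longrightarrow> le b (cert_cofinal g a ?e b) \<and>
        lt (cert_cofinal g a ?e b) a \<and> ?f (cert_cofinal g a ?e b) = ?f a) \<and>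
      (cert_overflow g a ?e \<longrightarrow> ?f a = 0)" for b v
      using cc[of a b _ ?e v] k unfolding cert_cond_def lt by (simp add: W_def)
    have nc: "\<not> cofinal_val W a ?f v" if "v < ?f a \<or> cert_overflow g a ?e" for v
    proof
      assume "cofinal_val W a ?f v"
      moreover have "lt (cert_bound g a ?e v) a" using C[of v] that by blast
      ultimately obtain b where "le (cert_bound g a ?e v) b" "lt b a" "?f b = v"
        unfolding cofinal_val_def by blast
      then show False using C[of v b] that by blast
    qed
    have "lim_val W a ?f = ?f a"
    proof (cases "cert_overflow g a ?e")
      case True
      then have "\<nexists>v. cofinal_val W a ?f v" using nc by blast
      then show ?thesis using C True by (simp add: lim_val_def)
    next
      case False
      then have c: "cofinal_val W a ?f (?f a)" using C unfolding cofinal_val_def by blast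
      moreover have "(LEAST v. cofinal_val W a ?f v) = ?f a"
      proof (rule Least_equality)
        show "?f a \<le> v" if "cofinal_val W a ?f v" for v using nc that not_less by blast
      qed (rule c)
      ultimately show ?thesis unfolding lim_val_def by auto
    qed
    then show "entry (cert_config g j k a) r = lim_val W a (\<lambda>b. entry (cert_config g j k b) r)"
      unfolding entry_cert_config by simp
  qed
  have lt01: "lt 0 1" using cc unfolding cert_cond_def lt by blast
  have loop: "cert_val g 0 e = cert_val g 1 e"
    "h \<in> seg 0 1 \<Longrightarrow> cert_val g 0 e \<le> cert_val g h e" for h e
    using cc[of 0 h 0 e 0] unfolding cert_cond_def lt by (simp_all add: W_def)
  have "halts (P k) (itrm_jump_iter j) \<longleftrightarrow> halted (P k) (cert_config g j k 0)" for k
    by (rule halts_iff_halted_at_loop[OF run lt01 countableI_type, unfolded entry_cert_config, OF loop])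
  then show ?case
    unfolding itrm_jump_iter.simps itrm_jump_def halted_cert_config by (simp add: cert_oracle_def)
qed

section \<open>Existence of a certificate\<close>

lemma (in wellord) infinite_below_limit:
  assumes "is_limit s"
  shows "infinite {x. lt x s}"
proof -
  have "\<exists>b. \<forall>n::nat. lt (b n) s \<and> lt (b n) (b (Suc n))"
    by (rule dependent_nat_choice) (use limit_below[OF assms] limit_between[OF assms] in blast)+
  then obtain b where b: "\<And>n::nat. lt (b n) s" "\<And>n. lt (b n) (b (Suc n))" by blast
  have "lt (b m) (b n)" if "m < n" for m n
    using that by (induction n) (use b(2) lt_trans in \<open>auto simp: less_Suc_eq\<close>)
  then have "inj b" using lt_irrefl by (metis injI linorder_neqE_nat)
  then have "infinite (range b)" by (rule range_inj_infinite)
  moreover have "range b \<subseteq> {x. lt x s}" using b by blast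
  ultimately show ?thesis using infinite_super by blast
qed

lemma ex_certificate_functions:
  fixes Le :: "nat \<Rightarrow> nat \<Rightarrow> bool" and V
  obtains g where "cert_le g = Le" "cert_kind g = K" "cert_val g = V" "cert_between g = B"
    "cert_bound g = C" "cert_cofinal g = D" "cert_overflow g = Ov"
proof -
  let ?f = "\<lambda>m. fst (prod_decode m)" and ?s = "\<lambda>m. snd (prod_decode m)"
  define g where "g n = (let t = ?f n; m = ?s n in
    if t = 0 then (if Le (?f m) (?s m) then 1 else 0)
    else if t = 1 then K m
    else if t = 2 then V (?f m) (?s m)
    else if t = 3 then B (?f m) (?s m)
    else if t = 4 then C (?f m) (?f (?s m)) (?s (?s m))
    else if t = 5 then D (?f m) (?f (?s m)) (?s (?s m))
    else if Ov (?f m) (?s m) then 1 else 0)" for n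
  show ?thesis
    by (rule that[of g]; intro ext)
      (simp_all add: g_def Let_def cert_le_def cert_kind_def cert_val_def cert_between_def
        cert_bound_def cert_cofinal_def cert_overflow_def)
qed

text \<open>The runs of all programs at all levels have countably many entries, so
  \<open>ex_common_loop\<close> applies to all of them jointly. The stages up to the second loop
  stage form a countable set, which is renumbered with the loop stages as 0 and 1; the Skolem
  functions are then chosen along this initial segment.\<close>

theorem certificate_exists: "\<exists>g. certificate g"
proof -
  define c where "c j k = (SOME c. run_on (P k) (itrm_jump_iter j) omega1 c)" for j k
  have c: "run_on (P k) (itrm_jump_iter j) omega1 (c j k)" for j k
    unfolding c_def using someI_ex[OF omega1.run_on_exists] .
  define f where "f e x = entry (c (fst (prod_decode (fst (prod_decode e)))) (snd (prod_decode (fst (prod_decode e)))) x)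
     (snd (prod_decode e))" for e x
  have f_entry: "f (prod_encode (prod_encode (j, k), r)) x = entry (c j k x) r" for j k r x
    by (simp add: f_def)
  have f_lim: "f e x = lim_val omega1 x (f e)" if "omega1.is_limit x" for e x
    unfolding f_def by (rule omega1.run_on_limit[OF c that])
  obtain s t where st: "sless omega1 s t" "omega1.is_limit s" "\<And>e. f e s = f e t"
    "\<And>e h. (s, h) \<in> omega1 \<Longrightarrow> f e s \<le> f e h"
    by (rule omega1.ex_common_loop[OF omega_bounded_omega1, of f]) (erule f_lim, blast)
  define A where "A = {x. (x, t) \<in> omega1} - {s, t}"
  have tF: "t \<in> Field omega1" "s \<noteq> t" using st(1) omega1.lt_Field omega1.lt_irrefl by blast+
  have "countable A"
    by (rule countable_subset[OF _ countable_below_omega1[of t]]) (auto simp: A_def sless_def)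
  \<comment> \<open>A bijection with all natural numbers needs infinitely many further stages; they
    exist because \<open>s\<close> is a limit.\<close>
  moreover have "infinite A"
  proof
    assume "finite A"
    moreover have "{x. sless omega1 x s} \<subseteq> A"
      unfolding A_def using st(1) omega1.lt_trans omega1.lt_irrefl omega1.lt_le by blast
    ultimately show False using omega1.infinite_below_limit[OF st(2)] finite_subset by blast
  qed
  ultimately have bij: "bij_betw (from_nat_into A) UNIV A" by (rule bij_betw_from_nat_into)
  define \<phi> where "\<phi> n = (case n of 0 \<Rightarrow> s | Suc m \<Rightarrow> (case m of 0 \<Rightarrow> t | Suc i \<Rightarrow> from_nat_into A i))" for n
  have \<phi>01: "\<phi> 0 = s" "\<phi> 1 = t" by (simp_all add: \<phi>_def)
  have A_mem: "from_nat_into A i \<in> A" for i using bij unfolding bij_betw_def by blast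
  have "inj \<phi>"
  proof (rule injI)
    fix m n assume "\<phi> m = \<phi> n"
    moreover have "inj (from_nat_into A)" using bij unfolding bij_betw_def by blast
    ultimately show "m = n"
      using A_mem tF(2) unfolding \<phi>_def A_def by (auto split: nat.splits dest: injD)
  qed
  have rng: "range \<phi> = {x. (x, t) \<in> omega1}"
  proof -
    have "\<phi> n \<in> insert s (insert t A)" for n using A_mem by (auto simp: \<phi>_def split: nat.split)
    then have 1: "range \<phi> \<subseteq> insert s (insert t A)" by blast
    have 2: "insert s (insert t A) = {x. (x, t) \<in> omega1}"
      unfolding A_def using omega1.lt_le[OF st(1)] omega1.le_refl[OF tF(1)] by blast
    have "x \<in> range \<phi>" if "x \<in> insert s (insert t A)" for x
    proof -
      have "x = \<phi> 0 \<or> x = \<phi> 1 \<or> (\<exists>i. x = \<phi> (Suc (Suc i)))"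
        using that bij unfolding bij_betw_def \<phi>_def by auto
      then show ?thesis by blast
    qed
    then have "insert s (insert t A) \<subseteq> range \<phi>" by blast
    then show ?thesis using 1 2 by simp
  qed
  \<comment> \<open>The range is an initial segment, so every witness found below a numbered stage
    has a number itself.\<close>
  have dn: "\<exists>b. x = \<phi> b" if "(x, \<phi> a) \<in> omega1" for x a
    using that rng omega1.le_trans[of x "\<phi> a" t] by (metis mem_Collect_eq rangeE rangeI)
  have \<phi>F: "\<phi> a \<in> Field omega1" for a using rng omega1.le_Field by blast
  have \<phi>eq: "\<phi> a = \<phi> b \<longleftrightarrow> a = b" for a b using \<open>inj \<phi>\<close> by (simp add: inj_eq)
  define Le where "Le a b \<longleftrightarrow> (\<phi> a, \<phi> b) \<in> omega1" for a b
  define Lt where "Lt a b \<longleftrightarrow> sless omega1 (\<phi> a) (\<phi> b)" for a b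
  have Lt: "Lt a b \<longleftrightarrow> Le a b \<and> a \<noteq> b" for a b by (simp add: Lt_def Le_def sless_def \<phi>eq)
  define V where "V a e = f e (\<phi> a)" for a e
  have "\<forall>a. \<exists>k. (k = 0 \<and> is_minimal omega1 (\<phi> a)) \<or> (k = 1 \<and> omega1.is_limit (\<phi> a)) \<or>
      (1 < k \<and> imm_pred omega1 (\<phi> (k - 2)) (\<phi> a))"
  proof
    fix a
    consider "is_minimal omega1 (\<phi> a)" | "omega1.is_limit (\<phi> a)" | x where "imm_pred omega1 x (\<phi> a)"
      using \<phi>F unfolding omega1.is_limit_def by blast
    then show "\<exists>k. (k = 0 \<and> is_minimal omega1 (\<phi> a)) \<or> (k = 1 \<and> omega1.is_limit (\<phi> a)) \<or>
      (1 < k \<and> imm_pred omega1 (\<phi> (k - 2)) (\<phi> a))"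
    proof cases
      case (3 x)
      then obtain b where "x = \<phi> b" using dn omega1.imm_pred_lt omega1.lt_le by blast
      then show ?thesis using 3 by (intro exI[of _ "b + 2"]) simp
    qed blast+
  qed
  then obtain K where K: "\<And>a. (K a = 0 \<and> is_minimal omega1 (\<phi> a)) \<or> (K a = 1 \<and> omega1.is_limit (\<phi> a)) \<or>
      (1 < K a \<and> imm_pred omega1 (\<phi> (K a - 2)) (\<phi> a))" by metis
  have K0: "is_minimal omega1 (\<phi> a)" if "K a = 0" for a using K[of a] that by auto
  have K1: "omega1.is_limit (\<phi> a)" if "K a = 1" for a using K[of a] that by auto
  have K2: "imm_pred omega1 (\<phi> (K a - 2)) (\<phi> a)" if "1 < K a" for a using K[of a] that by auto
  have "\<forall>a b. \<exists>w. K a = 1 \<longrightarrow> Lt w a \<and> (Lt b a \<longrightarrow> Lt b w)"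
  proof (intro allI)
    fix a b
    show "\<exists>w. K a = 1 \<longrightarrow> Lt w a \<and> (Lt b a \<longrightarrow> Lt b w)"
    proof (cases "K a = 1")
      case True
      obtain x where "sless omega1 x (\<phi> a)" "sless omega1 (\<phi> b) (\<phi> a) \<longrightarrow> sless omega1 (\<phi> b) x"
        using omega1.limit_between[OF K1[OF True], of "\<phi> b"] omega1.limit_below[OF K1[OF True]] by blast
      moreover from this obtain w where "x = \<phi> w" using dn omega1.lt_le by blast
      ultimately show ?thesis unfolding Lt_def by blast
    qed simp
  qed
  then obtain B where B: "\<And>a b. K a = 1 \<Longrightarrow> Lt (B a b) a \<and> (Lt b a \<longrightarrow> Lt b (B a b))" by metis
  define Ov where "Ov a e \<longleftrightarrow> (\<nexists>v. cofinal_val omega1 (\<phi> a) (f e) v)" for a e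
  have ncof: "\<not> cofinal_val omega1 (\<phi> a) (f e) v" if "K a = 1" "v < V a e \<or> Ov a e" for a e v
  proof
    assume v: "cofinal_val omega1 (\<phi> a) (f e) v"
    have "(LEAST v. cofinal_val omega1 (\<phi> a) (f e) v) \<le> v" using v by (rule Least_le)
    moreover have "V a e = (LEAST v. cofinal_val omega1 (\<phi> a) (f e) v)"
      unfolding V_def f_lim[OF K1[OF that(1)]] lim_val_def using v by auto
    ultimately show False using that(2) v unfolding Ov_def by auto
  qed
  have "\<forall>a e v. \<exists>w. K a = 1 \<and> (v < V a e \<or> Ov a e) \<longrightarrow> Lt w a \<and> (\<forall>b. Le w b \<and> Lt b a \<longrightarrow> V b e \<noteq> v)"
  proof (intro allI)
    fix a e v
    show "\<exists>w. K a = 1 \<and> (v < V a e \<or> Ov a e) \<longrightarrow> Lt w a \<and> (\<forall>b. Le w b \<and> Lt b a \<longrightarrow> V b e \<noteq> v)"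
    proof (cases "K a = 1 \<and> (v < V a e \<or> Ov a e)")
      case True
      then obtain x where x: "sless omega1 x (\<phi> a)" "\<And>h. (x, h) \<in> omega1 \<Longrightarrow> sless omega1 h (\<phi> a) \<Longrightarrow> f e h \<noteq> v"
        using ncof[of a v e] unfolding cofinal_val_def by blast
      then obtain w where "x = \<phi> w" using dn omega1.lt_le by blast
      then show ?thesis using x unfolding Lt_def Le_def V_def by blast
    qed blast
  qed
  then obtain C where C: "\<And>a e v. K a = 1 \<Longrightarrow> v < V a e \<or> Ov a e \<Longrightarrow>
      Lt (C a e v) a \<and> (\<forall>b. Le (C a e v) b \<and> Lt b a \<longrightarrow> V b e \<noteq> v)" by metis
  have "\<forall>a e b. \<exists>w. K a = 1 \<and> \<not> Ov a e \<and> Lt b a \<longrightarrow> Le b w \<and> Lt w a \<and> V w e = V a e"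
  proof (intro allI)
    fix a e b
    show "\<exists>w. K a = 1 \<and> \<not> Ov a e \<and> Lt b a \<longrightarrow> Le b w \<and> Lt w a \<and> V w e = V a e"
    proof (cases "K a = 1 \<and> \<not> Ov a e \<and> Lt b a")
      case True
      then have ex: "\<exists>v. cofinal_val omega1 (\<phi> a) (f e) v" unfolding Ov_def by blast
      then have "V a e = (LEAST v. cofinal_val omega1 (\<phi> a) (f e) v)"
        unfolding V_def using f_lim[OF K1, of a e] True by (simp add: lim_val_def)
      then have "cofinal_val omega1 (\<phi> a) (f e) (V a e)" using LeastI_ex[OF ex] by simp
      then obtain x where x: "(\<phi> b, x) \<in> omega1" "sless omega1 x (\<phi> a)" "f e x = V a e"
        using True unfolding cofinal_val_def Lt_def by blast
      then obtain w where "x = \<phi> w" using dn omega1.lt_le by blast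
      then show ?thesis using x unfolding Lt_def Le_def V_def by blast
    qed blast
  qed
  then obtain D where D: "\<And>a e b. K a = 1 \<Longrightarrow> \<not> Ov a e \<Longrightarrow> Lt b a \<Longrightarrow> Le b (D a e b) \<and> Lt (D a e b) a \<and> V (D a e b) e = V a e"
    by metis
  obtain g where g: "cert_le g = Le" "cert_kind g = K" "cert_val g = V" "cert_between g = B"
    "cert_bound g = C" "cert_cofinal g = D" "cert_overflow g = Ov"
    by (rule ex_certificate_functions)
  have glt: "cert_lt g = Lt" by (intro ext) (simp add: cert_lt_def g Lt)
  have conf: "cert_config g j k a = c j k (\<phi> a)" for j k a
    by (rule config_eqI) (simp add: entry_cert_config g V_def f_entry)
  \<comment> \<open>Node 0 is the stage \<open>s\<close>, where the loops of all levels begin, so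
    the bit read there is the true answer.\<close>
  have orc: "{u. cert_oracle g j u} = itrm_jump_iter j" for j
  proof (cases j)
    case 0
    then show ?thesis by (simp add: cert_oracle_def)
  next
    case (Suc i)
    have "halts (P k) (itrm_jump_iter i) \<longleftrightarrow> halted (P k) (c i k s)" for k
      by (rule omega1.halts_iff_halted_at_loop[OF c st(1) countable_below_omega1])
        (use st(3,4) f_entry[of i k] in \<open>metis mem_Collect_eq\<close>)+
    then show ?thesis
      unfolding Suc itrm_jump_iter.simps itrm_jump_def \<phi>01(1)[symmetric] conf[symmetric] halted_cert_config
      by (simp add: cert_oracle_def)
  qed
  have val_step: "V a e = cert_step g b e" if "imm_pred omega1 (\<phi> b) (\<phi> a)" for a b e
  proof -
    obtain j k r where e: "e = prod_encode (prod_encode (j, k), r)" by (metis prod_decode_inverse surj_pair)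
    have "cert_step g b e = entry (Defs.step (P k) (itrm_jump_iter j) (c j k (\<phi> b))) r"
      unfolding e entry_step_cert_config[symmetric] orc conf ..
    also have "\<dots> = entry (c j k (\<phi> a)) r" using omega1.run_on_succ[OF c that] by simp
    finally show ?thesis by (simp add: e V_def f_entry)
  qed
  have val_init: "V a e = 0" if "is_minimal omega1 (\<phi> a)" for a e
  proof -
    have "c j k (\<phi> a) = init_config" for j k using c that \<phi>F unfolding run_on_def by blast
    then show ?thesis by (cases "snd (prod_decode e)") (simp_all add: V_def f_def init_config_def)
  qed
  have "wf {(a, b). Lt a b}"
  proof -
    have "{(a, b). Lt a b} = inv_image {(x, y). sless omega1 x y} \<phi>" by (auto simp: Lt_def inv_image_def)
    then show ?thesis using wf_inv_image[OF omega1.wf_lt] by simp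
  qed
  moreover have "cert_cond g a b d e v" for a b d e v
    unfolding cert_cond_def glt unfolding g
  proof (intro conjI impI)
    show "Le a a" using omega1.le_refl \<phi>F by (simp add: Le_def)
    show "a = b" if "Le a b \<and> Le b a" using that omega1.le_antisym \<phi>eq unfolding Le_def by blast
    show "Le a d" if "Le a b \<and> Le b d" using that omega1.le_trans unfolding Le_def by blast
    show "Le a b \<or> Le b a" unfolding Le_def using omega1.le_or_lt[OF \<phi>F \<phi>F, of a b] omega1.lt_le by blast
    show "Le a b" if "K a = 0"
      using K0[OF that] omega1.le_or_lt[OF \<phi>F \<phi>F, of a b] omega1.not_minimal unfolding Le_def by blast
    show "V a e = 0" if "K a = 0" using val_init K0 that by blast
    show "Lt (B a b) a" if "K a = 1" using B that by blast
    show "Lt b (B a b)" if "K a = 1" "Lt b a" using B that by blast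
    show "Lt (C a e v) a" if "K a = 1" "v < V a e \<or> Ov a e" using C that by blast
    show "V b e \<noteq> v" if "K a = 1" "v < V a e \<or> Ov a e" "Le (C a e v) b \<and> Lt b a" using C that by blast
    show "Le b (D a e b)" if "K a = 1" "\<not> Ov a e \<and> Lt b a" using D that by blast
    show "Lt (D a e b) a" if "K a = 1" "\<not> Ov a e \<and> Lt b a" using D that by blast
    show "V (D a e b) e = V a e" if "K a = 1" "\<not> Ov a e \<and> Lt b a" using D that by blast
    show "V a e = 0" if "K a = 1" "Ov a e"
      using f_lim[OF K1[OF that(1)], of e] that(2) unfolding V_def Ov_def lim_val_def by simp
    show "Lt (K a - 2) a" if "1 < K a" using omega1.imm_pred_lt[OF K2[OF that]] unfolding Lt_def .
    show "\<not> (Lt (K a - 2) b \<and> Lt b a)" if "1 < K a"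
      using omega1.imm_pred_le[OF K2[OF that]] omega1.not_lt unfolding Lt_def by blast
    show "V a e = cert_step g (K a - 2) e" if "1 < K a" using val_step[OF K2[OF that]] .
    show "Lt 0 1" using st(1) unfolding Lt_def \<phi>01 .
    show "V 0 e = V 1 e" using st(3) unfolding V_def \<phi>01 .
    show "V 0 e \<le> V b e" if "Le 0 b \<and> Lt b 1" using st(4) that unfolding V_def Le_def \<phi>01 by blast
  qed
  ultimately have "certificate g" unfolding certificate_def glt by blast
  then show ?thesis by blast
qed

section \<open>Certificates presented as oracles\<close>

text \<open>A set acts as a function by taking least values, so different sets may present the same
  function. Totality guarantees that the search in \<open>graph_fun\<close> ends; hence it is tested
  before anything is computed from the oracle.\<close>

definition total_graphs :: "nat set set" where
  "total_graphs = {z. \<forall>n. \<exists>m. prod_encode (n, m) \<in> z}"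

definition graph_fun :: "nat set \<Rightarrow> nat \<Rightarrow> nat" where
  "graph_fun z n = (LEAST m. prod_encode (n, m) \<in> z)"

lemma ucomp_graph_fun:
  assumes "ucomp total_graphs n F"
  shows "ucomp total_graphs n (\<lambda>z xs. graph_fun z (F z xs))"
proof -
  have "ucomp total_graphs (Suc 0) (\<lambda>z xs. LEAST k. prod_encode ((k # xs) ! 1, (k # xs) ! 0) \<in> z)"
    by (intro ucomp_Least_dec ucomp_intros) (auto simp: total_graphs_def)
  then have "ucomp total_graphs (Suc 0) (\<lambda>z xs. graph_fun z (xs ! 0))" by (simp add: graph_fun_def)
  from ucomp_compose1[OF this assms] show ?thesis by simp
qed

lemma graph_fun_graph: "graph_fun {prod_encode (n, g n) | n. True} = g"
  by (rule ext) (auto simp: graph_fun_def intro: Least_equality)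

lemma udec_cert_lt: "ucomp total_graphs n F \<Longrightarrow> ucomp total_graphs n G \<Longrightarrow> udec total_graphs n (\<lambda>z xs. cert_lt (graph_fun z) (F z xs) (G z xs))"
  unfolding cert_lt_def cert_le_def by (intro ucomp_intros ucomp_graph_fun)

lemma udec_cert_oracle: "ucomp total_graphs n F \<Longrightarrow> ucomp total_graphs n G \<Longrightarrow> udec total_graphs n (\<lambda>z xs. cert_oracle (graph_fun z) (F z xs) (G z xs))"
  unfolding cert_oracle_def cert_val_def by (intro ucomp_intros ucomp_graph_fun ucomp_code_drop)

lemma ucomp_cert_val: "ucomp total_graphs n F \<Longrightarrow> ucomp total_graphs n G \<Longrightarrow> ucomp total_graphs n (\<lambda>z xs. cert_val (graph_fun z) (F z xs) (G z xs))"
  unfolding cert_val_def by (intro ucomp_intros ucomp_graph_fun)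

lemma ucomp_cert_step:
  assumes "ucomp total_graphs n F" "ucomp total_graphs n G"
  shows "ucomp total_graphs n (\<lambda>z xs. cert_step (graph_fun z) (F z xs) (G z xs))"
  unfolding cert_step_def step_entry_def Let_def
  by (intro ucomp_intros ucomp_cert_val udec_cert_oracle ucomp_code_drop ucomp_code_nth assms)

lemma udec_cert_cond:
  assumes "ucomp total_graphs n A" "ucomp total_graphs n B" "ucomp total_graphs n C" "ucomp total_graphs n E" "ucomp total_graphs n V"
  shows "udec total_graphs n (\<lambda>z xs. cert_cond (graph_fun z) (A z xs) (B z xs) (C z xs) (E z xs) (V z xs))"
  unfolding cert_cond_def cert_le_def cert_kind_def cert_between_def cert_bound_def cert_cofinal_def cert_overflow_def
  by (intro ucomp_intros ucomp_cert_val udec_cert_lt ucomp_cert_step ucomp_graph_fun assms)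

text \<open>Well-foundedness and the universal condition fit \<open>condition_test\<close> once the
  five quantified numbers are coded as one.\<close>

lemma certificate_test: "\<exists>fr N. tests fr N total_graphs (\<lambda>z. certificate (graph_fun z))"
proof -
  let ?f = "\<lambda>m. fst (prod_decode m)" and ?s = "\<lambda>m. snd (prod_decode m)"
  let ?Q = "\<lambda>z n (m::nat). cert_cond (graph_fun z) (?f n) (?f (?s n)) (?f (?s (?s n))) (?f (?s (?s (?s n)))) (?s (?s (?s (?s n))))"
  have "udec total_graphs 2 (\<lambda>z xs. cert_lt (graph_fun z) (xs ! 0) (xs ! 1))"
    by (intro udec_cert_lt ucomp_proj) simp_all
  moreover have "udec total_graphs 2 (\<lambda>z xs. ?Q z (xs ! 0) (xs ! 1))"
    by (intro udec_cert_cond ucomp_intros) simp_all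
  ultimately have "\<exists>fr N. tests fr N total_graphs (\<lambda>z. wf {(a, b). cert_lt (graph_fun z) a b} \<and> (\<forall>n. \<exists>m. ?Q z n m))"
    by (rule condition_test)
  moreover have "(\<forall>n. \<exists>m. ?Q z n m) \<longleftrightarrow> (\<forall>a b d e v. cert_cond (graph_fun z) a b d e v)" for z
  proof
    assume *: "\<forall>n. \<exists>m. ?Q z n m"
    show "\<forall>a b d e v. cert_cond (graph_fun z) a b d e v"
    proof (intro allI)
      fix a b d e v
      show "cert_cond (graph_fun z) a b d e v"
        using spec[OF *, of "prod_encode (a, prod_encode (b, prod_encode (d, prod_encode (e, v))))"] by simp
    qed
  qed blast
  ultimately show ?thesis unfolding certificate_def by simp
qed

text \<open>Totality is itself a universal-existential condition; the empty relation is used for the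
  well-founded half.\<close>

lemma total_graph_test: "\<exists>fr N. tests fr N UNIV (\<lambda>z. z \<in> total_graphs)"
proof -
  have "udec UNIV 2 (\<lambda>z xs. prod_encode (xs ! 0, xs ! 1) \<in> z)" "udec UNIV 2 (\<lambda>z xs. (1::nat) = 0)"
    by (intro ucomp_intros; simp)+
  from condition_test[OF this(2,1)] show ?thesis by (simp add: total_graphs_def)
qed

lemma nonempty_test: "\<exists>fr N. tests fr N UNIV (\<lambda>z. z \<noteq> {})"
proof -
  have "udec UNIV 2 (\<lambda>z xs. xs ! 1 \<in> z)" "udec UNIV 2 (\<lambda>z xs. (1::nat) = 0)"
    by (intro ucomp_intros; simp)+
  from condition_test[OF this(2,1)] show ?thesis by (simp add: ex_in_conv)
qed

section \<open>Simulating a program with a computed oracle\<close>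

lemma liminf_eqI':
  assumes "often A v" "\<And>n w. n \<ge> k \<Longrightarrow> w \<in> A n \<Longrightarrow> v \<le> w"
  shows "liminf A = v"
proof -
  have "v \<le> w" if "often A w" for w using that assms(2) unfolding often_def by blast
  then have "(LEAST v. often A v) = v" using assms(1) by (intro Least_equality)
  then show ?thesis using assms(1) unfolding liminf_def by auto
qed

text \<open>Only finitely many values lie below the liminf, and each of them occurs in finitely many
  segments. In the overflow case the bound 0 is trivial.\<close>

lemma eventually_ge_liminf: "\<exists>k. \<forall>n\<ge>k. \<forall>w\<in>A n. liminf A \<le> w"
proof (cases "\<exists>v. often A v")
  case True
  then have eq: "liminf A = (LEAST v. often A v)" unfolding liminf_def by (rule if_P)
  have "liminf A \<le> v" if "often A v" for v unfolding eq using that by (rule Least_le)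
  then have "\<forall>v<liminf A. \<not> often A v" using not_le by blast
  then have "\<forall>v<liminf A. \<exists>k. \<forall>n\<ge>k. v \<notin> A n" unfolding often_def by blast
  then obtain K where K: "\<And>v n. v < liminf A \<Longrightarrow> n \<ge> K v \<Longrightarrow> v \<notin> A n" by metis
  have "liminf A \<le> w" if n: "n \<ge> Max (insert 0 (K ` {..<liminf A}))" and w: "w \<in> A n" for n w
  proof (rule ccontr)
    assume "\<not> liminf A \<le> w"
    then have "w < liminf A" by simp
    moreover from this have "K w \<le> Max (insert 0 (K ` {..<liminf A}))" by (intro Max_ge) auto
    ultimately show False using K n w order_trans by blast
  qed
  then show ?thesis by blast
next
  case False
  then have "liminf A = 0" unfolding liminf_def by (rule if_not_P)
  then show ?thesis by simp
qed

lemma often_liminf: "\<exists>v. often A v \<Longrightarrow> often A (liminf A)"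
  unfolding liminf_def by (auto intro: LeastI)

text \<open>Pigeonhole: if each of the finitely many values died out, a late segment would be
  empty.\<close>

lemma often_bounded:
  assumes "\<And>n. A n \<noteq> {}" "\<And>n w. w \<in> A n \<Longrightarrow> w < (b::nat)"
  shows "\<exists>v. often A v"
proof (rule ccontr)
  assume "\<nexists>v. often A v"
  then have "\<forall>v. \<exists>k. \<forall>n\<ge>k. v \<notin> A n" unfolding often_def by blast
  then obtain K where K: "\<And>v n. n \<ge> K v \<Longrightarrow> v \<notin> A n" by metis
  let ?n = "Max (insert 0 (K ` {..<b}))"
  obtain w where w: "w \<in> A ?n" using assms(1) by blast
  then have "K w \<le> ?n" using assms(2) by (intro Max_ge) auto
  then show False using K w by blast
qed

text \<open>The first block starts at address \<open>base\<close>. The oracle computation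
  \<open>fo\<close> takes its argument in \<open>M\<close> and answers in \<open>Suc M\<close>;
  \<open>N\<close> is the shift of the simulated registers.\<close>

locale block_code =
  fixes base M N :: nat and fo :: "instr list" and q :: recf
  assumes fo: "computes fo N q [M] (Suc M) (M + 2)" and M: "0 < M"
begin

text \<open>The length of an oracle block: two copies, the fragment \<open>fo\<close> and
  \<open>N - M\<close> clearing instructions. All blocks are padded to this length, so addresses are
  mapped by \<open>base + L * t\<close>, which is computable and preserves order.\<close>

definition L :: nat where
  "L = length fo + 2 + (N - M)"

fun shift_instr :: "instr \<Rightarrow> instr" where
  "shift_instr (Zero r) = Zero (r + N)"
| "shift_instr (Inc r) = Inc (r + N)"
| "shift_instr (Copy i j) = Copy (i + N) (j + N)"
| "shift_instr (Jeq i j t) = Jeq (i + N) (j + N) (base + L * t)"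
| "shift_instr (Orc r) = Orc r"

text \<open>Registers below \<open>M\<close> belong to the certificate check, those from \<open>M\<close> to \<open>N\<close> are scratch
  and zero outside of oracle blocks, and register \<open>r\<close> of the simulated program is \<open>r + N\<close>.\<close>

definition block :: "nat \<Rightarrow> nat \<Rightarrow> instr list" where
  "block i m = (if m mod 5 = 4
     then Copy (m div 5 + N) M # map (reloc (Suc (base + L * i))) fo @ Copy (Suc M) (m div 5 + N) # map Zero [M..<N]
     else replicate (L - 1) (Zero M) @ [shift_instr (instr_of m)])"

lemma MN: "M + 2 \<le> N"
  using fo unfolding computes_def by blast

lemma length_block: "length (block i m) = L"
  unfolding block_def L_def by simp

definition emb :: "(nat \<Rightarrow> nat) \<Rightarrow> config \<Rightarrow> config" where
  "emb J c = (base + L * fst c, \<lambda>r. if r < M then J r else if r < N then 0 else snd c (r - N))"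

lemma emb_regs: "r < M \<Longrightarrow> snd (emb J c) r = J r" "M \<le> r \<Longrightarrow> r < N \<Longrightarrow> snd (emb J c) r = 0"
  "snd (emb J c) (r + N) = snd c r" "fst (emb J c) = base + L * fst c"
  using MN by (auto simp: emb_def)

end

text \<open>The host has oracle \<open>z\<close>, the simulated program oracle \<open>x\<close>;
  membership in \<open>x\<close> is computed from \<open>z\<close> by \<open>q\<close>.\<close>

locale block_simulation = block_code +
  fixes n :: nat and p :: program and z x :: "nat set" and J :: "nat \<Rightarrow> nat"
  assumes p_length: "length p = base + L * length (P n)"
    and p_block: "\<And>i d. i < length (P n) \<Longrightarrow> d < L \<Longrightarrow> p ! (base + L * i + d) = block i (list_decode n ! i) ! d"
    and orc_eval: "\<And>u. reval z q [u] (if u \<in> x then 1 else 0)"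
begin

lemma block_pos: "i < length (P n) \<Longrightarrow> d < L \<Longrightarrow> base + L * i + d < length p"
proof -
  assume "i < length (P n)" "d < L"
  then have "L * i + d < L * Suc i" "L * Suc i \<le> L * length (P n)" by (simp_all add: Suc_le_eq del: mult_Suc_right) (simp)
  then show ?thesis using p_length by linarith
qed

text \<open>The information about \<open>T\<close> is what limits need: no program counter below the
  start of the block, and every simulated register shows only its old or its new value. Padding
  precedes the instruction, which may jump away.\<close>

lemma sim_step:
  assumes "\<not> halted (P n) c"
  shows "\<exists>T. run p z (emb J c) T (emb J (Defs.step (P n) x c)) \<and> emb J c \<in> T \<and>
    (\<forall>e\<in>T. base + L * fst c \<le> fst e \<and> (\<forall>r<M. snd e r = J r) \<and>
      (\<forall>r. snd e (r + N) = snd c r \<or> snd e (r + N) = snd (Defs.step (P n) x c) r))"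
proof -
  obtain pc R where c: "c = (pc, R)" by fastforce
  have pc: "pc < length (P n)" using assms c by (simp add: halted_def)
  define m where "m = list_decode n ! pc"
  have Pm: "P n ! pc = instr_of m" using pc by (simp add: P_def m_def)
  let ?B = "base + L * pc" and ?c' = "Defs.step (P n) x c"
  have st: "?c' = exec x (instr_of m) (pc, R)" using assms c Pm by (simp add: step_def)
  define E where "E = snd (emb J c)"
  have embc: "emb J c = (?B, E)" unfolding E_def by (simp add: emb_def c)
  have E: "\<And>r. r < M \<Longrightarrow> E r = J r" "\<And>r. M \<le> r \<Longrightarrow> r < N \<Longrightarrow> E r = 0" "\<And>r. E (r + N) = R r"
    unfolding E_def using c by (simp_all add: emb_regs)
  have pb: "p ! (?B + d) = block pc m ! d" "?B + d < length p" if "d < L" for d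
    using p_block[OF pc that] block_pos[OF pc that] by (auto simp: m_def)
  let ?U = "{..<M} \<union> {N..}"
  show ?thesis
  proof (cases "m mod 5 = 4")
    case False
    have L1: "L = Suc (L - 1)" unfolding L_def by simp
    have "p ! (?B + d) = Zero M" if "d < L - 1" for d
      using pb(1)[of d] that False by (simp add: block_def nth_append)
    then have "d \<le> L - 1 \<Longrightarrow> brun p z ?B (?B + L) UNIV (?B, E) (?B + d, E)" for d
    proof (induction d)
      case 0
      show ?case by (simp add: brun_refl)
    next
      case (Suc d)
      \<comment> \<open>Padding clears a scratch register that is zero already.\<close>
      have "E(M := 0) = E" using E(2)[of M] MN by (simp add: fun_upd_idem)
      then have "brun p z ?B (?B + L) UNIV (?B + d, E) (?B + Suc d, E)"
        using Suc by (intro brun_step) (auto simp: pb)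
      then show ?case using Suc brun_trans by (meson Suc_leD)
    qed
    from this[of "L - 1"] obtain T where T: "run p z (?B, E) T (?B + (L - 1), E)"
      "\<forall>e\<in>T. ?B \<le> fst e \<and> fst e < ?B + L \<and> (\<forall>r\<in>UNIV. snd e r = E r)"
      unfolding brun_def by auto
    have last: "p ! (?B + (L - 1)) = shift_instr (instr_of m)"
      using pb(1)[of "L - 1"] L1 False by (simp add: block_def nth_append)
    have nh: "\<not> halted p (?B + (L - 1), E)" using pb(2)[of "L - 1"] L1 by (simp add: halted_def)
    have "Defs.step p z (?B + (L - 1), E) = exec z (shift_instr (instr_of m)) (?B + (L - 1), E)"
      using nh last by (simp add: step_def)
    also have "\<dots> = emb J ?c'"
    proof -
      have "m mod 5 < 5" by simp
      then consider "m mod 5 = 0" | "m mod 5 = 1" | "m mod 5 = 2" | "m mod 5 = 3" using False by linarith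
      moreover have "(\<lambda>r. if r < M then J r else if r < N then 0 else Q (r - N)) = E(k + N := v)"
        if "Q = R(k := v)" for Q k v
        using that E MN by (auto simp: fun_eq_iff le_Suc_ex) (metis E(3) le_add_diff_inverse2 not_less)
      moreover have "(\<lambda>r. if r < M then J r else if r < N then 0 else R (r - N)) = E"
        using E MN by (auto simp: fun_eq_iff) (metis E(3) le_add_diff_inverse2 not_less)
      moreover have "Suc (?B + (L - 1)) = ?B + L" using L1 by simp
      ultimately show ?thesis
        unfolding st emb_def
        by cases (auto simp: instr_of_def Let_def E(3))
    qed
    finally have fin: "Defs.step p z (?B + (L - 1), E) = emb J ?c'" .
    have "run p z (?B, E) (insert (?B + (L - 1), E) T) (emb J ?c')"
      using run.step[OF T(1) nh] fin by simp
    moreover have "emb J c \<in> insert (?B + (L - 1), E) T" using run_start[OF T(1)] embc by auto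
    moreover have "\<forall>e\<in>insert (?B + (L - 1), E) T. base + L * fst c \<le> fst e \<and> (\<forall>r<M. snd e r = J r) \<and>
      (\<forall>r. snd e (r + N) = snd c r \<or> snd e (r + N) = snd ?c' r)"
      using T(2) E c by auto
    ultimately show ?thesis unfolding embc by blast
  next
    case True
    define k where "k = m div 5"
    have ins: "instr_of m = Orc k" using True by (simp add: instr_of_def Let_def k_def)
    let ?v = "if R k \<in> x then 1 else 0 :: nat"
    have c': "?c' = (Suc pc, R(k := ?v))" unfolding st ins by simp
    have blk: "block pc m = Copy (k + N) M # map (reloc (Suc ?B)) fo @ Copy (Suc M) (k + N) # map Zero [M..<N]"
      using True by (simp add: block_def k_def)
    let ?l = "length fo"
    have i0: "p ! ?B = Copy (k + N) M" "?B < length p" using pb[of 0] blk by (simp_all add: L_def)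
    have cat: "cat p (Suc ?B) 0 fo"
      unfolding cat_def
    proof (intro allI impI)
      fix d assume d: "d < ?l"
      have "p ! (?B + Suc d) = block pc m ! Suc d" "?B + Suc d < length p" using pb[of "Suc d"] d by (simp_all add: L_def)
      then show "Suc ?B + 0 + d < length p \<and> p ! (Suc ?B + 0 + d) = reloc (Suc ?B) (fo ! d)"
        using d unfolding blk by (simp add: nth_append)
    qed
    have i1: "p ! (Suc ?B + ?l) = Copy (Suc M) (k + N)" "Suc ?B + ?l < length p"
      using pb[of "Suc ?l"] unfolding blk by (simp_all add: L_def nth_append)
    have i2: "p ! (?B + (?l + 2 + d)) = Zero (M + d)" "?B + (?l + 2 + d) < length p" if "d < N - M" for d
      using pb[of "?l + 2 + d"] that unfolding blk by (simp_all add: L_def nth_append)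
    have "brun p z ?B (?B + L) ?U (?B, E) (Suc ?B, E(M := E (k + N)))"
      by (rule brun_step) (use i0 MN in \<open>auto simp: L_def\<close>)
    moreover have args: "map (E(M := E (k + N))) [M] = [R k]" using E(3) by simp
    obtain E1 where E1: "brun p z ?B (?B + L) ?U (Suc ?B, E(M := E (k + N))) (Suc ?B + ?l, E1)" "E1 (Suc M) = ?v"
      by (rule computesD'[OF fo cat orc_eval args, of ?B "?B + L" ?U "Suc ?B + ?l"]) (use MN in \<open>auto simp: L_def keep_def\<close>)
    ultimately have b1: "brun p z ?B (?B + L) ?U (?B, E) (Suc ?B + ?l, E1)" using brun_trans by blast
    then obtain T1 where T1: "run p z (?B, E) T1 (Suc ?B + ?l, E1)"
      "\<forall>e\<in>T1. ?B \<le> fst e \<and> fst e < ?B + L \<and> (\<forall>r\<in>?U. snd e r = snd (?B, E) r)"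
      unfolding brun_def by blast
    have E1U: "E1 r = E r" if "r \<in> ?U" for r using b1 that unfolding brun_def by auto
    have nh: "\<not> halted p (Suc ?B + ?l, E1)" using i1 by (simp add: halted_def)
    define E2 where "E2 = E1(k + N := ?v)"
    have s2: "Defs.step p z (Suc ?B + ?l, E1) = (?B + (?l + 2), E2)"
      using nh i1 E1(2) by (simp add: step_def E2_def)
    let ?Z = "\<lambda>d r. if M \<le> r \<and> r < M + d then 0 else E2 r"
    have "d \<le> N - M \<Longrightarrow> brun p z ?B (?B + L) ?U (?B + (?l + 2), E2) (?B + (?l + 2 + d), ?Z d)" for d
    proof (induction d)
      case 0
      have "?Z 0 = E2" by (simp add: fun_eq_iff)
      then show ?case using brun_refl by simp
    next
      case (Suc d)
      have "(?Z d)(M + d := 0) = ?Z (Suc d)" by (auto simp: fun_eq_iff)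
      then have "brun p z ?B (?B + L) ?U (?B + (?l + 2 + d), ?Z d) (?B + (?l + 2 + Suc d), ?Z (Suc d))"
        using Suc.prems i2[of d] by (intro brun_step) (auto simp: L_def)
      then show ?case using Suc brun_trans by (meson Suc_leD)
    qed
    from this[of "N - M"] have b3: "brun p z ?B (?B + L) ?U (?B + (?l + 2), E2) (?B + L, ?Z (N - M))"
      by (simp add: L_def)
    have fin: "(?B + L, ?Z (N - M)) = emb J ?c'"
    proof -
      have "?Z (N - M) r = snd (emb J ?c') r" for r
      proof -
        consider "r < M" | "M \<le> r" "r < N" | "N \<le> r" by linarith
        then show ?thesis
        proof cases
          case 1
          then show ?thesis using E1U[of r] E(1) MN by (simp add: emb_regs E2_def)
        next
          case 2
          then show ?thesis using MN by (simp add: emb_regs)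
        next
          case 3
          then obtain u where u: "r = u + N" by (metis le_add_diff_inverse2)
          then show ?thesis using E1U[of r] E(3)[of u] MN c' by (simp add: emb_regs E2_def)
        qed
      qed
      then have "?Z (N - M) = snd (emb J ?c')" by (rule ext)
      moreover have "?B + L = fst (emb J ?c')" using c' by (simp add: emb_regs)
      ultimately show ?thesis by (simp only: prod.collapse)
    qed
    obtain T3 where T3: "run p z (?B + (?l + 2), E2) T3 (emb J ?c')"
      "\<forall>e\<in>T3. ?B \<le> fst e \<and> fst e < ?B + L \<and> (\<forall>r\<in>?U. snd e r = snd (?B + (?l + 2), E2) r)"
      using b3 unfolding fin brun_def by blast
    let ?T = "insert (Suc ?B + ?l, E1) T1 \<union> T3"
    have "run p z (?B, E) ?T (emb J ?c')"
      using run_trans[OF T3(1)] run.step[OF T1(1) nh] unfolding s2 by blast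
    moreover have "emb J c \<in> ?T" using run_start[OF T1(1)] embc by auto
    moreover have "base + L * fst c \<le> fst e \<and> (\<forall>r<M. snd e r = J r) \<and>
      (\<forall>r. snd e (r + N) = snd c r \<or> snd e (r + N) = snd ?c' r)" if "e \<in> ?T" for e
    proof -
      have E2U: "E2 r = J r" if "r < M" for r using E1U[of r] E(1) that MN by (simp add: E2_def)
      have E2N: "E2 (r + N) = snd ?c' r" for r using E1U[of "r + N"] E(3) by (simp add: E2_def c')
      from \<open>e \<in> ?T\<close> consider "e = (Suc ?B + ?l, E1)" | "e \<in> T1" | "e \<in> T3" by blast
      then show ?thesis
      proof cases
        case 1
        then show ?thesis using E1U E c by simp
      next
        case 2
        then show ?thesis using T1(2) E c by simp
      next
        case 3
        then show ?thesis using T3(2) E2U E2N c by simp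
      qed
    qed
    ultimately show ?thesis unfolding embc by blast
  qed
qed

text \<open>The simulation commutes with limits: block starts realize every simulated configuration,
  and the bounds on \<open>T\<close> exclude additional recurring values. The final \<open>d\<close>
  is included because a block may already show the register contents of the next
  configuration.\<close>

lemma sim_run:
  assumes "run (P n) x c S d"
  shows "\<exists>T. run p z (emb J c) T (emb J d) \<and> (\<forall>e\<in>S. emb J e \<in> T) \<and>
    (\<forall>e\<in>T. (\<exists>c1\<in>S. base + L * fst c1 \<le> fst e) \<and> (\<forall>r<M. snd e r = J r) \<and>
      (\<forall>r. \<exists>c1\<in>insert d S. snd e (r + N) = snd c1 r))"
  using assms
proof (induction rule: run.induct)
  case (refl c)
  show ?case by (intro exI[of _ "{}"]) (simp add: run.refl)
next
  case (step c S d)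
  obtain T where T: "run p z (emb J c) T (emb J d)" "\<forall>e\<in>S. emb J e \<in> T"
    "\<forall>e\<in>T. (\<exists>c1\<in>S. base + L * fst c1 \<le> fst e) \<and> (\<forall>r<M. snd e r = J r) \<and>
      (\<forall>r. \<exists>c1\<in>insert d S. snd e (r + N) = snd c1 r)" using step.IH by blast
  obtain T' where T': "run p z (emb J d) T' (emb J (Defs.step (P n) x d))" "emb J d \<in> T'"
    "\<forall>e\<in>T'. base + L * fst d \<le> fst e \<and> (\<forall>r<M. snd e r = J r) \<and>
      (\<forall>r. snd e (r + N) = snd d r \<or> snd e (r + N) = snd (Defs.step (P n) x d) r)" using sim_step[OF step.hyps(2)] by blast
  have "run p z (emb J c) (T \<union> T') (emb J (Defs.step (P n) x d))" using run_trans[OF T'(1) T(1)] .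
  moreover have "\<forall>e\<in>insert d S. emb J e \<in> T \<union> T'" using T(2) T'(2) by blast
  moreover have "\<forall>e\<in>T \<union> T'. (\<exists>c1\<in>insert d S. base + L * fst c1 \<le> fst e) \<and> (\<forall>r<M. snd e r = J r) \<and>
      (\<forall>r. \<exists>c1\<in>insert (Defs.step (P n) x d) (insert d S). snd e (r + N) = snd c1 r)"
    using T(3) T'(3) by blast
  ultimately show ?case by blast
next
  case (lim f A)
  have "\<forall>i. \<exists>T. run p z (emb J (f i)) T (emb J (f (Suc i))) \<and> (\<forall>e\<in>A i. emb J e \<in> T) \<and>
    (\<forall>e\<in>T. (\<exists>c1\<in>A i. base + L * fst c1 \<le> fst e) \<and> (\<forall>r<M. snd e r = J r) \<and>
      (\<forall>r. \<exists>c1\<in>insert (f (Suc i)) (A i). snd e (r + N) = snd c1 r))" using lim.IH by blast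
  from choice[OF this] obtain T where T': "\<forall>i. run p z (emb J (f i)) (T i) (emb J (f (Suc i))) \<and> (\<forall>e\<in>A i. emb J e \<in> T i) \<and>
    (\<forall>e\<in>T i. (\<exists>c1\<in>A i. base + L * fst c1 \<le> fst e) \<and> (\<forall>r<M. snd e r = J r) \<and>
      (\<forall>r. \<exists>c1\<in>insert (f (Suc i)) (A i). snd e (r + N) = snd c1 r))" ..
  have T1: "run p z (emb J (f i)) (T i) (emb J (f (Suc i)))" for i using T' by blast
  have T2: "emb J e \<in> T i" if "e \<in> A i" for e i using T' that by blast
  have T3: "\<exists>c1\<in>A i. base + L * fst c1 \<le> fst e" "\<And>r. r < M \<Longrightarrow> snd e r = J r"
    "\<And>r. \<exists>c1\<in>insert (f (Suc i)) (A i). snd e (r + N) = snd c1 r" if "e \<in> T i" for e i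
    using T' that by blast+
  have fA: "f i \<in> A i" for i using run_start[OF lim.hyps(1)[of i]] lim.hyps(2)[of i] by blast
  have Tne: "T i \<noteq> {}" for i using T2[OF fA] by blast
  have run: "run p z (emb J (f 0)) (\<Union>i. T i) (limc T)"
    using run.lim[of p z "\<lambda>i. emb J (f i)" T] T1 Tne by blast
  have "limc T = emb J (limc A)"
  proof (rule prod_eqI)
    let ?A = "\<lambda>i. fst ` A i"
    \<comment> \<open>The program counter of a running program is bounded, so its liminf is a
      recurring value. Otherwise the default 0 would not be mapped to \<open>base\<close>.\<close>
    have "fst e < length (P n)" if "e \<in> A i" for e i
      using run_not_halted[OF lim.hyps(1) that] by (simp add: halted_def)
    moreover have "?A i \<noteq> {}" for i using fA by blast
    ultimately have ex: "\<exists>v. often ?A v" by (intro often_bounded[of _ "length (P n)"]) auto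
    obtain k where k: "\<And>i w. i \<ge> k \<Longrightarrow> w \<in> ?A i \<Longrightarrow> liminf ?A \<le> w" using eventually_ge_liminf[of ?A] by blast
    have "liminf (\<lambda>i. fst ` T i) = base + L * liminf ?A"
    proof (rule liminf_eqI')
      show "often (\<lambda>i. fst ` T i) (base + L * liminf ?A)"
        unfolding often_def
      proof
        fix i
        obtain i' e where "i' \<ge> i" "e \<in> A i'" "liminf ?A = fst e"
          using often_liminf[OF ex] unfolding often_def by blast
        then show "\<exists>m\<ge>i. base + L * liminf ?A \<in> fst ` T m"
          using T2[of e i'] emb_regs(4)[of J e] by (metis image_eqI)
      qed
      show "base + L * liminf ?A \<le> w" if i: "i \<ge> k" and w: "w \<in> fst ` T i" for i w
      proof -
        obtain c1 where c1: "c1 \<in> A i" "base + L * fst c1 \<le> w" using T3(1) w by blast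
        then have "liminf ?A \<le> fst c1" using k[OF i] by blast
        then have "L * liminf ?A \<le> L * fst c1" by (rule mult_le_mono2)
        then show ?thesis using c1(2) by linarith
      qed
    qed
    then show "fst (limc T) = fst (emb J (limc A))" by (simp add: limc_def emb_def)
    show "snd (limc T) = snd (emb J (limc A))"
    proof
      fix r
      consider "r < M" | "M \<le> r" "r < N" | "N \<le> r" by linarith
      then show "snd (limc T) r = snd (emb J (limc A)) r"
      proof cases
        case 1
        have "snd (limc T) r = J r"
          unfolding limc_def snd_conv by (rule liminf_const) (use Tne T3(2) 1 in blast)+
        then show ?thesis using 1 by (simp add: emb_regs)
      next
        case 2
        \<comment> \<open>Scratch is zero at every block start, so its liminf is 0 although oracle
          blocks write to it.\<close>
        have "0 \<in> (\<lambda>d. snd d r) ` T i" for i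
          using T2[OF fA, of i] emb_regs(2)[OF 2, of J "f i"] by force
        then have "snd (limc T) r = 0"
          unfolding limc_def snd_conv by (intro liminf_eqI) (auto simp: often_def)
        then show ?thesis using 2 by (simp add: emb_regs)
      next
        case 3
        then obtain u where u: "r = u + N" by (metis le_add_diff_inverse2)
        have "often (\<lambda>i. (\<lambda>d. snd d r) ` T i) v \<longleftrightarrow> often (\<lambda>i. (\<lambda>d. snd d u) ` A i) v" for v
        proof
          assume o: "often (\<lambda>i. (\<lambda>d. snd d r) ` T i) v"
          show "often (\<lambda>i. (\<lambda>d. snd d u) ` A i) v"
            unfolding often_def
          proof
            fix i
            obtain i' e where e: "i' \<ge> i" "e \<in> T i'" "v = snd e r" using o unfolding often_def by blast
            then obtain c1 where "c1 \<in> insert (f (Suc i')) (A i')" "v = snd c1 u" using T3(3) u by metis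
            \<comment> \<open>A value that appears one configuration early belongs to the next
              segment, which starts with \<open>f (Suc i')\<close>.\<close>
            then have "v \<in> (\<lambda>d. snd d u) ` A i' \<or> v \<in> (\<lambda>d. snd d u) ` A (Suc i')" using fA by blast
            then show "\<exists>m\<ge>i. v \<in> (\<lambda>d. snd d u) ` A m" using e(1) by (meson le_SucI)
          qed
        next
          assume o: "often (\<lambda>i. (\<lambda>d. snd d u) ` A i) v"
          show "often (\<lambda>i. (\<lambda>d. snd d r) ` T i) v"
            unfolding often_def
          proof
            fix i
            obtain i' e where e: "i' \<ge> i" "e \<in> A i'" "v = snd e u" using o unfolding often_def by blast
            then have "v = snd (emb J e) r" using u emb_regs(3) by simp
            then show "\<exists>m\<ge>i. v \<in> (\<lambda>d. snd d r) ` T m" using e(1) T2[OF e(2)] by blast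
          qed
        qed
        then have "often (\<lambda>i. (\<lambda>d. snd d r) ` T i) = often (\<lambda>i. (\<lambda>d. snd d u) ` A i)" by blast
        then have "snd (limc T) r = snd (limc A) u" by (simp only: limc_def snd_conv liminf_def)
        then show ?thesis using u emb_regs(3) by simp
      qed
    qed
  qed
  then have t1: "run p z (emb J (f 0)) (\<Union>i. T i) (emb J (limc A))" using run by simp
  have t2: "\<forall>e\<in>\<Union>i. A i. emb J e \<in> (\<Union>i. T i)" using T2 by blast
  have t3: "(\<exists>c1\<in>\<Union>i. A i. base + L * fst c1 \<le> fst e) \<and> (\<forall>r<M. snd e r = J r) \<and>
      (\<forall>r. \<exists>c1\<in>insert (limc A) (\<Union>i. A i). snd e (r + N) = snd c1 r)" if e: "e \<in> (\<Union>i. T i)" for e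
  proof -
    obtain i where i: "e \<in> T i" using e by blast
    have "\<exists>c1\<in>insert (limc A) (\<Union>i. A i). snd e (r + N) = snd c1 r" for r
      using T3(3)[OF i, of r] fA[of "Suc i"] by blast
    then show ?thesis using T3(1,2)[OF i] by blast
  qed
  show ?case
    by (rule exI[of _ "\<Union>i. T i"], rule conjI[OF t1], rule conjI[OF t2], rule ballI, rule t3)
qed

text \<open>The output is \<open>J 0\<close>, since register 0 lies below \<open>M\<close> and is
  not a simulated register.\<close>

lemma sim_halting:
  assumes "run p z init_config S0 (emb J init_config)" "halting_run (P n) x out"
  shows "halting_run p z (J 0)"
proof -
  obtain S d where "run (P n) x init_config S d" "halted (P n) d"
    using assms(2) unfolding halting_run_def by blast
  moreover from this obtain T where "run p z (emb J init_config) T (emb J d)" using sim_run by blast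
  moreover have "halted p (emb J d)" if "halted (P n) d"
    using that p_length by (simp add: halted_def emb_regs)
  moreover have "snd (emb J d) 0 = J 0" using M by (simp add: emb_regs)
  ultimately show ?thesis using run_trans[OF _ assms(1)] unfolding halting_run_def by blast
qed

text \<open>The embedding is monotone in every entry, check registers stay constant and scratch is 0
  at the start of the loop. So domination carries over from the simulated loop to the host.\<close>

lemma sim_looping:
  assumes "run p z init_config S0 (emb J init_config)" "looping (P n) x"
  shows "looping p z"
proof -
  obtain S c T where r: "run (P n) x init_config S c" "run (P n) x c T c" "T \<noteq> {}"
    and T: "\<And>d e. d \<in> T \<Longrightarrow> entry c e \<le> entry d e"
    using assms(2) unfolding looping_def by blast
  obtain S' where S': "run p z (emb J init_config) S' (emb J c)" using sim_run[OF r(1)] by blast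
  obtain T' where T': "run p z (emb J c) T' (emb J c)" "\<forall>e\<in>T. emb J e \<in> T'"
    "\<forall>e\<in>T'. (\<exists>c1\<in>T. base + L * fst c1 \<le> fst e) \<and> (\<forall>r<M. snd e r = J r) \<and>
      (\<forall>r. \<exists>c1\<in>insert c T. snd e (r + N) = snd c1 r)" using sim_run[OF r(2)] by blast
  have "entry (emb J c) i \<le> entry e i" if e: "e \<in> T'" for e i
  proof (cases i)
    case 0
    obtain c1 where c1: "c1 \<in> T" "base + L * fst c1 \<le> fst e" using T'(3) e by blast
    then have "fst c \<le> fst c1" using T[of c1 0] by simp
    then have "L * fst c \<le> L * fst c1" by (rule mult_le_mono2)
    then have "base + L * fst c \<le> fst e" using c1(2) by linarith
    then show ?thesis using 0 by (simp add: emb_regs)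
  next
    case (Suc r)
    consider "r < M" | "M \<le> r" "r < N" | "N \<le> r" by linarith
    then have "snd (emb J c) r \<le> snd e r"
    proof cases
      case 1
      then show ?thesis using T'(3) e by (simp add: emb_regs)
    next
      case 2
      then show ?thesis by (simp add: emb_regs)
    next
      case 3
      then obtain u where u: "r = u + N" by (metis le_add_diff_inverse2)
      obtain c1 where c1: "c1 \<in> insert c T" "snd e (u + N) = snd c1 u" using T'(3) e by blast
      then have "snd c u \<le> snd c1 u" using T[of c1 "Suc u"] by auto
      then show ?thesis using u c1(2) by (simp add: emb_regs)
    qed
    then show ?thesis using Suc by simp
  qed
  moreover have "T' \<noteq> {}" using r(3) T'(2) by blast
  ultimately show ?thesis unfolding looping_def using run_trans[OF S' assms(1)] T'(1) by blast
qed

end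

section \<open>Computing program indices\<close>

fun code_of :: "instr \<Rightarrow> nat" where
  "code_of (Zero r) = 5 * r"
| "code_of (Inc r) = 5 * r + 1"
| "code_of (Copy i j) = 5 * prod_encode (i, j) + 2"
| "code_of (Jeq i j t) = 5 * prod_encode (i, prod_encode (j, t)) + 3"
| "code_of (Orc r) = 5 * r + 4"

lemma instr_of_code_of: "instr_of (code_of a) = a"
proof (cases a)
  case (Inc r)
  have "(5 * r + 1) mod 5 = 1" "(5 * r + 1) div 5 = r" by presburger+
  then show ?thesis using Inc by (simp add: instr_of_def)
next
  case (Copy i j)
  have "(5 * k + 2) mod 5 = 2" "(5 * k + 2) div 5 = k" for k :: nat by presburger+
  then show ?thesis using Copy by (simp add: instr_of_def)
next
  case (Jeq i j t)
  have "(5 * k + 3) mod 5 = 3" "(5 * k + 3) div 5 = k" for k :: nat by presburger+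
  then show ?thesis using Jeq by (simp add: instr_of_def)
next
  case (Orc r)
  have "(5 * r + 4) mod 5 = 4" "(5 * r + 4) div 5 = r" by presburger+
  then show ?thesis using Orc by (simp add: instr_of_def)
qed (simp add: instr_of_def)

text \<open>List encoding with an explicit code \<open>c\<close> for the rest, so that concatenation
  becomes composition.\<close>

definition enc :: "instr list \<Rightarrow> nat \<Rightarrow> nat" where
  "enc as c = foldr (\<lambda>a c. Suc (prod_encode (code_of a, c))) as c"

lemma enc_simps [simp]: "enc [] c = c" "enc (a # as) c = Suc (prod_encode (code_of a, enc as c))"
  "enc (as @ bs) c = enc as (enc bs c)"
  by (simp_all add: enc_def)

lemma P_enc: "P (enc as 0) = as"
proof -
  have "enc as 0 = list_encode (map code_of as)" by (induction as) simp_all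
  then show ?thesis by (simp add: P_def instr_of_code_of comp_def)
qed

text \<open>Computability of a program-valued function, stated as prepending to an arbitrary
  computable tail. In this form it is closed under concatenation without a recursion on
  codes.\<close>

definition ucode :: "nat set set \<Rightarrow> nat \<Rightarrow> (nat set \<Rightarrow> nat list \<Rightarrow> instr list) \<Rightarrow> bool" where
  "ucode D n X \<longleftrightarrow> (\<forall>C. ucomp D n C \<longrightarrow> ucomp D n (\<lambda>z xs. enc (X z xs) (C z xs)))"

lemma ucomp_enc: "ucode D n X \<Longrightarrow> ucomp D n C \<Longrightarrow> ucomp D n (\<lambda>z xs. enc (X z xs) (C z xs))"
  by (simp add: ucode_def)

lemma ucode_Nil: "ucode D n (\<lambda>z xs. [])"
  by (simp add: ucode_def)

lemma ucode_Cons: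
  "ucomp D n (\<lambda>z xs. code_of (x z xs)) \<Longrightarrow> ucode D n X \<Longrightarrow> ucode D n (\<lambda>z xs. x z xs # X z xs)"
  unfolding ucode_def by (simp add: ucomp_Suc ucomp_prod_encode)

lemma ucode_append: "ucode D n X \<Longrightarrow> ucode D n Y \<Longrightarrow> ucode D n (\<lambda>z xs. X z xs @ Y z xs)"
  unfolding ucode_def by simp

lemma ucode_const: "ucode D n (\<lambda>z xs. as)"
  by (induction as) (simp_all add: ucode_Nil ucode_Cons ucomp_const)

lemma ucode_reloc:
  assumes "ucomp D n F"
  shows "ucode D n (\<lambda>z xs. map (reloc (F z xs)) as)"
proof (induction as)
  case Nil
  show ?case by (simp add: ucode_Nil)
next
  case (Cons a as)
  have "ucomp D n (\<lambda>z xs. code_of (reloc (F z xs) a))"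
    by (cases a) (simp_all add: ucomp_const, intro ucomp_intros assms)
  then show ?case using Cons by (simp add: ucode_Cons)
qed

text \<open>The index is a readily available upper bound for the length, used both to bound the
  recursion over the instructions and to obtain a halting address.\<close>

lemma length_list_decode_le: "length (list_decode n) \<le> n"
proof (induction n rule: list_decode.induct)
  case (2 n)
  obtain a b where ab: "prod_decode n = (a, b)" by fastforce
  then have "n = prod_encode (a, b)" by (metis prod_decode_inverse)
  then have "b \<le> n" using le_prod_encode_2 by simp
  moreover have "length (list_decode b) \<le> b" using 2 ab by simp
  ultimately show ?case using ab by simp
qed simp

section \<open>Computability of the simulating program\<close>

context block_code
begin

lemma code_of_shift_instr:
  "m mod 5 \<noteq> 4 \<Longrightarrow> code_of (shift_instr (instr_of m)) =
    (if m mod 5 = 0 then 5 * (m div 5 + N)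
     else if m mod 5 = 1 then 5 * (m div 5 + N) + 1
     else if m mod 5 = 2 then 5 * prod_encode (fst (prod_decode (m div 5)) + N, snd (prod_decode (m div 5)) + N) + 2
     else 5 * prod_encode (fst (prod_decode (m div 5)) + N,
       prod_encode (fst (prod_decode (snd (prod_decode (m div 5)))) + N,
         base + L * snd (prod_decode (snd (prod_decode (m div 5)))))) + 3)"
proof -
  assume "m mod 5 \<noteq> 4"
  moreover have "m mod 5 < 5" by simp
  ultimately consider "m mod 5 = 0" | "m mod 5 = 1" | "m mod 5 = 2" | "m mod 5 = 3" by linarith
  then show ?thesis by cases (simp_all add: instr_of_def Let_def)
qed

text \<open>In both cases the block has a fixed shape, and only the operands of its instructions
  depend on the inputs.\<close>

lemma ucode_block:
  assumes "ucomp D n I" "ucomp D n F"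
  shows "ucode D n (\<lambda>z xs. block (I z xs) (F z xs))"
proof -
  let ?last = "\<lambda>m. if m mod 5 = 0 then 5 * (m div 5 + N)
     else if m mod 5 = 1 then 5 * (m div 5 + N) + 1
     else if m mod 5 = 2 then 5 * prod_encode (fst (prod_decode (m div 5)) + N, snd (prod_decode (m div 5)) + N) + 2
     else 5 * prod_encode (fst (prod_decode (m div 5)) + N,
       prod_encode (fst (prod_decode (snd (prod_decode (m div 5)))) + N,
         base + L * snd (prod_decode (snd (prod_decode (m div 5)))))) + 3"
  have orc: "ucode D n (\<lambda>z xs. Copy (F z xs div 5 + N) M # map (reloc (Suc (base + L * I z xs))) fo @
      Copy (Suc M) (F z xs div 5 + N) # map Zero [M..<N])"
    by (intro ucode_Cons ucode_append ucode_reloc ucode_const; (unfold code_of.simps)?; intro ucomp_intros assms)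
  have last: "ucomp D n (\<lambda>z xs. ?last (F z xs))" by (intro ucomp_intros assms)
  show ?thesis
    unfolding ucode_def
  proof (intro allI impI)
    fix C assume C: "ucomp D n C"
    have "ucomp D n (\<lambda>z xs. if F z xs mod 5 = 4
        then enc (Copy (F z xs div 5 + N) M # map (reloc (Suc (base + L * I z xs))) fo @
          Copy (Suc M) (F z xs div 5 + N) # map Zero [M..<N]) (C z xs)
        else enc (replicate (L - 1) (Zero M)) (Suc (prod_encode (?last (F z xs), C z xs))))"
      by (intro ucomp_if ucomp_enc[OF orc C] ucomp_enc[OF ucode_const] ucomp_Suc ucomp_prod_encode last C
          udec_eq ucomp_mod5 ucomp_const assms)
    then show "ucomp D n (\<lambda>z xs. enc (block (I z xs) (F z xs)) (C z xs))"
      by (rule ucomp_cong) (simp add: block_def code_of_shift_instr)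
  qed
qed

definition blocks :: "nat \<Rightarrow> instr list" where
  "blocks n = concat (map (\<lambda>i. block i (list_decode n ! i)) [0..<length (list_decode n)])"

text \<open>The list is built from its end: with \<open>ys\<close> listing the current code, the
  step number t and the index n, step t prepends block n - 1 - t. Positions beyond the end of the
  program are skipped.\<close>

lemma ucomp_blocks: "ucomp D (Suc 0) (\<lambda>z xs. enc (blocks (xs ! 0)) 0)"
proof -
  let ?i = "\<lambda>ys. ys ! 2 - 1 - ys ! 1"
  let ?G = "\<lambda>(z :: nat set) ys. if code_drop (ys ! 2) (?i ys) = 0 then ys ! 0
     else enc (block (?i ys) (code_nth (ys ! 2) (?i ys))) (ys ! 0)"
  have "ucomp D (Suc 0) (\<lambda>z xs. rec_nat 0 (\<lambda>t y. ?G z (y # t # xs)) (xs ! 0))"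
    by (intro ucomp_rec ucomp_enc ucode_block ucomp_code_drop ucomp_code_nth ucomp_intros) simp_all
  moreover have "rec_nat 0 (\<lambda>t y. ?G z (y # t # xs)) (xs ! 0) = enc (blocks (xs ! 0)) 0"
    if l: "length xs = Suc 0" for z :: "nat set" and xs :: "nat list"
  proof -
    obtain n where xs: "xs = [n]" using l by (auto simp: length_Suc_conv)
    let ?blk = "\<lambda>i. if i < length (list_decode n) then block i (list_decode n ! i) else []"
    have len: "length (list_decode n) \<le> n" by (rule length_list_decode_le)
    have "t \<le> n \<Longrightarrow> rec_nat 0 (\<lambda>t y. ?G z (y # t # xs)) t = enc (concat (map ?blk [n - t..<n])) 0" for t
    proof (induction t)
      case 0
      show ?case by simp
    next
      case (Suc t)
      then have up: "[n - Suc t..<n] = (n - 1 - t) # [n - t..<n]"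
        by (subst upt_rec) (auto simp: Suc_diff_Suc)
      have IH: "rec_nat 0 (\<lambda>t y. ?G z (y # t # xs)) t = enc (concat (map ?blk [n - t..<n])) 0"
        using Suc by simp
      have "rec_nat 0 (\<lambda>t y. ?G z (y # t # xs)) (Suc t) = enc (?blk (n - 1 - t)) (rec_nat 0 (\<lambda>t y. ?G z (y # t # xs)) t)"
        by (simp add: xs code_drop_eq_0 code_nth_eq not_le)
      then show ?case unfolding up IH by simp
    qed
    from this[of n] have "rec_nat 0 (\<lambda>t y. ?G z (y # t # xs)) n = enc (concat (map ?blk [0..<n])) 0" by simp
    also have "[0..<n] = [0..<length (list_decode n)] @ [length (list_decode n)..<n]"
      using len upt_add_eq_append[of 0 "length (list_decode n)" "n - length (list_decode n)"] by simp
    also have "concat (map ?blk ([0..<length (list_decode n)] @ [length (list_decode n)..<n])) = blocks n"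
    proof -
      have e1: "concat (map ?blk [length (list_decode n)..<n]) = []" by simp
      have e2: "map ?blk [0..<length (list_decode n)] = map (\<lambda>i. block i (list_decode n ! i)) [0..<length (list_decode n)]"
        by simp
      show ?thesis unfolding blocks_def map_append concat_append e1 e2 by (rule append_Nil2)
    qed
    finally show ?thesis by (simp add: xs)
  qed
  ultimately show ?thesis by (rule ucomp_cong)
qed

lemma length_concat_blocks: "length (concat (map (\<lambda>i. block i (g i)) [0..<k])) = L * k"
  by (induction k) (simp_all add: length_block)

lemma length_blocks: "length (blocks n) = L * length (P n)"
  unfolding blocks_def length_concat_blocks by (simp add: P_def)

lemma nth_concat_blocks:
  "i < k \<Longrightarrow> d < L \<Longrightarrow> concat (map (\<lambda>i. block i (g i)) [0..<k]) ! (L * i + d) = block i (g i) ! d"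
proof (induction k)
  case (Suc k)
  have len: "length (concat (map (\<lambda>i. block i (g i)) [0..<k])) = L * k" by (rule length_concat_blocks)
  show ?case
  proof (cases "i < k")
    case True
    then have "L * Suc i \<le> L * k" by (intro mult_le_mono2) simp
    then have "L * i + d < L * k" using Suc.prems by simp
    then show ?thesis using Suc.IH[OF True Suc.prems(2)] len by (simp add: nth_append)
  next
    case False
    then have "i = k" using Suc.prems by simp
    then show ?thesis using len by (simp add: nth_append)
  qed
qed simp

lemma nth_blocks:
  "i < length (P n) \<Longrightarrow> d < L \<Longrightarrow> blocks n ! (L * i + d) = block i (list_decode n ! i) ! d"
  unfolding blocks_def by (rule nth_concat_blocks) (simp_all add: P_def)

end

lemma reloc_0: "reloc 0 a = a"
  by (cases a) auto

lemma cat_prefix: "cat (as @ bs) 0 0 as"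
  by (simp add: cat_def reloc_0 nth_append)

lemma brun_run: "brun p z lo hi U c d \<Longrightarrow> \<exists>S. run p z c S d"
  unfolding brun_def by blast

section \<open>Reduction of the iterated jumps to the recognizable jump\<close>

text \<open>The program outputs 1 on the empty oracle and 0 on every other non-certificate; on
  certificates it simulates \<open>P n\<close> with output 0. If \<open>P n\<close> halts, the empty
  set is recognized; if not, divergence on an existing certificate prevents any recognition.\<close>

lemma jump_reduction:
  "\<exists>idx. ucomp UNIV (Suc 0) (\<lambda>z xs. idx (xs ! 0)) \<and>
    (\<forall>n. n \<in> itrm_jump_iter (Suc i) \<longleftrightarrow> idx n \<in> itrm_rec_jump)"
proof -
  obtain f0 N0 where f0: "tests f0 N0 UNIV (\<lambda>z. z \<noteq> {})" using nonempty_test by blast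
  obtain f1 N1 where f1: "tests f1 N1 UNIV (\<lambda>z. z \<in> total_graphs)" using total_graph_test by blast
  obtain f2 N2 where f2: "tests f2 N2 total_graphs (\<lambda>z. certificate (graph_fun z))" using certificate_test by blast
  define M where "M = Max {N0, N1, N2}"
  have Mmax: "N0 \<le> M" "N1 \<le> M" "N2 \<le> M" unfolding M_def by simp_all
  have M8: "8 \<le> M" using f0 Mmax(1) unfolding tests_def by linarith
  have "udec total_graphs (Suc 0) (\<lambda>z xs. cert_oracle (graph_fun z) i (xs ! 0))"
    by (intro udec_cert_oracle ucomp_intros) simp
  then obtain q where q: "\<forall>z\<in>total_graphs. \<forall>xs. length xs = Suc 0 \<longrightarrow>
      reval z q xs (if cert_oracle (graph_fun z) i (xs ! 0) then 1 else 0)"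
    unfolding udec_def ucomp_def ..
  obtain fo N where fo: "computes fo N q [M] (Suc M) (M + 2)" using compile[of "[M]" "M + 2" "Suc M" q] by auto
  define l0 where "l0 = length f0"
  define l1 where "l1 = l0 + length f1"
  define l2 where "l2 = l1 + length f2"
  define base where "base = l2 + 6"
  interpret block_code base M N fo q using fo M8 by unfold_locales auto
  \<comment> \<open>Address \<open>l2 + 4\<close> sets the output to 1 and falls through to the exit
    jump at \<open>l2 + 5\<close>, the common target of all rejections; the simulated program starts
    right behind it, at \<open>base\<close>. Totality is tested before the certificate test, which
    is correct only on total graphs.\<close>
  define pre where "pre = f0 @ [Jeq 1 5 (l2 + 4)] @ map (reloc (l0 + 1)) f1 @ [Jeq 1 5 (l2 + 5)] @
    map (reloc (l1 + 2)) f2 @ [Jeq 1 5 (l2 + 5), Jeq 0 0 base, Inc 0]"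
  define prog where "prog n = pre @ [Jeq 0 0 (base + L * n)] @ blocks n" for n
  have len_pre: "length pre = l2 + 5" by (simp add: pre_def l0_def l1_def l2_def)
  have len_prog: "length (prog n) = base + L * length (P n)" for n
  proof -
    have "length (prog n) = length pre + 1 + length (blocks n)" by (simp add: prog_def)
    then show ?thesis using length_blocks[of n] len_pre base_def by linarith
  qed
  \<comment> \<open>Since \<open>n\<close> is at least the length of \<open>P n\<close>, the target
    of the exit jump lies past the end of the program and is computable from \<open>n\<close>
    directly.\<close>
  have halt_pos: "length (prog n) \<le> base + L * n" for n
    unfolding len_prog using length_list_decode_le[of n] by (simp add: P_def mult_le_mono2)
  define idx where "idx n = enc (prog n) 0" for n
  have P_idx: "P (idx n) = prog n" for n unfolding idx_def by (rule P_enc)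
  have ucomp_idx: "ucomp UNIV (Suc 0) (\<lambda>z xs. idx (xs ! 0))"
    unfolding idx_def prog_def enc_simps code_of.simps
    by (intro ucomp_enc[OF ucode_const] ucomp_blocks ucomp_intros) simp
  have outcome: "(z = {} \<longrightarrow> halting_run (prog n) z 1) \<and>
      (z \<noteq> {} \<longrightarrow> \<not> (z \<in> total_graphs \<and> certificate (graph_fun z)) \<longrightarrow> halting_run (prog n) z 0) \<and>
      (z \<in> total_graphs \<and> certificate (graph_fun z) \<longrightarrow>
        (\<exists>J S. J 0 = 0 \<and> run (prog n) z init_config S (emb J init_config)))" for n z
  proof -
    let ?p = "prog n"
    let ?br = "brun ?p z 0 (length ?p) (insert 0 {M..})"
    have "cat ?p 0 0 pre" unfolding prog_def by (rule cat_prefix)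
    then have cats: "cat ?p 0 0 f0" "cat ?p 0 l0 [Jeq 1 5 (l2 + 4)]" "cat ?p 0 (l0 + 1) (map (reloc (l0 + 1)) f1)"
      "cat ?p 0 (l1 + 1) [Jeq 1 5 (l2 + 5)]" "cat ?p 0 (l1 + 2) (map (reloc (l1 + 2)) f2)"
      "cat ?p 0 (l2 + 2) [Jeq 1 5 (l2 + 5), Jeq 0 0 base, Inc 0]"
      unfolding pre_def cat_append length_append length_map l0_def[symmetric]
      by (simp_all del: cat_reloc cat_Cons add: l1_def l2_def add_ac eval_nat_numeral)
    have c1: "cat ?p (l0 + 1) 0 f1" and c2: "cat ?p (l1 + 2) 0 f2"
      using cats(3,5) cat_shift[of ?p 0 "l0 + 1" f1] cat_shift[of ?p 0 "l1 + 2" f2] by (simp_all del: cat_reloc)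
    have lp: "l2 + 5 < length ?p" unfolding len_prog base_def by simp
    have ins: "?p ! l0 = Jeq 1 5 (l2 + 4)" "?p ! (l1 + 1) = Jeq 1 5 (l2 + 5)" "?p ! (l2 + 2) = Jeq 1 5 (l2 + 5)"
      "?p ! (l2 + 3) = Jeq 0 0 base" "?p ! (l2 + 4) = Inc 0"
      using cats(2,4,6) by (simp_all add: eval_nat_numeral)
    have ins5: "?p ! (l2 + 5) = Jeq 0 0 (base + L * n)"
      unfolding prog_def using nth_append_length[of pre "Jeq 0 0 (base + L * n)" "blocks n"] len_pre by simp
    have ls: "l0 \<le> l1" "l1 \<le> l2" by (simp_all add: l1_def l2_def)
    have exit: "halting_run ?p z (R 0)" if r: "run ?p z init_config S (l2 + 5, R)" for S R
    proof -
      have nh: "\<not> halted ?p (l2 + 5, R)" using lp by (simp add: halted_def)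
      have "Defs.step ?p z (l2 + 5, R) = (base + L * n, R)" using nh ins5 by (simp add: step_def)
      then have "run ?p z init_config (insert (l2 + 5, R) S) (base + L * n, R)" using run.step[OF r nh] by simp
      moreover have "halted ?p (base + L * n, R)" using halt_pos by (simp add: halted_def)
      ultimately show ?thesis unfolding halting_run_def by (metis snd_conv)
    qed
    have init: "init_config = (0, \<lambda>_. 0)" by (simp add: init_config_def)
    obtain R1 where "brun ?p z 0 (0 + length f0) (insert 0 {N0..}) (0, \<lambda>_. 0) (0 + length f0, R1)"
      and R1: "R1 5 = 0" "R1 1 = (if z \<noteq> {} then 1 else 0)"
      using f0 cats(1) unfolding tests_def by blast
    then have "brun ?p z 0 l0 (insert 0 {N0..}) init_config (l0, R1)" unfolding init l0_def by simp
    then have b1: "?br init_config (l0, R1)" by (rule brun_mono) (use lp ls Mmax in auto)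
    show ?thesis
    proof (cases "z = {}")
      case True
      have "?br (l0, R1) (l2 + 4, R1)" by (rule brun_step) (use ins lp ls R1 True in auto)
      then have b2: "?br init_config (l2 + 4, R1)" using b1 brun_trans by blast
      then have "R1 0 = 0" by (simp add: brun_def init)
      obtain S where S: "run ?p z init_config S (l2 + 4, R1)" using b2 brun_run by blast
      have nh: "\<not> halted ?p (l2 + 4, R1)" using lp by (simp add: halted_def)
      have "Defs.step ?p z (l2 + 4, R1) = (l2 + 5, R1(0 := 1))"
        using nh ins \<open>R1 0 = 0\<close> by (simp add: step_def)
      then have "run ?p z init_config (insert (l2 + 4, R1) S) (l2 + 5, R1(0 := 1))" using run.step[OF S nh] by simp
      then have "halting_run ?p z 1" using exit by fastforce
      then show ?thesis using True by (simp add: total_graphs_def)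
    next
      case False
      have "?br (l0, R1) (l0 + 1, R1)" by (rule brun_step) (use ins lp ls R1 False in auto)
      then have b2: "?br init_config (l0 + 1, R1)" using b1 brun_trans by blast
      obtain R2 where "brun ?p z (l0 + 1) (l0 + 1 + length f1) (insert 0 {N1..}) (l0 + 1, R1) (l0 + 1 + length f1, R2)"
        and R2: "R2 5 = 0" "R2 1 = (if z \<in> total_graphs then 1 else 0)"
        using f1 c1 unfolding tests_def by blast
      then have "brun ?p z (l0 + 1) (l1 + 1) (insert 0 {N1..}) (l0 + 1, R1) (l1 + 1, R2)" unfolding l1_def by (simp add: add_ac)
      then have "?br (l0 + 1, R1) (l1 + 1, R2)" by (rule brun_mono) (use lp ls Mmax in auto)
      then have b3: "?br init_config (l1 + 1, R2)" using b2 brun_trans by blast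
      show ?thesis
      proof (cases "z \<in> total_graphs")
        case nt: False
        have "?br (l1 + 1, R2) (l2 + 5, R2)" by (rule brun_step) (use ins lp ls R2 nt in auto)
        then have b4: "?br init_config (l2 + 5, R2)" using b3 brun_trans by blast
        then have "R2 0 = 0" by (simp add: brun_def init)
        moreover have "halting_run ?p z (R2 0)" using b4 brun_run exit by blast
        ultimately show ?thesis using False nt by simp
      next
        case tot: True
        have "?br (l1 + 1, R2) (l1 + 2, R2)" by (rule brun_step) (use ins lp ls R2 tot in auto)
        then have b4: "?br init_config (l1 + 2, R2)" using b3 brun_trans by blast
        obtain R3 where "brun ?p z (l1 + 2) (l1 + 2 + length f2) (insert 0 {N2..}) (l1 + 2, R2) (l1 + 2 + length f2, R3)"
          and R3: "R3 5 = 0" "R3 1 = (if certificate (graph_fun z) then 1 else 0)"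
          using f2 c2 tot unfolding tests_def by blast
        then have "brun ?p z (l1 + 2) (l2 + 2) (insert 0 {N2..}) (l1 + 2, R2) (l2 + 2, R3)" unfolding l2_def by (simp add: add_ac)
        then have "?br (l1 + 2, R2) (l2 + 2, R3)" by (rule brun_mono) (use lp ls Mmax in auto)
        then have b5: "?br init_config (l2 + 2, R3)" using b4 brun_trans by blast
        show ?thesis
        proof (cases "certificate (graph_fun z)")
          case nc: False
          have "?br (l2 + 2, R3) (l2 + 5, R3)" by (rule brun_step) (use ins lp ls R3 nc in auto)
          then have b6: "?br init_config (l2 + 5, R3)" using b5 brun_trans by blast
          then have "R3 0 = 0" by (simp add: brun_def init)
          moreover have "halting_run ?p z (R3 0)" using b6 brun_run exit by blast
          ultimately show ?thesis using False nc by simp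
        next
          case cert: True
          have "?br (l2 + 2, R3) (l2 + 3, R3)" by (rule brun_step) (use ins lp ls R3 cert in auto)
          moreover have "?br (l2 + 3, R3) (base, R3)" by (rule brun_step) (use ins lp ls R3 in auto)
          ultimately have b6: "?br init_config (base, R3)" using b5 brun_trans by blast
          then have zero: "R3 0 = 0" "R3 r = 0" if "M \<le> r" for r using that by (simp_all add: brun_def init)
          have "(base, R3) = emb R3 init_config"
            by (auto simp: emb_def init fun_eq_iff zero(2))
          moreover obtain S where "run ?p z init_config S (base, R3)" using b6 brun_run by blast
          moreover have "R3 0 = 0" using zero(1)[of M] by simp
          ultimately show ?thesis using False tot cert by auto
        qed
      qed
    qed
  qed
  have sim: "block_simulation base M N fo q n (prog n) z (itrm_jump_iter i)"
    if z: "z \<in> total_graphs" "certificate (graph_fun z)" for n z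
  proof
    show "length (prog n) = base + L * length (P n)" by (rule len_prog)
    show "prog n ! (base + L * k + d) = block k (list_decode n ! k) ! d" if "k < length (P n)" "d < L" for k d
    proof -
      have "prog n = (pre @ [Jeq 0 0 (base + L * n)]) @ blocks n" by (simp add: prog_def)
      moreover have "length (pre @ [Jeq 0 0 (base + L * n)]) = base" by (simp add: len_pre base_def)
      ultimately have "prog n ! (base + (L * k + d)) = blocks n ! (L * k + d)" by (metis nth_append_length_plus)
      then show ?thesis using nth_blocks[OF that] by (simp add: add.assoc)
    qed
    show "reval z q [u] (if u \<in> itrm_jump_iter i then 1 else 0)" for u
      using q[rule_format, OF z(1), of "[u]"] by (simp flip: certificate_oracle[OF z(2)])
  qed
  have "n \<in> itrm_jump_iter (Suc i) \<longleftrightarrow> idx n \<in> itrm_rec_jump" for n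
  proof
    assume "n \<in> itrm_jump_iter (Suc i)"
    then obtain out where out: "halting_run (P n) (itrm_jump_iter i) out"
      by (auto simp: itrm_jump_def halts_iff)
    have "halts_with (prog n) z (delta z {})" for z
    proof (cases "z \<in> total_graphs \<and> certificate (graph_fun z)")
      case True
      then have "z \<noteq> {}" by (auto simp: total_graphs_def)
      obtain J S where J: "J 0 = 0" "run (prog n) z init_config S (emb J init_config)" using outcome True by blast
      interpret block_simulation base M N fo q n "prog n" z "itrm_jump_iter i" J using sim True by blast
      have "halting_run (prog n) z (J 0)" using sim_halting[OF J(2) out] .
      then show ?thesis using J(1) \<open>z \<noteq> {}\<close> by (simp add: halts_with_iff delta_def)
    next
      case False
      then show ?thesis using outcome[of z n] by (cases "z = {}") (auto simp: halts_with_iff delta_def)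
    qed
    then show "idx n \<in> itrm_rec_jump" unfolding itrm_rec_jump_def mem_Collect_eq P_idx by blast
  next
    assume "idx n \<in> itrm_rec_jump"
    then obtain y where y: "\<And>z. halts_with (prog n) z (delta z y)"
      unfolding itrm_rec_jump_def mem_Collect_eq P_idx by blast
    obtain g where g: "certificate g" using certificate_exists by blast
    define z where "z = {prod_encode (n, g n) | n. True}"
    have z: "z \<in> total_graphs" "certificate (graph_fun z)"
      using g unfolding z_def graph_fun_graph by (auto simp: total_graphs_def)
    obtain J S where J: "run (prog n) z init_config S (emb J init_config)" using outcome[of z n] z by blast
    interpret block_simulation base M N fo q n "prog n" z "itrm_jump_iter i" J using sim z by blast
    \<comment> \<open>On this certificate the host halts, so the simulated \<open>P n\<close> cannot
      loop, and halting is the only alternative.\<close>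
    have "\<not> looping (prog n) z" using y[of z] looping_not_halting unfolding halts_with_iff by blast
    then have "\<not> looping (P n) (itrm_jump_iter i)" using sim_looping[OF J] by blast
    then show "n \<in> itrm_jump_iter (Suc i)" using not_halts_looping by (auto simp: itrm_jump_def)
  qed
  then show ?thesis using ucomp_idx by blast
qed

theorem mainTheorem16:
  fixes i :: nat
  shows "turing_reducible (itrm_jump_iter i) itrm_rec_jump"
proof (cases i)
  case 0
  then show ?thesis unfolding turing_reducible_def using reval.zero by (intro exI[of _ RZ]) simp
next
  case (Suc j)
  obtain idx where idx: "ucomp UNIV (Suc 0) (\<lambda>z xs. idx (xs ! 0))"
    "\<And>n. n \<in> itrm_jump_iter i \<longleftrightarrow> idx n \<in> itrm_rec_jump"
    using jump_reduction[of j] Suc by blast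
  \<comment> \<open>A single oracle query at the computed index decides membership.\<close>
  obtain f where f: "\<forall>z\<in>UNIV. \<forall>xs. length xs = Suc 0 \<longrightarrow> reval z f xs (if idx (xs ! 0) \<in> z then 1 else 0)"
    using udec_Orc[OF idx(1)] unfolding udec_def ucomp_def ..
  show ?thesis
    unfolding turing_reducible_def idx(2)
    using f[rule_format, OF UNIV_I, of "[_]"] by (intro exI[of _ f]) simp
qed

end
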